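(* An $(\alpha,\beta)$-metric $F=\alpha\phi(s)$, $s=\beta/\alpha$, on a manifold of dimension $n\ge 3$ satisfies the $\sigma T$-condition if and only if it satisfies the $T$-condition or $\phi$ is given by $$\phi(s)=c_3\,\exp\left(\int_0^s\frac{c_1\sqrt{b^2-t^2}+c_2t}{t\,(c_1\sqrt{b^2-t^2}+c_2t)+1}\,dt\right),$$ where $c_1,c_2,c_3$ are constants and $b^2=b^ib_i$.
   Context: $(\alpha,\beta)$-metrics. $M$ is an $n$-dimensional smooth manifold with induced local coordinates $(x^i,y^i)$ on $TM$; $\alpha=\sqrt{a_{ij}(x)y^iy^j}$ is the norm of a Riemannian metric and $\beta=b_i(x)y^i$ is a 1-form. $(a^{ij})$ is the inverse of $(a_{ij})$, $b^i:=a^{ij}b_j$, $b^2:=b^ib_i$. An $(\alpha,\beta)$-metric is a function $F=\alpha\,\phi(s)$, $s:=\beta/\alpha$, on nonzero tangent vectors, where $\phi:(-b_0,b_0)\to\mathbb R$ is smooth ($b_0>0$). Standing assumptions: $\phi(t)>0$ and $\phi(t)-t\phi'(t)+(x^2-t^2)\phi''(t)>0$ for all real $t,x$ with $|t|<x<b_0$; almost regular metrics are allowed, i.e. the $\alpha$-norm of $\beta$ is only required to be $\le b_0$ at each point, and $\phi$ may be defined only on $(0,b_0)$. The choice $\phi(s)=k_1s+k_2\sqrt{b^2-s^2}$ ($k_1,k_2$ constants), for which $g_{ij}$ below is degenerate, is excluded. $T$-tensor. With $\dot\partial_i=\partial/\partial y^i$, $g_{ij}=\frac12\dot\partial_i\dot\partial_jF^2$,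 $(g^{ij})$ its inverse, $C_{ijk}=\frac12\dot\partial_kg_{ij}$, $C^s_{ij}=g^{sr}C_{rij}$, $C_{rijk}=\dot\partial_rC_{ijk}$, $\ell_i=\dot\partial_iF$, $$T_{rijk}=FC_{rijk}-F(C_{sij}C^s_{rk}+C_{sjr}C^s_{ik}+C_{sir}C^s_{jk})+C_{rij}\ell_k+C_{rik}\ell_j+C_{rjk}\ell_i+C_{ijk}\ell_r,$$ and $T^h_{ijk}:=g^{hr}T_{rijk}$. The space satisfies the $T$-condition if its $T$-tensor vanishes. It satisfies the $\sigma T$-condition if it admits a smooth function $\sigma(x)$ on $M$ such that $\sigma_hT^h_{ijk}=0$, where $\sigma_h:=\partial\sigma/\partial x^h$.
   Formalization: The function σ must be non-constant on every nonempty open set (constant σ trivializes the σT-condition); "T-condition implies σT" assumes such a σ exists on M, and "φ given by the formula implies σT" assumes such a σ with dσ∧β=0, as it fails e.g. for contact β. *)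

theory Defs
  imports "HOL-Analysis.Analysis"
begin

section \<open>Smooth functions and smooth manifolds\<close>

text \<open>Only used for open \<open>S\<close>, where the Frechet derivative is unique.\<close>

primrec Ck_on :: "nat \<Rightarrow> 'a::real_normed_vector set \<Rightarrow> ('a \<Rightarrow> 'b::real_normed_vector) \<Rightarrow> bool" where
  "Ck_on 0 S f \<longleftrightarrow> continuous_on S f"
| "Ck_on (Suc k) S f \<longleftrightarrow>
     f differentiable_on S \<and> (\<forall>v. Ck_on k S (\<lambda>x. frechet_derivative f (at x) v))"

definition smooth_on :: "'a::real_normed_vector set \<Rightarrow> ('a \<Rightarrow> 'b::real_normed_vector) \<Rightarrow> bool" where
  "smooth_on S f \<longleftrightarrow> (\<forall>k. Ck_on k S f)"

definition pd :: "'n::finite \<Rightarrow> (real^'n \<Rightarrow> real) \<Rightarrow> real^'n \<Rightarrow> real" where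
  "pd i f y = frechet_derivative f (at y) (axis i 1)"

text \<open>
  The manifold is the whole type \<open>'m\<close> (a second countable Hausdorff space in the theorem),
  equipped with an atlas of charts (domain, coordinate map). Tensor fields are given by their
  components in each chart, as functions of the coordinates, together with the transformation law.
\<close>

type_synonym ('m, 'n) chart = "'m set \<times> ('m \<Rightarrow> real^'n)"

definition chart_image :: "('m, 'n::finite) chart \<Rightarrow> (real^'n) set" where
  "chart_image c = snd c ` fst c"

definition chart_inv :: "('m, 'n::finite) chart \<Rightarrow> real^'n \<Rightarrow> 'm" where
  "chart_inv c = inv_into (fst c) (snd c)"

definition smooth_atlas :: "('m::topological_space, 'n::finite) chart set \<Rightarrow> bool" where
  "smooth_atlas A \<longleftrightarrow>
     (\<Union>c\<in>A. fst c) = UNIV \<and>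
     (\<forall>c\<in>A. open (fst c) \<and> open (chart_image c) \<and>
        homeomorphism (fst c) (chart_image c) (snd c) (chart_inv c)) \<and>
     (\<forall>c\<in>A. \<forall>d\<in>A. smooth_on (snd c ` (fst c \<inter> fst d)) (snd d \<circ> chart_inv c))"

definition smooth_function :: "('m, 'n::finite) chart set \<Rightarrow> ('m \<Rightarrow> real) \<Rightarrow> bool" where
  "smooth_function A \<sigma> \<longleftrightarrow> (\<forall>c\<in>A. smooth_on (chart_image c) (\<sigma> \<circ> chart_inv c))"

definition riemannian_metric ::
  "('m, 'n::finite) chart set \<Rightarrow> (('m, 'n) chart \<Rightarrow> real^'n \<Rightarrow> real^'n^'n) \<Rightarrow> bool" where
  "riemannian_metric A a \<longleftrightarrow>
     (\<forall>c\<in>A. smooth_on (chart_image c) (a c) \<and>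
        (\<forall>x\<in>chart_image c. transpose (a c x) = a c x \<and>
           (\<forall>v. v \<noteq> 0 \<longrightarrow> v \<bullet> (a c x *v v) > 0))) \<and>
     (\<forall>c\<in>A. \<forall>d\<in>A. \<forall>x \<in> snd c ` (fst c \<inter> fst d).
        let \<tau> = snd d \<circ> chart_inv c; J = jacobian \<tau> (at x)
        in a c x = transpose J ** a d (\<tau> x) ** J)"

definition one_form ::
  "('m, 'n::finite) chart set \<Rightarrow> (('m, 'n) chart \<Rightarrow> real^'n \<Rightarrow> real^'n) \<Rightarrow> bool" where
  "one_form A b \<longleftrightarrow>
     (\<forall>c\<in>A. smooth_on (chart_image c) (b c)) \<and>
     (\<forall>c\<in>A. \<forall>d\<in>A. \<forall>x \<in> snd c ` (fst c \<inter> fst d).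
        let \<tau> = snd d \<circ> chart_inv c
        in b c x = transpose (jacobian \<tau> (at x)) *v b d (\<tau> x))"

section \<open>The T-tensor of a fibre metric\<close>

text \<open>
  All objects below are algebraic in the point \<open>x\<close>, so \<open>F\<close> is the restriction of the Finsler
  function to one tangent space and the derivatives are the vertical ones.
\<close>

definition gF :: "(real^'n::finite \<Rightarrow> real) \<Rightarrow> real^'n \<Rightarrow> real^'n^'n" where
  "gF F y = (\<chi> i j. 1/2 * pd i (pd j (\<lambda>z. (F z)\<^sup>2)) y)"

definition gF_inv :: "(real^'n::finite \<Rightarrow> real) \<Rightarrow> real^'n \<Rightarrow> real^'n^'n" where
  "gF_inv F y = matrix_inv (gF F y)"

definition Cartan :: "(real^'n::finite \<Rightarrow> real) \<Rightarrow> 'n \<Rightarrow> 'n \<Rightarrow> 'n \<Rightarrow> real^'n \<Rightarrow> real" where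
  "Cartan F i j k y = 1/2 * pd k (\<lambda>z. gF F z $ i $ j) y"

text \<open>\<open>Cartan_up F s i j\<close> is $C^s_{ij}$.\<close>

definition Cartan_up :: "(real^'n::finite \<Rightarrow> real) \<Rightarrow> 'n \<Rightarrow> 'n \<Rightarrow> 'n \<Rightarrow> real^'n \<Rightarrow> real" where
  "Cartan_up F s i j y = (\<Sum>r\<in>UNIV. gF_inv F y $ s $ r * Cartan F r i j y)"

definition T_tensor :: "(real^'n::finite \<Rightarrow> real) \<Rightarrow> 'n \<Rightarrow> 'n \<Rightarrow> 'n \<Rightarrow> 'n \<Rightarrow> real^'n \<Rightarrow> real" where
  "T_tensor F r i j k y =
     F y * pd r (Cartan F i j k) y
     - F y * (\<Sum>s\<in>UNIV. Cartan F s i j y * Cartan_up F s r k y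
                       + Cartan F s j r y * Cartan_up F s i k y
                       + Cartan F s i r y * Cartan_up F s j k y)
     + Cartan F r i j y * pd k F y + Cartan F r i k y * pd j F y
     + Cartan F r j k y * pd i F y + Cartan F i j k y * pd r F y"

text \<open>\<open>T_tensor_up F h i j k\<close> is $T^h_{ijk}$.\<close>

definition T_tensor_up :: "(real^'n::finite \<Rightarrow> real) \<Rightarrow> 'n \<Rightarrow> 'n \<Rightarrow> 'n \<Rightarrow> 'n \<Rightarrow> real^'n \<Rightarrow> real" where
  "T_tensor_up F h i j k y = (\<Sum>r\<in>UNIV. gF_inv F y $ h $ r * T_tensor F r i j k y)"

section \<open>$(\alpha,\beta)$-metrics\<close>

definition \<alpha>_norm :: "real^'n::finite^'n \<Rightarrow> real^'n \<Rightarrow> real" where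
  "\<alpha>_norm a y = sqrt (\<Sum>i\<in>UNIV. \<Sum>j\<in>UNIV. a $ i $ j * y $ i * y $ j)"

definition \<beta>_form :: "real^'n::finite \<Rightarrow> real^'n \<Rightarrow> real" where
  "\<beta>_form b y = (\<Sum>i\<in>UNIV. b $ i * y $ i)"

text \<open>$b^2 = b^i b_i = a^{ij} b_i b_j$.\<close>

definition b_sq :: "real^'n::finite^'n \<Rightarrow> real^'n \<Rightarrow> real" where
  "b_sq a b = (\<Sum>i\<in>UNIV. \<Sum>j\<in>UNIV. matrix_inv a $ i $ j * b $ i * b $ j)"

definition ab_s :: "real^'n::finite^'n \<Rightarrow> real^'n \<Rightarrow> real^'n \<Rightarrow> real" where
  "ab_s a b y = \<beta>_form b y / \<alpha>_norm a y"

definition ab_F :: "(real \<Rightarrow> real) \<Rightarrow> real^'n::finite^'n \<Rightarrow> real^'n \<Rightarrow> real^'n \<Rightarrow> real" where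
  "ab_F \<phi> a b y = \<alpha>_norm a y * \<phi> (ab_s a b y)"

text \<open>
  With \<open>I\<close> the domain of \<open>\<phi>\<close>, these are the tangent vectors at which \<open>F\<close> is defined. In the
  almost regular case this excludes, e.g., the directions \<open>\<plusminus>b\<^sup>i\<close> at points with \<open>b = b\<^sub>0\<close>.
\<close>

definition ab_cone :: "real set \<Rightarrow> real^'n::finite^'n \<Rightarrow> real^'n \<Rightarrow> (real^'n) set" where
  "ab_cone I a b = {y. y \<noteq> 0 \<and> ab_s a b y \<in> I}"

text \<open>
  The last clause is what makes $g^{ij}$ meaningful. For \<open>b < b\<^sub>0\<close> it follows from the inequality
  on \<open>\<phi>\<close>; for \<open>b = b\<^sub>0\<close> it does not, and it excludes
  $\phi(s) = k_1 s + k_2 \sqrt{b^2 - s^2}$, for which $g_{ij}$ is degenerate.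
\<close>

definition ab_metric ::
  "('m, 'n::finite) chart set \<Rightarrow> (('m, 'n) chart \<Rightarrow> real^'n \<Rightarrow> real^'n^'n) \<Rightarrow>
   (('m, 'n) chart \<Rightarrow> real^'n \<Rightarrow> real^'n) \<Rightarrow> (real \<Rightarrow> real) \<Rightarrow> real set \<Rightarrow> real \<Rightarrow> bool" where
  "ab_metric A a b \<phi> I b0 \<longleftrightarrow>
     riemannian_metric A a \<and> one_form A b \<and>
     b0 > 0 \<and> (I = {-b0<..<b0} \<or> I = {0<..<b0}) \<and> smooth_on I \<phi> \<and>
     (\<forall>t\<in>I. \<phi> t > 0) \<and>
     (\<forall>t\<in>I. \<forall>x. \<bar>t\<bar> < x \<and> x < b0 \<longrightarrow>
        \<phi> t - t * deriv \<phi> t + (x\<^sup>2 - t\<^sup>2) * deriv (deriv \<phi>) t > 0) \<and>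
     (\<forall>c\<in>A. \<forall>x\<in>chart_image c. sqrt (b_sq (a c x) (b c x)) \<le> b0) \<and>
     (\<forall>c\<in>A. \<forall>x\<in>chart_image c. \<forall>y\<in>ab_cone I (a c x) (b c x).
        invertible (gF (ab_F \<phi> (a c x) (b c x)) y))"

section \<open>The T-condition and the \<open>\<sigma>T\<close>-condition\<close>

definition T_condition ::
  "('m, 'n::finite) chart set \<Rightarrow> (('m, 'n) chart \<Rightarrow> real^'n \<Rightarrow> real^'n^'n) \<Rightarrow>
   (('m, 'n) chart \<Rightarrow> real^'n \<Rightarrow> real^'n) \<Rightarrow> (real \<Rightarrow> real) \<Rightarrow> real set \<Rightarrow> bool" where
  "T_condition A a b \<phi> I \<longleftrightarrow>
     (\<forall>c\<in>A. \<forall>x\<in>chart_image c. \<forall>y\<in>ab_cone I (a c x) (b c x). \<forall>r i j k.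
        T_tensor (ab_F \<phi> (a c x) (b c x)) r i j k y = 0)"

definition dcomp :: "('m, 'n::finite) chart \<Rightarrow> ('m \<Rightarrow> real) \<Rightarrow> 'n \<Rightarrow> real^'n \<Rightarrow> real" where
  "dcomp c \<sigma> h x = pd h (\<sigma> \<circ> chart_inv c) x"

text \<open>
  A constant \<open>\<sigma>\<close> satisfies \<open>\<sigma>\<^sub>h T\<^sup>h\<^sub>i\<^sub>j\<^sub>k = 0\<close> for every metric, and a \<open>\<sigma>\<close> which is
  constant on some open set gives no information there; such \<open>\<sigma>\<close> are therefore not admitted.
\<close>

definition admissible_function ::
  "('m::topological_space, 'n::finite) chart set \<Rightarrow> ('m \<Rightarrow> real) \<Rightarrow> bool" where
  "admissible_function A \<sigma> \<longleftrightarrow>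
     smooth_function A \<sigma> \<and> (\<forall>U. open U \<and> U \<noteq> {} \<longrightarrow> \<not> \<sigma> constant_on U)"

definition sigma_T_condition ::
  "('m::topological_space, 'n::finite) chart set \<Rightarrow> (('m, 'n) chart \<Rightarrow> real^'n \<Rightarrow> real^'n^'n) \<Rightarrow>
   (('m, 'n) chart \<Rightarrow> real^'n \<Rightarrow> real^'n) \<Rightarrow> (real \<Rightarrow> real) \<Rightarrow> real set \<Rightarrow> bool" where
  "sigma_T_condition A a b \<phi> I \<longleftrightarrow>
     (\<exists>\<sigma>. admissible_function A \<sigma> \<and>
        (\<forall>c\<in>A. \<forall>x\<in>chart_image c. \<forall>y\<in>ab_cone I (a c x) (b c x). \<forall>i j k.
           (\<Sum>h\<in>UNIV. dcomp c \<sigma> h x * T_tensor_up (ab_F \<phi> (a c x) (b c x)) h i j k y) = 0))"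

text \<open>$\beta \wedge d\sigma = 0$: where \<open>\<beta> \<noteq> 0\<close>, \<open>\<sigma>\<^sub>h\<close> is a multiple of \<open>b\<^sub>h\<close>.\<close>

definition parallel_differential ::
  "('m, 'n::finite) chart set \<Rightarrow> (('m, 'n) chart \<Rightarrow> real^'n \<Rightarrow> real^'n) \<Rightarrow> ('m \<Rightarrow> real) \<Rightarrow> bool" where
  "parallel_differential A b \<sigma> \<longleftrightarrow>
     (\<forall>c\<in>A. \<forall>x\<in>chart_image c. \<forall>i j. b c x $ i * dcomp c \<sigma> j x = b c x $ j * dcomp c \<sigma> i x)"

section \<open>The explicit family\<close>

definition sT_integrand :: "real \<Rightarrow> real \<Rightarrow> real \<Rightarrow> real \<Rightarrow> real" where
  "sT_integrand b2 c1 c2 t =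
     (c1 * sqrt (b2 - t\<^sup>2) + c2 * t) / (t * (c1 * sqrt (b2 - t\<^sup>2) + c2 * t) + 1)"

text \<open>
  The formula is required at every point of the manifold, with the \<open>b\<^sup>2\<close> of that point and the same
  constants throughout, for all values \<open>s\<close> in the domain of \<open>\<phi>\<close> that \<open>\<beta>/\<alpha>\<close> takes there. Since
  \<open>\<phi>\<close> does not depend on the point, \<open>c\<^sub>1 \<noteq> 0\<close> forces \<open>b\<^sup>2\<close> to be constant where it is nonzero.
  The integral is oriented, so \<open>s < 0\<close> is covered; its existence is part of the condition, as a
  divergent integral would have value 0.
\<close>

definition phi_explicit ::
  "('m, 'n::finite) chart set \<Rightarrow> (('m, 'n) chart \<Rightarrow> real^'n \<Rightarrow> real^'n^'n) \<Rightarrow>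
   (('m, 'n) chart \<Rightarrow> real^'n \<Rightarrow> real^'n) \<Rightarrow> (real \<Rightarrow> real) \<Rightarrow> real set \<Rightarrow> bool" where
  "phi_explicit A a b \<phi> I \<longleftrightarrow>
     (\<exists>c1 c2 c3. \<forall>c\<in>A. \<forall>x\<in>chart_image c. \<forall>s\<in>I. \<bar>s\<bar> \<le> sqrt (b_sq (a c x) (b c x)) \<longrightarrow>
        interval_lebesgue_integrable lborel 0 (ereal s)
          (sT_integrand (b_sq (a c x) (b c x)) c1 c2) \<and>
        \<phi> s = c3 * exp (LBINT t=0..ereal s. sT_integrand (b_sq (a c x) (b c x)) c1 c2 t))"

end

theory Submission
  imports Defs
begin

text \<open>
  Let $h_{ij}$ be the angular metric of $\alpha$ and $m_i = b_i - s\,\alpha_{y^i}$. The T-tensor is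
  $\frac1{2\alpha}\left(\Phi\,h h + \Psi\,h m m + \Omega\,m m m m\right)$, symmetrised, with coefficients
  depending on $s$ and $b^2$ only. Since $n \ge 3$, contracting with $\sigma_h$ and with vectors
  orthogonal to $y$ and $b$ shows that $\sigma_h T^h_{ijk} = 0$ with $\sigma_h \ne 0$ forces
  $\Phi + (b^2 - s^2)\Psi = 0$, whether or not $\sigma_h$ is parallel to $b_h$.

  In terms of $Q = \phi'/(\phi - s\phi')$ this equation factors as the product of
  $2s(1+sQ) + (b^2-s^2)(Q+sQ')$ and $(b^2-s^2)Q'' + Q - sQ'$. Where the first factor vanishes on an
  open set, the second one is nonzero, and stays so at the boundary, because $g_{ij}$ is nondegenerate; so exactly
  one of them vanishes identically. The first factor gives $T = 0$. The second is a linear equation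
  with solutions $Q = c_1\sqrt{b^2-s^2} + c_2 s$, that is the explicit family, and it implies the
  full condition when $\sigma_h$ is parallel to $b_h$. The two alternatives cannot occur at two
  different points of the manifold, because $\phi$ is the same at all of them.
\<close>

text \<open>The dimension enters through one device: for n \<ge> 3 there is a nonzero vector
  \<open>p\<close> killed by \<open>b\<close> and a-orthogonal to \<open>y\<close>, and contracting
  with it annihilates every m. This removes \<Omega>, the only coefficient with fourth derivatives
  of \<phi>, so that the remaining equation is of second order in Q. A vanishing product of two
  functions does not make one of them vanish throughout. What decides here is an identity: where the
  first factor vanishes on an open set, t (b^2 - t^2) times the second factor is -2 b^2 times the
  nondegeneracy expression. The quotient of the two is continuous and can only be 0 or -2 b^2, hence
  is constant. The identity survives when the second factor is taken with the b^2 of another point,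
  and this is how different points are compared. Two places resist: directions with s^2 = b^2, where
  all m_i vanish and the contraction is silent, and the zeros of the denominator in the integrand,
  which the explicit formula does not exclude in advance.\<close>

section \<open>Smooth functions of one real variable\<close>

lemma Ck_on_cong:
  assumes "open S" "\<And>x. x \<in> S \<Longrightarrow> f x = g x" "Ck_on k S f"
  shows "Ck_on k S g"
  using assms(2,3)
proof (induction k arbitrary: f g)
  case 0
  then show ?case by (simp cong: continuous_on_cong)
next
  case (Suc k)
  have fd: "(f has_derivative frechet_derivative f (at x)) (at x)" if "x \<in> S" for x
    using Suc.prems(2) that assms(1) by (simp add: differentiable_on_eq_differentiable_at frechet_derivative_works)
  have gd: "(g has_derivative frechet_derivative f (at x)) (at x)" if "x \<in> S" for x
    using has_derivative_transform_within_open[OF fd[OF that] assms(1) that] Suc.prems(1) by blast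
  have "frechet_derivative f (at x) = frechet_derivative g (at x)" if "x \<in> S" for x
    using frechet_derivative_at[OF gd[OF that]] .
  moreover have "g differentiable_on S"
    using gd unfolding differentiable_on_def differentiable_def by (meson has_derivative_at_withinI)
  ultimately show ?case
    using Suc.prems(2) Suc.IH[of "\<lambda>x. frechet_derivative f (at x) v" "\<lambda>x. frechet_derivative g (at x) v" for v]
    by auto
qed

text \<open>\<open>Ck_on\<close> applies \<open>frechet_derivative\<close> to a vector. On the line
  its value at 1 is \<open>deriv\<close>, but this is known only on \<open>S\<close>, hence the
  congruence lemma.\<close>

lemma Ck_on_deriv:
  fixes f :: "real \<Rightarrow> real"
  assumes "open S" "Ck_on (Suc k) S f"
  shows "Ck_on k S (deriv f)" and "\<And>x. x \<in> S \<Longrightarrow> (f has_real_derivative deriv f x) (at x)"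
proof -
  have d: "(f has_derivative frechet_derivative f (at x)) (at x)" if "x \<in> S" for x
    using assms that by (simp add: differentiable_on_eq_differentiable_at frechet_derivative_works)
  have *: "(f has_real_derivative frechet_derivative f (at x) 1) (at x)" if "x \<in> S" for x
  proof -
    have "frechet_derivative f (at x) = (*) (frechet_derivative f (at x) 1)"
    proof
      fix v
      show "frechet_derivative f (at x) v = frechet_derivative f (at x) 1 * v"
        using linear_scale[OF has_derivative_linear[OF d[OF that]], of v 1] by (simp add: mult.commute)
    qed
    then show ?thesis
      using d[OF that] unfolding has_field_derivative_def by metis
  qed
  then show "(f has_real_derivative deriv f x) (at x)" if "x \<in> S" for x
    using DERIV_imp_deriv that by metis
  have "Ck_on k S (\<lambda>x. frechet_derivative f (at x) 1)" using assms by simp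
  then show "Ck_on k S (deriv f)"
    by (rule Ck_on_cong[OF assms(1), rotated]) (metis * DERIV_imp_deriv)
qed

lemma smooth_on_deriv_funpow:
  fixes f :: "real \<Rightarrow> real"
  assumes "open S" "smooth_on S f"
  shows "smooth_on S ((deriv ^^ n) f)"
    and "\<And>x. x \<in> S \<Longrightarrow> ((deriv ^^ n) f has_real_derivative (deriv ^^ Suc n) f x) (at x)"
proof -
  have *: "smooth_on S ((deriv ^^ n) f)" for n
    using assms by (induction n) (auto simp: smooth_on_def intro: Ck_on_deriv)
  show "smooth_on S ((deriv ^^ n) f)" by fact
  show "((deriv ^^ n) f has_real_derivative (deriv ^^ Suc n) f x) (at x)" if "x \<in> S" for x
    using Ck_on_deriv(2)[OF assms(1), of 0 "(deriv ^^ n) f"] * that unfolding smooth_on_def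
    by (metis funpow.simps(2) o_apply)
qed

section \<open>Gradients in index notation\<close>

text \<open>\<open>pd\<close> is read off a Frechet derivative and means nothing where there is
  none. Recording differentiability together with the components gives the product and chain rules
  in index form.\<close>

definition has_grad :: "(real^'n::finite \<Rightarrow> real) \<Rightarrow> ('n \<Rightarrow> real) \<Rightarrow> real^'n \<Rightarrow> bool" where
  "has_grad f G y \<longleftrightarrow> (f has_derivative (\<lambda>v. \<Sum>k\<in>UNIV. G k * v $ k)) (at y)"

lemma has_grad_pd:
  assumes "has_grad f G y"
  shows "pd k f y = G k"
proof -
  have "frechet_derivative f (at y) = (\<lambda>v. \<Sum>k\<in>UNIV. G k * v $ k)"
    using frechet_derivative_at[OF assms[unfolded has_grad_def]] by simp
  then show ?thesis
    by (simp add: pd_def axis_def if_distrib cong: if_cong)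
qed

lemma has_grad_eq:
  assumes "has_grad f G y" "\<And>k. G k = H k" shows "has_grad f H y"
  using assms by (simp add: has_grad_def)

lemma has_grad_transform:
  assumes "has_grad f G y" "open S" "y \<in> S" "\<And>z. z \<in> S \<Longrightarrow> f z = g z"
  shows "has_grad g G y"
  using assms has_derivative_transform_within_open unfolding has_grad_def by blast

lemma has_grad_const: "has_grad (\<lambda>y. c) (\<lambda>k. 0) y"
  by (simp add: has_grad_def)

lemma has_grad_add:
  assumes "has_grad f G y" "has_grad f' G' y" 
  shows "has_grad (\<lambda>y. f y + f' y) (\<lambda>k. G k + G' k) y"
  using has_derivative_add[OF assms[unfolded has_grad_def]]
  by (simp add: has_grad_def sum.distrib distrib_right)

lemma has_grad_diff:
  assumes "has_grad f G y" "has_grad f' G' y" 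
  shows "has_grad (\<lambda>y. f y - f' y) (\<lambda>k. G k - G' k) y"
  using has_derivative_diff[OF assms[unfolded has_grad_def]]
  by (simp add: has_grad_def sum_subtractf left_diff_distrib)

lemma has_grad_mult:
  assumes "has_grad f G y" "has_grad f' G' y" 
  shows "has_grad (\<lambda>y. f y * f' y) (\<lambda>k. G k * f' y + f y * G' k) y"
  using has_derivative_mult[OF assms[unfolded has_grad_def]]
  by (simp add: has_grad_def sum.distrib distrib_right sum_distrib_left sum_distrib_right algebra_simps)

lemma has_grad_compose:
  assumes "has_grad f G y" "(p has_real_derivative p') (at (f y))"
  shows "has_grad (\<lambda>y. p (f y)) (\<lambda>k. p' * G k) y"
  using has_derivative_compose[OF assms(1)[unfolded has_grad_def] assms(2)[unfolded has_field_derivative_def]]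
  by (simp add: has_grad_def sum_distrib_left algebra_simps)

lemma has_grad_inner: "has_grad (\<lambda>y. \<Sum>k\<in>UNIV. c k * y $ k) c y"
  unfolding has_grad_def
  by (auto intro!: derivative_eq_intros bounded_linear.has_derivative[OF bounded_linear_vec_nth])

lemma has_grad_divide:
  assumes "has_grad f G y" "has_grad f' G' y" "f' y \<noteq> 0"
  shows "has_grad (\<lambda>y. f y / f' y) (\<lambda>k. (G k - f y / f' y * G' k) / f' y) y"
proof -
  have "has_grad (\<lambda>y. f y * inverse (f' y)) (\<lambda>k. G k * inverse (f' y) + f y * (- (inverse (f' y))\<^sup>2 * G' k)) y"
    using assms by (intro has_grad_mult has_grad_compose[where p = inverse])
      (auto intro!: derivative_eq_intros simp: power2_eq_square)
  then have "has_grad (\<lambda>y. f y / f' y) (\<lambda>k. G k * inverse (f' y) + f y * (- (inverse (f' y))\<^sup>2 * G' k)) y"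
    by (simp add: divide_inverse)
  then show ?thesis
    by (rule has_grad_eq) (use assms(3) in \<open>simp add: field_simps power2_eq_square\<close>)
qed

section \<open>Vertical derivatives of an $(\alpha,\beta)$-metric\<close>

text \<open>One tangent space: \<open>a\<close> and \<open>b\<close> are values at a point,
  \<open>y\<close> is the only variable, and \<phi> is shared by all instances.\<close>

locale ab_fibre =
  fixes a :: "real^'n::finite^'n" and b :: "real^'n" and \<phi> :: "real \<Rightarrow> real" and I :: "real set"
  assumes a_sym: "a $ i $ j = a $ j $ i"
    and a_pos: "v \<noteq> 0 \<Longrightarrow> v \<bullet> (a *v v) > 0"
    and open_I: "open I"
    and smooth: "smooth_on I \<phi>"
    and \<phi>_pos: "t \<in> I \<Longrightarrow> \<phi> t > 0"
    and regular: "y \<in> ab_cone I a b \<Longrightarrow> invertible (gF (ab_F \<phi> a b) y)"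
    and card: "CARD('n) \<ge> 3"
begin

abbreviation "al \<equiv> \<alpha>_norm a"
abbreviation "sl \<equiv> ab_s a b"
abbreviation "F \<equiv> ab_F \<phi> a b"
abbreviation "domF \<equiv> ab_cone I a b"
abbreviation "d n \<equiv> (deriv ^^ n) \<phi>"

text \<open>The derivatives of \<open>l\<close>, \<open>m\<close>, \<open>h\<close> are again
  polynomials in them over \<alpha>, and \<open>m\<close> and \<open>h\<close> annihilate y.
  Expanding in this frame rather than in a, b and y keeps the tensors short.\<close>

definition "l i y = (a *v y) $ i / al y"
definition "m i y = b $ i - sl y * l i y"
definition "h i j y = a $ i $ j - l i y * l j y"

text \<open>F F_ij = rho h + del m m; \<open>rho1\<close> and \<open>kap\<close> are the
  coefficients of the Cartan tensor. \<open>rho1\<close> is rho' and \<open>kap\<close> is -rho1'/t,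
  written so as to make sense at t = 0; \<open>kap1\<close> is kap'.\<close>

definition "rho t = \<phi> t * (\<phi> t - t * d 1 t)"
definition "rho1 t = d 1 t * (\<phi> t - t * d 1 t) - t * \<phi> t * d 2 t"
definition "del t = \<phi> t * d 2 t"
definition "kap t = 3 * d 1 t * d 2 t + \<phi> t * d 3 t"
definition "kap1 t = 3 * (d 2 t)\<^sup>2 + 4 * d 1 t * d 3 t + \<phi> t * d 4 t"
definition "ell i y = \<phi> (sl y) * l i y + d 1 (sl y) * m i y"

lemma DERIV_d:
  assumes "t \<in> I"
  shows "(\<phi> has_real_derivative d 1 t) (at t)" "(d 1 has_real_derivative d 2 t) (at t)"
    "(d 2 has_real_derivative d 3 t) (at t)" "(d 3 has_real_derivative d 4 t) (at t)"
  using smooth_on_deriv_funpow(2)[OF open_I smooth assms, of 0]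
    smooth_on_deriv_funpow(2)[OF open_I smooth assms, of 1]
    smooth_on_deriv_funpow(2)[OF open_I smooth assms, of 2]
    smooth_on_deriv_funpow(2)[OF open_I smooth assms, of 3]
  by (simp_all add: numeral_eq_Suc)

lemma DERIV_coeffs:
  assumes "t \<in> I"
  shows "(rho has_real_derivative rho1 t) (at t)" "(rho1 has_real_derivative - t * kap t) (at t)"
    "(del has_real_derivative d 1 t * d 2 t + \<phi> t * d 3 t) (at t)"
    "(kap has_real_derivative kap1 t) (at t)"
  unfolding rho_def[abs_def] rho1_def[abs_def] del_def[abs_def] kap_def[abs_def] kap1_def[abs_def]
  by (rule derivative_eq_intros DERIV_d[OF assms] refl
      | simp add: rho1_def kap_def kap1_def algebra_simps power2_eq_square)+

lemma a_adjoint: "v \<bullet> (a *v w) = (a *v v) \<bullet> w"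
proof -
  have "v \<bullet> (a *v w) = (\<Sum>i\<in>UNIV. \<Sum>j\<in>UNIV. v $ i * (a $ i $ j * w $ j))"
    by (simp add: inner_vec_def matrix_vector_mult_def sum_distrib_left)
  also have "\<dots> = (\<Sum>j\<in>UNIV. \<Sum>i\<in>UNIV. v $ i * (a $ i $ j * w $ j))"
    by (rule sum.swap)
  also have "\<dots> = (a *v v) \<bullet> w"
    by (simp add: inner_vec_def matrix_vector_mult_def sum_distrib_right sum_distrib_left a_sym mult_ac)
  finally show ?thesis .
qed

lemma al_eq: "al y = sqrt (y \<bullet> (a *v y))"
  unfolding \<alpha>_norm_def
  by (simp add: inner_vec_def matrix_vector_mult_def sum_distrib_left mult_ac)

lemma al_pos: "y \<noteq> 0 \<Longrightarrow> al y > 0"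
  using a_pos by (simp add: al_eq)

lemma al_sq: "(al y)\<^sup>2 = y \<bullet> (a *v y)"
  using a_pos[of y] by (cases "y = 0") (auto simp: al_eq)

lemma \<beta>_eq: "\<beta>_form b y = b \<bullet> y"
  by (simp add: \<beta>_form_def inner_vec_def)

lemma grad_al:
  assumes "y \<noteq> 0"
  shows "has_grad al (\<lambda>k. l k y) y"
proof -
  have "((\<lambda>y. y \<bullet> (a *v y)) has_derivative (\<lambda>v. \<Sum>k\<in>UNIV. (2 * (a *v y) $ k) * v $ k)) (at y)"
  proof -
    have "((\<lambda>y. y \<bullet> (a *v y)) has_derivative (\<lambda>v. y \<bullet> (a *v v) + v \<bullet> (a *v y))) (at y)"
      by (auto intro!: derivative_eq_intros bounded_linear.has_derivative[OF matrix_vector_mul_bounded_linear])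
    moreover have "y \<bullet> (a *v v) + v \<bullet> (a *v y) = (\<Sum>k\<in>UNIV. (2 * (a *v y) $ k) * v $ k)" for v
      unfolding a_adjoint[of y v] inner_commute[of v "a *v y"]
      by (simp add: inner_vec_def sum_distrib_left sum.distrib[symmetric] mult_ac)
    ultimately show ?thesis by simp
  qed
  then have g: "has_grad (\<lambda>y. y \<bullet> (a *v y)) (\<lambda>k. 2 * (a *v y) $ k) y"
    unfolding has_grad_def .
  have "has_grad (\<lambda>y. sqrt (y \<bullet> (a *v y))) (\<lambda>k. inverse (sqrt (y \<bullet> (a *v y))) / 2 * (2 * (a *v y) $ k)) y"
    by (rule has_grad_compose[OF g]) (use a_pos[OF assms] in \<open>auto intro!: DERIV_real_sqrt\<close>)
  moreover have "al = (\<lambda>y. sqrt (y \<bullet> (a *v y)))" using al_eq by auto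
  ultimately show ?thesis
    by (auto elim!: has_grad_eq simp: l_def field_simps)
qed

lemma grad_sl:
  assumes "y \<noteq> 0"
  shows "has_grad sl (\<lambda>k. m k y / al y) y"
proof -
  have "has_grad (\<lambda>y. \<beta>_form b y / al y) (\<lambda>k. (b $ k - \<beta>_form b y / al y * l k y) / al y) y"
    using assms al_pos[OF assms] unfolding \<beta>_form_def
    by (intro has_grad_divide has_grad_inner grad_al) auto
  then show ?thesis
    by (simp add: m_def ab_s_def[abs_def])
qed

lemma grad_l:
  assumes "y \<noteq> 0"
  shows "has_grad (l i) (\<lambda>k. h i k y / al y) y"
proof -
  have "has_grad (\<lambda>y. (\<Sum>k\<in>UNIV. a $ i $ k * y $ k) / al y)
     (\<lambda>k. (a $ i $ k - (\<Sum>k\<in>UNIV. a $ i $ k * y $ k) / al y * l k y) / al y) y"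
    using assms al_pos[OF assms]
    by (intro has_grad_divide has_grad_inner grad_al) auto
  then show ?thesis
    by (simp add: h_def l_def[abs_def] matrix_vector_mult_def)
qed

lemma grad_m:
  assumes "y \<noteq> 0"
  shows "has_grad (m i) (\<lambda>k. - (m k y * l i y + sl y * h i k y) / al y) y"
  unfolding m_def[of i, abs_def] using al_pos[OF assms]
  by (intro has_grad_eq[OF has_grad_diff[OF has_grad_const has_grad_mult[OF grad_sl[OF assms] grad_l[OF assms]]]])
     (simp add: field_simps)

lemma grad_h:
  assumes "y \<noteq> 0"
  shows "has_grad (h i j) (\<lambda>k. - (h i k y * l j y + h j k y * l i y) / al y) y"
  unfolding h_def[of i j, abs_def] using al_pos[OF assms]
  by (intro has_grad_eq[OF has_grad_diff[OF has_grad_const has_grad_mult[OF grad_l[OF assms] grad_l[OF assms]]]])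
     (simp add: field_simps)

lemma open_domF: "open domF"
proof -
  have "continuous_on (- {0}) sl"
    using grad_sl unfolding has_grad_def
    by (intro continuous_at_imp_continuous_on ballI has_derivative_continuous) auto
  then have "open (- {0} \<inter> sl -` I)"
    by (rule continuous_open_preimage) (auto simp: open_I)
  moreover have "domF = - {0} \<inter> sl -` I"
    by (auto simp: ab_cone_def)
  ultimately show ?thesis by simp
qed

lemma domFD: "y \<in> domF \<Longrightarrow> y \<noteq> 0" "y \<in> domF \<Longrightarrow> sl y \<in> I" "y \<in> domF \<Longrightarrow> al y > 0"
  by (auto simp: ab_cone_def al_pos)

lemma grad_F:
  assumes "y \<in> domF"
  shows "has_grad F (\<lambda>k. ell k y) y"
  unfolding ab_F_def[abs_def]
  by (rule has_grad_eq[OF has_grad_mult[OF grad_al has_grad_compose[OF grad_sl DERIV_d(1)]]])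
     (use domFD[OF assms] in \<open>auto simp: ell_def field_simps\<close>)

lemma grad_ell:
  assumes "y \<in> domF"
  shows "has_grad (ell i)
    (\<lambda>k. ((\<phi> (sl y) - sl y * d 1 (sl y)) * h i k y + d 2 (sl y) * m i y * m k y) / al y) y"
  unfolding ell_def[of i, abs_def]
  by (rule has_grad_eq[OF has_grad_add[OF
        has_grad_mult[OF has_grad_compose[OF grad_sl DERIV_d(1)] grad_l]
        has_grad_mult[OF has_grad_compose[OF grad_sl DERIV_d(2)] grad_m]]])
     (use domFD[OF assms] in \<open>auto simp: field_simps\<close>)

lemma h_commute: "h i j y = h j i y"
  by (simp add: h_def a_sym mult.commute)

text \<open>Half the Hessian of F^2 is F_i F_j + F F_ij, and the second summand annihilates
  y.\<close>

lemma gF_eq: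
  assumes "y \<in> domF"
  shows "gF F y $ i $ j = ell i y * ell j y + rho (sl y) * h i j y + del (sl y) * m i y * m j y"
proof -
  have sq: "has_grad (\<lambda>z. (F z)\<^sup>2) (\<lambda>k. 2 * F z * ell k z) z" if "z \<in> domF" for z
    unfolding power2_eq_square
    by (rule has_grad_eq[OF has_grad_mult[OF grad_F grad_F]]) (use that in auto)
  have "has_grad (\<lambda>z. 2 * F z * ell j z)
     (\<lambda>i. 2 * (ell i y * ell j y + rho (sl y) * h i j y + del (sl y) * m i y * m j y)) y"
    by (rule has_grad_eq[OF has_grad_mult[OF has_grad_mult[OF has_grad_const grad_F] grad_ell]])
       (use assms domFD[OF assms] in \<open>auto simp: field_simps rho_def del_def ab_F_def h_commute[of j]\<close>)
  then have "has_grad (pd j (\<lambda>z. (F z)\<^sup>2))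
     (\<lambda>i. 2 * (ell i y * ell j y + rho (sl y) * h i j y + del (sl y) * m i y * m j y)) y"
    by (rule has_grad_transform[OF _ open_domF assms]) (simp add: has_grad_pd[OF sq])
  then show ?thesis
    unfolding gF_def by (simp add: has_grad_pd)
qed

definition "c3 i j k y = (rho1 (sl y) * (m i y * h j k y + m j y * h i k y + m k y * h i j y)
   + kap (sl y) * m i y * m j y * m k y) / (2 * al y)"

text \<open>All terms of the derivative of \<open>gF_eq\<close> that contain l cancel, in accordance
  with C_ijk y^k = 0.\<close>

lemma Cartan_eq:
  assumes "y \<in> domF"
  shows "Cartan F i j k y = c3 i j k y"
proof -
  have "has_grad (\<lambda>y. ell i y * ell j y + rho (sl y) * h i j y + del (sl y) * m i y * m j y)
     (\<lambda>k. 2 * c3 i j k y) y"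
    by (rule has_grad_eq[OF has_grad_add[OF has_grad_add[OF
          has_grad_mult[OF grad_ell grad_ell]
          has_grad_mult[OF has_grad_compose[OF grad_sl DERIV_coeffs(1)] grad_h]]
          has_grad_mult[OF has_grad_mult[OF has_grad_compose[OF grad_sl DERIV_coeffs(3)] grad_m] grad_m]]])
       (use assms domFD[OF assms] in \<open>auto simp: field_simps c3_def rho_def del_def ell_def rho1_def kap_def power2_eq_square\<close>)
  then have "has_grad (\<lambda>z. gF F z $ i $ j) (\<lambda>k. 2 * c3 i j k y) y"
    by (rule has_grad_transform[OF _ open_domF assms]) (simp add: gF_eq)
  then show ?thesis
    unfolding Cartan_def by (simp add: has_grad_pd)
qed

end

section \<open>The inverse metric and the Cartan tensor\<close>

text \<open>\<open>matrix_inv\<close> is a choice. No entry of an inverse is computed below; each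
  g^{-1} u is identified by exhibiting a v with g v = u.\<close>

lemma matrix_inv_vec:
  fixes A :: "real^'n::finite^'n"
  assumes "invertible A" "A *v x = u"
  shows "matrix_inv A *v u = x"
proof -
  have "matrix_inv A ** A = mat 1"
    using assms(1) unfolding invertible_def matrix_inv_def by (rule someI2_ex) simp
  then show ?thesis
    using assms(2) by (metis matrix_vector_mul_assoc matrix_vector_mul_lid)
qed

lemma matrix_inv_solves:
  fixes A :: "real^'n::finite^'n"
  assumes "invertible A"
  shows "A *v (matrix_inv A *v u) = u"
proof -
  have "A ** matrix_inv A = mat 1"
    using assms(1) unfolding invertible_def matrix_inv_def by (rule someI2_ex) simp
  then show ?thesis
    by (metis matrix_vector_mul_assoc matrix_vector_mul_lid)
qed

text \<open>All uses of n \<ge> 3 go through this lemma: the span of two vectors is a proper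
  subspace.\<close>

lemma orthogonal_to_two_exists:
  fixes u v :: "real^'n::finite"
  assumes "CARD('n) \<ge> 3"
  obtains p where "p \<noteq> 0" "p \<bullet> u = 0" "p \<bullet> v = 0"
proof -
  have "dim {u, v} < DIM(real^'n)"
    using dim_le_card'[of "{u, v}"] card_insert_le_m1[of 2 "{v}" u] assms by simp
  then obtain p where "p \<noteq> 0" "\<And>w. w \<in> span {u, v} \<Longrightarrow> orthogonal p w"
    using orthogonal_to_subspace_exists by blast
  then show thesis
    using that by (simp add: orthogonal_def span_base)
qed

context ab_fibre
begin

definition "b_up = matrix_inv a *v b"
abbreviation "B \<equiv> b_sq a b"
definition "mu t = B - t\<^sup>2"
text \<open>The angular metric rho h + del m m sends \<open>m_up\<close> to N m, because h sends it
  to m and m sends it to \<open>mu\<close>.\<close>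

definition "N t = rho t + del t * mu t"
definition "lv y = (\<chi> i. l i y)"
definition "mv y = (\<chi> i. m i y)"
definition "hv i y = (\<chi> j. h i j y)"
definition "ellv y = (\<chi> i. ell i y)"
definition "m_up y = b_up - (sl y / al y) *\<^sub>R y"
text \<open>The closed forms of g^{-1} m and, below, g^{-1} h_r. The multiple of y is chosen to make
  ell vanish on the vector; since m and h annihilate y, it does not affect their pairings.\<close>

definition "g_up_m y = (1 / N (sl y)) *\<^sub>R (m_up y - (d 1 (sl y) * mu (sl y) / F y) *\<^sub>R y)"
definition "g_up_h r y = (1 / rho (sl y)) *\<^sub>R
  (axis r 1 - (l r y / al y + d 1 (sl y) * m r y / F y) *\<^sub>R y - (del (sl y) * m r y) *\<^sub>R g_up_m y)"
abbreviation "gi y \<equiv> gF_inv F y"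

lemma invertible_a: "invertible a"
proof -
  have "x = 0" if "a *v x = 0" for x using a_pos[of x] that by auto
  then show ?thesis
    using invertible_left_inverse matrix_left_invertible_ker by blast
qed

lemma a_b_up: "a *v b_up = b"
  unfolding b_up_def by (rule matrix_inv_solves[OF invertible_a])

lemma B_eq: "B = b \<bullet> b_up"
  by (simp add: b_sq_def b_up_def inner_vec_def matrix_vector_mult_def sum_distrib_left mult_ac)

lemma B_pos: "b \<noteq> 0 \<Longrightarrow> B > 0"
  using a_pos[of b_up] a_b_up by (metis B_eq inner_commute matrix_vector_mult_0_right)

lemma covector_nth [simp]: "lv y $ i = l i y" "mv y $ i = m i y" "hv i y $ j = h i j y" "ellv y $ i = ell i y"
  by (simp_all add: lv_def mv_def hv_def ellv_def)

lemma lv_dot: "lv y \<bullet> v = (a *v y) \<bullet> v / al y"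
  by (simp add: lv_def l_def inner_vec_def sum_divide_distrib)

lemma mv_dot: "mv y \<bullet> v = b \<bullet> v - sl y * (lv y \<bullet> v)"
  by (simp add: lv_def mv_def m_def inner_vec_def sum_subtractf sum_distrib_left algebra_simps)

lemma hv_dot: "hv i y \<bullet> v = (a *v v) $ i - l i y * (lv y \<bullet> v)"
  by (simp add: hv_def lv_def h_def inner_vec_def matrix_vector_mult_def sum_subtractf sum_distrib_left
      algebra_simps)

lemma ellv_dot: "ellv y \<bullet> v = \<phi> (sl y) * (lv y \<bullet> v) + d 1 (sl y) * (mv y \<bullet> v)"
  by (simp add: ellv_def ell_def lv_def mv_def inner_vec_def sum.distrib sum_distrib_left
      algebra_simps)

context
  fixes y :: "real^'n" assumes y: "y \<noteq> 0"
begin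

lemma ly: "lv y \<bullet> y = al y"
  using al_pos[OF y] al_sq[of y] by (simp add: lv_dot power2_eq_square) (simp add: inner_commute field_simps)

lemma my: "mv y \<bullet> y = 0"
  using al_pos[OF y] by (simp add: mv_dot ly ab_s_def \<beta>_eq)

lemma hy: "hv i y \<bullet> y = 0"
  using al_pos[OF y] by (simp add: hv_dot ly l_def)

lemma lmh: "lv y \<bullet> m_up y = 0"
proof -
  have "(a *v y) \<bullet> b_up = b \<bullet> y"
    using a_adjoint[of y b_up] a_b_up by (simp add: inner_commute)
  moreover have "(a *v y) \<bullet> y = (al y)\<^sup>2" by (simp add: al_sq inner_commute)
  ultimately show ?thesis
    using al_pos[OF y] 
    by (simp add: m_up_def lv_dot inner_diff_right ab_s_def \<beta>_eq power2_eq_square)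
qed

lemma a_m_up: "a *v m_up y = mv y"
  by (simp add: m_up_def matrix_vector_mult_diff_distrib matrix_vector_mult_scaleR a_b_up vec_eq_iff
      mv_def m_def l_def)

lemma mmh: "mv y \<bullet> m_up y = mu (sl y)"
proof -
  have "b \<bullet> m_up y = B - (sl y)\<^sup>2"
    using al_pos[OF y] by (simp add: m_up_def inner_diff_right B_eq ab_s_def \<beta>_eq power2_eq_square)
  then show ?thesis by (simp add: mv_dot lmh mu_def)
qed

lemma hmh: "hv i y \<bullet> m_up y = m i y"
  by (simp add: hv_dot lmh a_m_up mv_def)

lemma mu_nonneg: "mu (sl y) \<ge> 0"
  using a_pos[of "m_up y"] mmh by (cases "m_up y = 0") (auto simp: a_m_up inner_commute)

text \<open>\<open>mu\<close> is the squared a-norm of \<open>m_up\<close>, so both vanish together.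
  In the directions s^2 = b^2 only the h h terms of the T-tensor survive.\<close>

lemma mu_zero: "mu (sl y) = 0 \<Longrightarrow> m i y = 0"
  using a_pos[of "m_up y"] mmh a_m_up hmh by (cases "m_up y = 0") (auto simp: inner_commute)

end

lemma rho_N: "rho t = N t - del t * mu t"
  by (simp add: N_def)

text \<open>This is 4 \<alpha>^2 C_sij C^s_rk, expanded by the pairings of m and h_i with g^{-1} m
  and g^{-1} h_r; their denominators are rho and N.\<close>

definition "cartan_sq y i j r k = (let t = sl y; w = rho1 t; n = N t; e = kap t in
   w\<^sup>2 * (mu t / n * h i j y * h r k y + 2 * h i j y * m r y * m k y / n + 2 * h r k y * m i y * m j y / n
     + (h i r y * m j y * m k y + h i k y * m j y * m r y + h j r y * m i y * m k y + h j k y * m i y * m r y) / rho t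
     - 4 * del t / (rho t * n) * m i y * m j y * m r y * m k y)
   + w * e * (mu t / n * (h i j y * m r y * m k y + h r k y * m i y * m j y) + 4 * m i y * m j y * m r y * m k y / n)
   + e\<^sup>2 * mu t / n * m i y * m j y * m r y * m k y)"

lemma gF_mult:
  assumes "y \<in> domF"
  shows "(gF F y *v v) $ i =
    ell i y * (ellv y \<bullet> v) + rho (sl y) * (hv i y \<bullet> v) + del (sl y) * m i y * (mv y \<bullet> v)"
  using gF_eq[OF assms]
  by (simp add: matrix_vector_mult_def inner_vec_def hv_def mv_def ellv_def sum_distrib_left
      sum.distrib[symmetric] algebra_simps)

lemma gF_ker: "y \<in> domF \<Longrightarrow> gF F y *v v = 0 \<Longrightarrow> v = 0"
  using regular matrix_inv_vec[of "gF F y" v 0] by simp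

lemma gi_eq: "y \<in> domF \<Longrightarrow> gF F y *v v = u \<Longrightarrow> gi y *v u = v"
  unfolding gF_inv_def by (rule matrix_inv_vec[OF regular])

context
  fixes y :: "real^'n" assumes y: "y \<in> domF"
begin

lemma F_pos: "F y > 0"
  using domFD[OF y] \<phi>_pos by (simp add: ab_F_def)

text \<open>Both l and m vanish on a vector killed by b and a-orthogonal to y. If rho were 0, g
  would annihilate it.\<close>

lemma rho_nz: "rho (sl y) \<noteq> 0"
proof
  assume r: "rho (sl y) = 0"
  obtain p where p: "p \<noteq> 0" "p \<bullet> (a *v y) = 0" "p \<bullet> b = 0"
    using orthogonal_to_two_exists[OF card] by metis
  have "lv y \<bullet> p = 0" using p by (simp add: lv_dot) (simp add: inner_commute)
  moreover from this have "mv y \<bullet> p = 0" using p by (simp add: mv_dot) (simp add: inner_commute)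
  ultimately have "gF F y *v p = 0"
    by (simp add: vec_eq_iff gF_mult[OF y] ellv_dot r)
  then show False using gF_ker[OF y] p by blast
qed

text \<open>If N were 0, \<open>m_up\<close> corrected by a multiple of y would lie in the kernel of
  g, hence be zero. Pairing it with m gives mu = 0, and then N = rho.\<close>

lemma N_nz: "N (sl y) \<noteq> 0"
proof
  assume n: "N (sl y) = 0"
  note y0 = domFD(1)[OF y]
  let ?v = "m_up y - (d 1 (sl y) * mu (sl y) / F y) *\<^sub>R y"
  have F: "F y = \<phi> (sl y) * al y" by (simp add: ab_F_def)
  have "gF F y *v ?v = 0"
    using n F_pos unfolding N_def
    by (auto simp: vec_eq_iff gF_mult[OF y] ellv_dot inner_diff_right ly[OF y0] my[OF y0] hy[OF y0]
        lmh[OF y0] mmh[OF y0] hmh[OF y0] F algebra_simps simp flip: distrib_left)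
  then have v: "?v = 0" using gF_ker[OF y] by blast
  then have "lv y \<bullet> ?v = 0" "mv y \<bullet> ?v = 0" by simp_all
  then have "mu (sl y) = 0"
    by (simp add: inner_diff_right my[OF y0] mmh[OF y0])
  then show False using n rho_nz by (simp add: N_def)
qed

lemma ell_y: "ellv y \<bullet> y = F y"
  using domFD(1)[OF y] by (simp add: ellv_dot ly my ab_F_def)

lemma ell_m_up: "ellv y \<bullet> m_up y = d 1 (sl y) * mu (sl y)"
  using domFD(1)[OF y] by (simp add: ellv_dot lmh mmh)

lemma ell_g_up_m: "ellv y \<bullet> g_up_m y = 0"
  using F_pos by (simp add: g_up_m_def inner_diff_right ell_y ell_m_up)

lemma m_g_up_m: "mv y \<bullet> g_up_m y = mu (sl y) / N (sl y)"
  using domFD(1)[OF y] by (simp add: g_up_m_def inner_diff_right my mmh)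

lemma h_g_up_m: "hv i y \<bullet> g_up_m y = m i y / N (sl y)"
  using domFD(1)[OF y] by (simp add: g_up_m_def inner_diff_right hy hmh)

lemma gi_mv: "gi y *v mv y = g_up_m y"
proof (rule gi_eq[OF y])
  show "gF F y *v g_up_m y = mv y"
    using N_nz by (auto simp: vec_eq_iff gF_mult[OF y] ell_g_up_m m_g_up_m h_g_up_m rho_N field_simps)
qed

lemma ell_g_up_h: "ellv y \<bullet> g_up_h r y = 0"
proof -
  have "ellv y \<bullet> axis r 1 = \<phi> (sl y) * l r y + d 1 (sl y) * m r y"
    by (simp add: inner_axis ell_def)
  moreover have "F y = \<phi> (sl y) * al y" by (simp add: ab_F_def)
  ultimately show ?thesis
    using \<phi>_pos[OF domFD(2)[OF y]] domFD(3)[OF y]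
    by (simp add: g_up_h_def inner_diff_right ell_y ell_g_up_m) (simp add: field_simps)
qed

lemma m_g_up_h: "mv y \<bullet> g_up_h r y = m r y / N (sl y)"
proof -
  have "mv y \<bullet> g_up_h r y = (m r y - del (sl y) * m r y * (mu (sl y) / N (sl y))) / rho (sl y)"
    using domFD(1)[OF y] by (simp add: g_up_h_def inner_diff_right my m_g_up_m inner_axis)
  also have "m r y - del (sl y) * m r y * (mu (sl y) / N (sl y)) = m r y * rho (sl y) / N (sl y)"
    using N_nz by (simp add: rho_N field_simps)
  finally show ?thesis
    using rho_nz by simp
qed

lemma h_g_up_h: "hv i y \<bullet> g_up_h r y = (h i r y - del (sl y) * m i y * m r y / N (sl y)) / rho (sl y)"
  using domFD(1)[OF y] by (simp add: g_up_h_def inner_diff_right hy h_g_up_m inner_axis mult_ac)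

lemma gi_hv: "gi y *v hv r y = g_up_h r y"
proof (rule gi_eq[OF y])
  show "gF F y *v g_up_h r y = hv r y"
    using N_nz rho_nz
    by (auto simp: vec_eq_iff gF_mult[OF y] ell_g_up_h m_g_up_h h_g_up_h h_commute field_simps)
qed

lemma c3_eq: "(\<chi> s. c3 s i j y) = (1 / (2 * al y)) *\<^sub>R
  ((rho1 (sl y) * h i j y + kap (sl y) * m i y * m j y) *\<^sub>R mv y
    + (rho1 (sl y) * m j y) *\<^sub>R hv i y + (rho1 (sl y) * m i y) *\<^sub>R hv j y)"
  by (simp add: vec_eq_iff c3_def mv_def hv_def h_commute add_divide_distrib algebra_simps)

lemma Cartan_up_eq: "(\<chi> s. Cartan_up F s r k y) = (1 / (2 * al y)) *\<^sub>R
  ((rho1 (sl y) * h r k y + kap (sl y) * m r y * m k y) *\<^sub>R g_up_m y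
    + (rho1 (sl y) * m k y) *\<^sub>R g_up_h r y + (rho1 (sl y) * m r y) *\<^sub>R g_up_h k y)"
proof -
  have "(\<chi> s. Cartan_up F s r k y) = gi y *v (\<chi> s. c3 s r k y)"
    by (simp add: vec_eq_iff Cartan_up_def Cartan_eq[OF y] matrix_vector_mult_def)
  then show ?thesis
    by (simp add: c3_eq matrix_vector_mult_add_rdistrib matrix_vector_right_distrib
        matrix_vector_mult_scaleR gi_mv gi_hv)
qed

lemma Cartan_contract:
  "(\<Sum>s\<in>UNIV. Cartan F s i j y * Cartan_up F s r k y) = cartan_sq y i j r k / (4 * (al y)\<^sup>2)"
proof -
  have "(\<Sum>s\<in>UNIV. Cartan F s i j y * Cartan_up F s r k y)
     = (\<chi> s. c3 s i j y) \<bullet> (\<chi> s. Cartan_up F s r k y)"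
    by (simp add: inner_vec_def Cartan_eq[OF y])
  also have "\<dots> = cartan_sq y i j r k / (4 * (al y)\<^sup>2)"
    unfolding c3_eq Cartan_up_eq cartan_sq_def Let_def inner_add_left inner_add_right inner_scaleR_left inner_scaleR_right
      m_g_up_m h_g_up_m m_g_up_h h_g_up_h
    using rho_nz N_nz domFD(3)[OF y] h_commute[of k r] h_commute[of j r] h_commute[of i r] h_commute[of k i] h_commute[of k j]
    by (simp add: field_simps power2_eq_square)
  finally show ?thesis .
qed

end

text \<open>Three sources: the derivative of the Cartan tensor, its products with ell (the terms
  with \<open>d 1\<close>), and its square (the quotients by \<open>rho\<close> and
  \<open>N\<close>).\<close>

definition "Phi t = - t * \<phi> t * rho1 t - \<phi> t * (rho1 t)\<^sup>2 * mu t / (2 * N t)"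
definition "Psi t = - t * \<phi> t * kap t + 2 * rho1 t * d 1 t
  - \<phi> t / 2 * (2 * (rho1 t)\<^sup>2 / N t + rho1 t * kap t * mu t / N t + 2 * (rho1 t)\<^sup>2 / rho t)"
definition "Omega t = \<phi> t * kap1 t + 4 * kap t * d 1 t
  - 3 * \<phi> t / 2 * (4 * rho1 t * kap t / N t + (kap t)\<^sup>2 * mu t / N t - 4 * del t * (rho1 t)\<^sup>2 / (rho t * N t))"

text \<open>The terms with l, from differentiating m, h and 1/\<alpha>, are gathered in the
  symmetric last bracket, the form in which \<open>T_eq\<close> cancels them.\<close>

lemma grad_c3:
  assumes "y \<in> domF"
  shows "has_grad (c3 i j k) (\<lambda>r.
    (rho1 (sl y) * - (sl y) * (h i j y * h k r y + h i k y * h j r y + h j k y * h i r y)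
     - sl y * kap (sl y) * (m r y * (m i y * h j k y + m j y * h i k y + m k y * h i j y)
         + h i r y * m j y * m k y + h j r y * m i y * m k y + h k r y * m i y * m j y)
     + kap1 (sl y) * m i y * m j y * m k y * m r y) / (2 * (al y)\<^sup>2)
    - (l r y * c3 i j k y + l i y * c3 r j k y + l j y * c3 i r k y + l k y * c3 i j r y) / al y) y"
proof -
  have y0: "y \<noteq> 0" "sl y \<in> I" "al y \<noteq> 0" using domFD[OF assms] by auto
  note gh = grad_h[OF y0(1)] and gm = grad_m[OF y0(1)]
  have "has_grad (\<lambda>y. (rho1 (sl y) * (m i y * h j k y + m j y * h i k y + m k y * h i j y)
   + kap (sl y) * m i y * m j y * m k y) / (2 * al y)) (\<lambda>r. 
   (rho1 (sl y) * - (sl y) * (h i j y * h k r y + h i k y * h j r y + h j k y * h i r y)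
     - sl y * kap (sl y) * (m r y * (m i y * h j k y + m j y * h i k y + m k y * h i j y)
         + h i r y * m j y * m k y + h j r y * m i y * m k y + h k r y * m i y * m j y)
     + kap1 (sl y) * m i y * m j y * m k y * m r y) / (2 * (al y)\<^sup>2)
    - (l r y * c3 i j k y + l i y * c3 r j k y + l j y * c3 i r k y + l k y * c3 i j r y) / al y) y"
    by (rule has_grad_eq[OF has_grad_divide[OF has_grad_add[OF
          has_grad_mult[OF has_grad_compose[OF grad_sl DERIV_coeffs(2)]
            has_grad_add[OF has_grad_add[OF has_grad_mult[OF gm gh] has_grad_mult[OF gm gh]] has_grad_mult[OF gm gh]]]
          has_grad_mult[OF has_grad_mult[OF has_grad_mult[OF has_grad_compose[OF grad_sl DERIV_coeffs(4)] gm] gm] gm]]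
          has_grad_mult[OF has_grad_const grad_al]]])
       (use y0 in \<open>auto simp: field_simps c3_def power2_eq_square h_commute\<close>)
  then show ?thesis by (simp add: c3_def[abs_def])
qed

end

section \<open>The T-tensor and its contractions\<close>

context ab_fibre
begin

lemma cartan_sq_sum:
  "cartan_sq y i j r k + cartan_sq y j r i k + cartan_sq y i r j k =
    (rho1 (sl y))\<^sup>2 * mu (sl y) / N (sl y) * (h r i y * h j k y + h r j y * h i k y + h r k y * h i j y)
    + (2 * (rho1 (sl y))\<^sup>2 / N (sl y) + rho1 (sl y) * kap (sl y) * mu (sl y) / N (sl y) + 2 * (rho1 (sl y))\<^sup>2 / rho (sl y))
      * (h r i y * m j y * m k y + h r j y * m i y * m k y + h r k y * m i y * m j y
         + h i j y * m r y * m k y + h i k y * m r y * m j y + h j k y * m r y * m i y)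
    + 3 * (4 * rho1 (sl y) * kap (sl y) / N (sl y) + (kap (sl y))\<^sup>2 * mu (sl y) / N (sl y)
        - 4 * del (sl y) * (rho1 (sl y))\<^sup>2 / (rho (sl y) * N (sl y))) * m r y * m i y * m j y * m k y"
  unfolding cartan_sq_def Let_def h_commute[of i r] h_commute[of j r] h_commute[of k r] h_commute[of j i] h_commute[of k i] h_commute[of k j]
  by (simp add: divide_inverse algebra_simps)

lemma T_eq:
  assumes y: "y \<in> domF"
  shows "T_tensor F r i j k y =
   (Phi (sl y) * (h r i y * h j k y + h r j y * h i k y + h r k y * h i j y)
    + Psi (sl y) * (h r i y * m j y * m k y + h r j y * m i y * m k y + h r k y * m i y * m j y
         + h i j y * m r y * m k y + h i k y * m r y * m j y + h j k y * m r y * m i y)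
    + Omega (sl y) * m r y * m i y * m j y * m k y) / (2 * al y)"
proof -
  define t where "t = sl y"
  define hh where "hh = h r i y * h j k y + h r j y * h i k y + h r k y * h i j y"
  define hm where "hm = h r i y * m j y * m k y + h r j y * m i y * m k y + h r k y * m i y * m j y
         + h i j y * m r y * m k y + h i k y * m r y * m j y + h j k y * m r y * m i y"
  define mm where "mm = m r y * m i y * m j y * m k y"
  define lc where "lc = l r y * c3 i j k y + l i y * c3 r j k y + l j y * c3 i r k y + l k y * c3 i j r y"
  have al: "al y > 0" using domFD(3)[OF y] .
  have "has_grad (Cartan F i j k) (\<lambda>r.
    (rho1 (sl y) * - (sl y) * (h i j y * h k r y + h i k y * h j r y + h j k y * h i r y)
     - sl y * kap (sl y) * (m r y * (m i y * h j k y + m j y * h i k y + m k y * h i j y)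
         + h i r y * m j y * m k y + h j r y * m i y * m k y + h k r y * m i y * m j y)
     + kap1 (sl y) * m i y * m j y * m k y * m r y) / (2 * (al y)\<^sup>2)
    - (l r y * c3 i j k y + l i y * c3 r j k y + l j y * c3 i r k y + l k y * c3 i j r y) / al y) y"
    by (rule has_grad_transform[OF grad_c3[OF y] open_domF y]) (simp add: Cartan_eq)
  then have "pd r (Cartan F i j k) y =
    (rho1 (sl y) * - (sl y) * (h i j y * h k r y + h i k y * h j r y + h j k y * h i r y)
     - sl y * kap (sl y) * (m r y * (m i y * h j k y + m j y * h i k y + m k y * h i j y)
         + h i r y * m j y * m k y + h j r y * m i y * m k y + h k r y * m i y * m j y)
     + kap1 (sl y) * m i y * m j y * m k y * m r y) / (2 * (al y)\<^sup>2)
    - (l r y * c3 i j k y + l i y * c3 r j k y + l j y * c3 i r k y + l k y * c3 i j r y) / al y"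
    by (rule has_grad_pd)
  then have 1: "pd r (Cartan F i j k) y
      = (- t * rho1 t * hh - t * kap t * hm + kap1 t * mm) / (2 * (al y)\<^sup>2) - lc / al y"
    by (simp add: t_def[symmetric] hh_def hm_def mm_def lc_def h_commute algebra_simps)
  have 2: "(\<Sum>s\<in>UNIV. Cartan F s i j y * Cartan_up F s r k y
       + Cartan F s j r y * Cartan_up F s i k y + Cartan F s i r y * Cartan_up F s j k y)
     = ((rho1 t)\<^sup>2 * mu t / N t * hh
       + (2 * (rho1 t)\<^sup>2 / N t + rho1 t * kap t * mu t / N t + 2 * (rho1 t)\<^sup>2 / rho t) * hm
       + 3 * (4 * rho1 t * kap t / N t + (kap t)\<^sup>2 * mu t / N t
          - 4 * del t * (rho1 t)\<^sup>2 / (rho t * N t)) * mm) / (4 * (al y)\<^sup>2)"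
    unfolding sum.distrib Cartan_contract[OF y] add_divide_distrib[symmetric] cartan_sq_sum
    by (simp add: t_def hh_def hm_def mm_def mult.assoc)
  \<comment> \<open>As ell = \<phi> l + \<phi>' m, the l part gives \<phi> \<open>lc\<close>, which
    cancels the term -F \<open>lc\<close> / \<alpha> produced by the derivative of the Cartan
    tensor.\<close>
  have 3: "c3 r i j y * ell k y + c3 r i k y * ell j y + c3 r j k y * ell i y + c3 i j k y * ell r y
      = \<phi> t * lc + d 1 t * (2 * rho1 t * hm + 4 * kap t * mm) / (2 * al y)"
    unfolding ell_def lc_def t_def[symmetric] hm_def mm_def c3_def using al
    by (simp add: field_simps h_commute)
  have 4: "F y = al y * \<phi> t" by (simp add: ab_F_def t_def)
  have "T_tensor F r i j k y = al y * \<phi> t * ((- t * rho1 t * hh - t * kap t * hm + kap1 t * mm) / (2 * (al y)\<^sup>2) - lc / al y)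
    - al y * \<phi> t * (((rho1 t)\<^sup>2 * mu t / N t * hh
       + (2 * (rho1 t)\<^sup>2 / N t + rho1 t * kap t * mu t / N t + 2 * (rho1 t)\<^sup>2 / rho t) * hm
       + 3 * (4 * rho1 t * kap t / N t + (kap t)\<^sup>2 * mu t / N t
          - 4 * del t * (rho1 t)\<^sup>2 / (rho t * N t)) * mm) / (4 * (al y)\<^sup>2))
    + (\<phi> t * lc + d 1 t * (2 * rho1 t * hm + 4 * kap t * mm) / (2 * al y))"
    unfolding T_tensor_def 1 2 4 has_grad_pd[OF grad_F[OF y]] unfolding Cartan_eq[OF y] using 3 by linarith
  also have "\<dots> = (Phi t * hh + Psi t * hm + Omega t * mm) / (2 * al y)"
  proof -
    \<comment> \<open>With the quotients named, both sides are linear in them and no denominators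
      have to be cleared.\<close>
    define X Y Z where "X = (rho1 t)\<^sup>2 * mu t / N t"
      and "Y = 2 * (rho1 t)\<^sup>2 / N t + rho1 t * kap t * mu t / N t + 2 * (rho1 t)\<^sup>2 / rho t"
      and "Z = 4 * rho1 t * kap t / N t + (kap t)\<^sup>2 * mu t / N t - 4 * del t * (rho1 t)\<^sup>2 / (rho t * N t)"
    have P: "Phi t = - t * \<phi> t * rho1 t - \<phi> t / 2 * X"
      "Psi t = - t * \<phi> t * kap t + 2 * rho1 t * d 1 t - \<phi> t / 2 * Y"
      "Omega t = \<phi> t * kap1 t + 4 * kap t * d 1 t - 3 * \<phi> t / 2 * Z"
      by (simp_all add: Phi_def Psi_def Omega_def X_def Y_def Z_def)
    have step: "al y * \<phi> t * (u / (2 * (al y)\<^sup>2) - lc / al y) - al y * \<phi> t * (v / (4 * (al y)\<^sup>2)) + (\<phi> t * lc + w / (2 * al y))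
       = (\<phi> t * u - \<phi> t / 2 * v + w) / (2 * al y)" for u v w
      using al by (simp add: field_simps power2_eq_square)
    show ?thesis
      unfolding step X_def[symmetric] Y_def[symmetric] Z_def[symmetric] P
      by (rule arg_cong[where f = "\<lambda>x. x / (2 * al y)"]) (simp add: algebra_simps)
  qed
  finally show ?thesis by (simp add: hh_def hm_def mm_def t_def mult.assoc)
qed

lemma T_zero:
  assumes "y \<in> domF" "Phi (sl y) = 0" "mu (sl y) \<noteq> 0 \<Longrightarrow> Psi (sl y) = 0 \<and> Omega (sl y) = 0"
  shows "T_tensor F r i j k y = 0"
  using assms mu_zero[OF domFD(1)[OF assms(1)]] by (cases "mu (sl y) = 0") (auto simp: T_eq)

section \<open>Contraction of the T-tensor with a covector\<close>

definition "sT \<sigma> i j k y = (\<Sum>h\<in>UNIV. \<sigma> $ h * T_tensor_up F h i j k y)"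

lemma sT_eq:
  assumes y: "y \<in> domF"
  shows "sT \<sigma> i j k y =
    (Phi (sl y) * ((\<sigma> \<bullet> g_up_h i y) * h j k y + (\<sigma> \<bullet> g_up_h j y) * h i k y + (\<sigma> \<bullet> g_up_h k y) * h i j y)
     + Psi (sl y) * ((\<sigma> \<bullet> g_up_h i y) * m j y * m k y + (\<sigma> \<bullet> g_up_h j y) * m i y * m k y + (\<sigma> \<bullet> g_up_h k y) * m i y * m j y
         + (\<sigma> \<bullet> g_up_m y) * (h i j y * m k y + h i k y * m j y + h j k y * m i y))
     + Omega (sl y) * (\<sigma> \<bullet> g_up_m y) * m i y * m j y * m k y) / (2 * al y)"
proof -
  \<comment> \<open>\<open>V\<close> is \<sigma> with its index raised by g. Only its pairings with
    h_i and m are needed, and these are pairings of \<sigma> with the known vectors g^{-1} h_i and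
    g^{-1} m.\<close>
  define V where "V r = (\<Sum>h\<in>UNIV. \<sigma> $ h * gi y $ h $ r)" for r
  have V: "(\<Sum>r\<in>UNIV. V r * u $ r) = \<sigma> \<bullet> (gi y *v u)" for u
    unfolding V_def inner_vec_def matrix_vector_mult_def
    by (simp add: sum_distrib_left sum_distrib_right mult.assoc) (rule sum.swap)
  have Vh: "(\<Sum>r\<in>UNIV. V r * h r i y) = \<sigma> \<bullet> g_up_h i y" for i
    using V[of "hv i y"] by (simp add: gi_hv[OF y] h_commute)
  have Vm: "(\<Sum>r\<in>UNIV. V r * m r y) = \<sigma> \<bullet> g_up_m y"
    using V[of "mv y"] by (simp add: gi_mv[OF y])
  have "sT \<sigma> i j k y = (\<Sum>r\<in>UNIV. V r * T_tensor F r i j k y)"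
    unfolding sT_def T_tensor_up_def V_def
    by (simp add: sum_distrib_left sum_distrib_right mult.assoc) (rule sum.swap)
  also have "\<dots> = (\<Sum>r\<in>UNIV. 
     Phi (sl y) / (2 * al y) * (h j k y * (V r * h r i y) + h i k y * (V r * h r j y) + h i j y * (V r * h r k y))
    + Psi (sl y) / (2 * al y) * (m j y * m k y * (V r * h r i y) + m i y * m k y * (V r * h r j y) + m i y * m j y * (V r * h r k y)
         + (h i j y * m k y + h i k y * m j y + h j k y * m i y) * (V r * m r y))
    + Omega (sl y) / (2 * al y) * m i y * m j y * m k y * (V r * m r y))"
    unfolding T_eq[OF y] by (intro sum.cong refl) (simp add: algebra_simps add_divide_distrib)
  also have "\<dots> = Phi (sl y) / (2 * al y) * (h j k y * (\<sigma> \<bullet> g_up_h i y) + h i k y * (\<sigma> \<bullet> g_up_h j y) + h i j y * (\<sigma> \<bullet> g_up_h k y))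
    + Psi (sl y) / (2 * al y) * (m j y * m k y * (\<sigma> \<bullet> g_up_h i y) + m i y * m k y * (\<sigma> \<bullet> g_up_h j y) + m i y * m j y * (\<sigma> \<bullet> g_up_h k y)
         + (h i j y * m k y + h i k y * m j y + h j k y * m i y) * (\<sigma> \<bullet> g_up_m y))
    + Omega (sl y) / (2 * al y) * m i y * m j y * m k y * (\<sigma> \<bullet> g_up_m y)"
    unfolding sum.distrib sum_distrib_left[symmetric] Vh Vm ..
  finally show ?thesis
    by (simp add: algebra_simps add_divide_distrib)
qed

text \<open>Up to a common factor, the coefficients of m h and of m m m in m_r T^r_ijk.\<close>

definition "E1 t = Phi t + Psi t * mu t"
definition "E2 t = 3 * Psi t + Omega t * mu t"

lemma factor_nz:
  assumes "y \<in> domF"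
  shows "1 - sl y * d 1 (sl y) / \<phi> (sl y) \<noteq> 0"
  using rho_nz[OF assms] \<phi>_pos[OF domFD(2)[OF assms]] by (auto simp: rho_def field_simps)

lemma b_dot:
  assumes y: "y \<in> domF"
  shows "b \<bullet> g_up_m y = (1 - sl y * d 1 (sl y) / \<phi> (sl y)) * (mu (sl y) / N (sl y))"
    "b \<bullet> g_up_h r y = (1 - sl y * d 1 (sl y) / \<phi> (sl y)) * (m r y / N (sl y))"
proof -
  \<comment> \<open>The condition ell(v) = 0 expresses l(v) by m(v), so that b(v) = m(v) + s l(v)
    becomes a multiple of m(v). Both g^{-1} m and g^{-1} h_r satisfy it.\<close>
  have b: "b \<bullet> v = (1 - sl y * d 1 (sl y) / \<phi> (sl y)) * (mv y \<bullet> v)" if "ellv y \<bullet> v = 0" for v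
  proof -
    have l: "lv y \<bullet> v = - d 1 (sl y) * (mv y \<bullet> v) / \<phi> (sl y)"
      using that \<phi>_pos[OF domFD(2)[OF y]] by (simp add: ellv_dot field_simps add_eq_0_iff)
    have "b \<bullet> v = mv y \<bullet> v + sl y * (lv y \<bullet> v)" using mv_dot[of y v] by simp
    then show ?thesis unfolding l by (simp add: algebra_simps)
  qed
  show "b \<bullet> g_up_m y = (1 - sl y * d 1 (sl y) / \<phi> (sl y)) * (mu (sl y) / N (sl y))"
    using b[OF ell_g_up_m[OF y]] by (simp add: m_g_up_m[OF y])
  show "b \<bullet> g_up_h r y = (1 - sl y * d 1 (sl y) / \<phi> (sl y)) * (m r y / N (sl y))"
    using b[OF ell_g_up_h[OF y]] by (simp add: m_g_up_h[OF y])
qed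

lemma sT_parallel:
  assumes y: "y \<in> domF"
  shows "sT (w *\<^sub>R b) i j k y = w * (1 - sl y * d 1 (sl y) / \<phi> (sl y)) / (2 * al y * N (sl y)) *
    (E1 (sl y) * (m i y * h j k y + m j y * h i k y + m k y * h i j y) + E2 (sl y) * m i y * m j y * m k y)"
proof -
  have ring: "P * ((w * (c * (m1 * q))) * h1 + (w * (c * (m2 * q))) * h2 + (w * (c * (m3 * q))) * h3)
     + Q * ((w * (c * (m1 * q))) * m2 * m3 + (w * (c * (m2 * q))) * m1 * m3 + (w * (c * (m3 * q))) * m1 * m2
         + (w * (c * (u * q))) * (h3 * m3 + h2 * m2 + h1 * m1))
     + R * (w * (c * (u * q))) * m1 * m2 * m3
    = w * c * q * ((P + Q * u) * (m1 * h1 + m2 * h2 + m3 * h3) + (3 * Q + R * u) * m1 * m2 * m3)"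
    for P Q R c q u m1 m2 m3 h1 h2 h3 :: real
    by (simp add: algebra_simps)
  have div: "w * c * inverse n * X / (2 * e) = w * c / (2 * e * n) * X" for c n X e :: real
    by (cases "n = 0"; cases "e = 0") (simp_all add: field_simps)
  show ?thesis
    unfolding sT_eq[OF y] inner_scaleR_left b_dot[OF y] E1_def E2_def divide_inverse[of _ "N (sl y)"] ring
    by (rule div)
qed

lemma sT_parallel_zero:
  assumes y: "y \<in> domF" and "mu (sl y) \<noteq> 0 \<Longrightarrow> E1 (sl y) = 0 \<and> E2 (sl y) = 0"
  shows "sT (w *\<^sub>R b) i j k y = 0"
  using assms mu_zero[OF domFD(1)[OF y]] by (cases "mu (sl y) = 0") (auto simp: sT_parallel)

lemma h_perp:
  assumes "y \<noteq> 0" "p \<bullet> (a *v y) = 0" "p \<bullet> b = 0"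
  shows "lv y \<bullet> p = 0" "mv y \<bullet> p = 0" "hv i y \<bullet> p = (a *v p) $ i"
proof -
  show l: "lv y \<bullet> p = 0" using assms by (simp add: lv_dot) (simp add: inner_commute)
  then show "mv y \<bullet> p = 0" using assms by (simp add: mv_dot) (simp add: inner_commute)
  show "hv i y \<bullet> p = (a *v p) $ i" by (simp add: hv_dot l)
qed

lemma sum_h: "(\<Sum>i\<in>UNIV. p $ i * h i j y) = hv j y \<bullet> p" "(\<Sum>i\<in>UNIV. p $ i * h j i y) = hv j y \<bullet> p"
   "(\<Sum>i\<in>UNIV. p $ i * m i y) = mv y \<bullet> p"
  by (simp_all add: inner_vec_def h_commute mult.commute)

text \<open>Contract one index with \<open>m_up\<close> and another with \<open>p\<close>. Every m
  is killed by \<open>p\<close>, so \<open>E2\<close> drops out and E1 mu (a p)_k remains, where a p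
  is nonzero.\<close>

lemma E1_parallel:
  assumes y: "y \<in> domF" and "w \<noteq> 0" "\<And>i j k. sT (w *\<^sub>R b) i j k y = 0" "mu (sl y) \<noteq> 0"
  shows "E1 (sl y) = 0"
proof -
  note y0 = domFD(1)[OF y]
  obtain p where p: "p \<noteq> 0" "p \<bullet> (a *v y) = 0" "p \<bullet> b = 0"
    using orthogonal_to_two_exists[OF card] by metis
  note hp = h_perp[OF y0 p(2,3)]
  let ?e = "E1 (sl y)" and ?f = "E2 (sl y)"
  have z: "?e * (m i y * h j k y + m j y * h i k y + m k y * h i j y) + ?f * m i y * m j y * m k y = 0" for i j k
    using assms(2) assms(3)[of i j k] factor_nz[OF y] N_nz[OF y] domFD(3)[OF y] \<phi>_pos[OF domFD(2)[OF y]]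
    unfolding sT_parallel[OF y] by auto
  have 1: "?e * (mu (sl y) * h j k y + 2 * m j y * m k y) + ?f * mu (sl y) * m j y * m k y = 0" for j k
  proof -
    have "0 = (\<Sum>i\<in>UNIV. m_up y $ i * (?e * (m i y * h j k y + m j y * h i k y + m k y * h i j y) + ?f * m i y * m j y * m k y))"
      by (simp add: z)
    also have "\<dots> = (\<Sum>i\<in>UNIV. (?e * h j k y + ?f * m j y * m k y) * (m_up y $ i * m i y) + ?e * m j y * (m_up y $ i * h i k y) + ?e * m k y * (m_up y $ i * h i j y))"
      by (intro sum.cong refl) (simp add: algebra_simps)
    also have "\<dots> = ?e * (mu (sl y) * h j k y + 2 * m j y * m k y) + ?f * mu (sl y) * m j y * m k y"
      unfolding sum.distrib sum_distrib_left[symmetric] sum_h by (simp add: mmh[OF y0] hmh[OF y0] algebra_simps)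
    finally show ?thesis by simp
  qed
  have 2: "?e * mu (sl y) * (a *v p) $ k = 0" for k
  proof -
    have "0 = (\<Sum>j\<in>UNIV. p $ j * (?e * (mu (sl y) * h j k y + 2 * m j y * m k y) + ?f * mu (sl y) * m j y * m k y))"
      by (simp add: 1)
    also have "\<dots> = (\<Sum>j\<in>UNIV. (?e * mu (sl y)) * (p $ j * h j k y) + (?e * 2 * m k y + ?f * mu (sl y) * m k y) * (p $ j * m j y))"
      by (intro sum.cong refl) (simp add: algebra_simps)
    also have "\<dots> = ?e * mu (sl y) * (a *v p) $ k"
      unfolding sum.distrib sum_distrib_left[symmetric] sum_h by (simp add: hp)
    finally show ?thesis by simp
  qed
  have "a *v p \<noteq> 0" using a_pos[OF p(1)] by auto
  then obtain k where "(a *v p) $ k \<noteq> 0" by (auto simp: vec_eq_iff)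
  then show ?thesis using 2[of k] assms(4) by simp
qed

text \<open>Contract one index with \<open>p\<close>, on which \<sigma> does not vanish but l and m
  do, and the other two with \<open>m_up\<close>. The remaining pairings of \<sigma> end up
  multiplied by the pairing of a p with \<open>m_up\<close>, which is m(p) = 0.\<close>

lemma E1_nonparallel:
  assumes y: "y \<in> domF" and z: "\<And>i j k. sT \<sigma> i j k y = 0" and mu: "mu (sl y) \<noteq> 0"
    and p: "p \<bullet> (a *v y) = 0" "p \<bullet> b = 0" "\<sigma> \<bullet> p \<noteq> 0"
  shows "E1 (sl y) = 0"
proof -
  note y0 = domFD(1)[OF y]
  note hp = h_perp[OF y0 p(1,2)]
  let ?P = "Phi (sl y)" and ?Q = "Psi (sl y)" and ?R = "Omega (sl y)"
  let ?h = "\<lambda>i. \<sigma> \<bullet> g_up_h i y" and ?m = "\<sigma> \<bullet> g_up_m y"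
  have z: "?P * (?h i * h j k y + ?h j * h i k y + ?h k * h i j y)
     + ?Q * (?h i * m j y * m k y + ?h j * m i y * m k y + ?h k * m i y * m j y
         + ?m * (h i j y * m k y + h i k y * m j y + h j k y * m i y))
     + ?R * ?m * m i y * m j y * m k y = 0" for i j k
    using z[of i j k] domFD(3)[OF y] by (simp add: sT_eq[OF y])
  have sum_X: "(\<Sum>i\<in>UNIV. v $ i * ?h i) = \<sigma> \<bullet> (gi y *v (\<chi> j. hv j y \<bullet> v))" for v
  proof -
    have "(\<Sum>i\<in>UNIV. v $ i * ?h i) = \<sigma> \<bullet> (\<Sum>i\<in>UNIV. v $ i *\<^sub>R (gi y *v hv i y))"
      by (simp add: gi_hv[OF y] inner_sum_right)
    also have "(\<Sum>i\<in>UNIV. v $ i *\<^sub>R (gi y *v hv i y)) = gi y *v (\<Sum>i\<in>UNIV. v $ i *\<^sub>R hv i y)"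
      by (simp add: linear_sum[OF matrix_vector_mul_linear] matrix_vector_mult_scaleR)
    also have "(\<Sum>i\<in>UNIV. v $ i *\<^sub>R hv i y) = (\<chi> j. hv j y \<bullet> v)"
      by (simp add: vec_eq_iff sum_h(1))
    finally show ?thesis .
  qed
  \<comment> \<open>On \<open>p\<close> the metric g acts as rho a, because ell and m vanish
    there.\<close>
  have "gF F y *v ((1 / rho (sl y)) *\<^sub>R p) = (\<chi> j. hv j y \<bullet> p)"
    using rho_nz[OF y] by (simp add: vec_eq_iff gF_mult[OF y] ellv_dot hp)
  from gi_eq[OF y this] have Xp: "(\<Sum>i\<in>UNIV. p $ i * ?h i) = \<sigma> \<bullet> p / rho (sl y)"
    by (simp add: sum_X)
  let ?u = "\<sigma> \<bullet> p / rho (sl y)"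
  have 1: "?P * (?h i * 0 + ?h j * 0 + ?u * h i j y) + ?P * (?h i * (a *v p) $ j + ?h j * (a *v p) $ i)
      + ?Q * (?u * m i y * m j y + ?m * ((a *v p) $ i * m j y + (a *v p) $ j * m i y)) = 0" for i j
  proof -
    have "0 = (\<Sum>k\<in>UNIV. p $ k * (?P * (?h i * h j k y + ?h j * h i k y + ?h k * h i j y)
     + ?Q * (?h i * m j y * m k y + ?h j * m i y * m k y + ?h k * m i y * m j y
         + ?m * (h i j y * m k y + h i k y * m j y + h j k y * m i y))
     + ?R * ?m * m i y * m j y * m k y))"
      by (simp add: z)
    also have "\<dots> = (\<Sum>k\<in>UNIV. (?P * ?h i + ?Q * ?m * m i y) * (p $ k * h j k y)
        + (?P * ?h j + ?Q * ?m * m j y) * (p $ k * h i k y)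
        + (?P * h i j y + ?Q * m i y * m j y) * (p $ k * ?h k)
        + (?Q * ?h i * m j y + ?Q * ?h j * m i y + ?Q * ?m * h i j y + ?R * ?m * m i y * m j y) * (p $ k * m k y))"
      by (intro sum.cong refl) (simp add: algebra_simps)
    also have "\<dots> = ?P * (?h i * 0 + ?h j * 0 + ?u * h i j y) + ?P * (?h i * (a *v p) $ j + ?h j * (a *v p) $ i)
      + ?Q * (?u * m i y * m j y + ?m * ((a *v p) $ i * m j y + (a *v p) $ j * m i y))"
      unfolding sum.distrib sum_distrib_left[symmetric] sum_h Xp by (simp add: hp algebra_simps)
    finally show ?thesis by simp
  qed
  have amh: "(\<Sum>i\<in>UNIV. m_up y $ i * (a *v p) $ i) = 0"
  proof -
    have "(\<Sum>i\<in>UNIV. m_up y $ i * (a *v p) $ i) = m_up y \<bullet> (a *v p)" by (simp add: inner_vec_def)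
    also have "\<dots> = 0" unfolding a_adjoint by (simp add: a_m_up[OF y0] hp)
    finally show ?thesis .
  qed
  let ?v = "\<Sum>i\<in>UNIV. m_up y $ i * ?h i"
  have 2: "?P * ?u * m j y + ?P * ?v * (a *v p) $ j + ?Q * (?u * mu (sl y) * m j y + ?m * mu (sl y) * (a *v p) $ j) = 0" for j
  proof -
    have "0 = (\<Sum>i\<in>UNIV. m_up y $ i * (?P * (?h i * 0 + ?h j * 0 + ?u * h i j y) + ?P * (?h i * (a *v p) $ j + ?h j * (a *v p) $ i)
      + ?Q * (?u * m i y * m j y + ?m * ((a *v p) $ i * m j y + (a *v p) $ j * m i y))))"
      by (simp only: 1) simp
    also have "\<dots> = (\<Sum>i\<in>UNIV. ?P * ?u * (m_up y $ i * h i j y) + ?P * (a *v p) $ j * (m_up y $ i * ?h i)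
        + (?P * ?h j + ?Q * ?m * m j y) * (m_up y $ i * (a *v p) $ i)
        + (?Q * ?u * m j y + ?Q * ?m * (a *v p) $ j) * (m_up y $ i * m i y))"
      by (intro sum.cong refl) (simp add: algebra_simps)
    also have "\<dots> = ?P * ?u * m j y + ?P * ?v * (a *v p) $ j + ?Q * (?u * mu (sl y) * m j y + ?m * mu (sl y) * (a *v p) $ j)"
      unfolding sum.distrib sum_distrib_left[symmetric] sum_h amh by (simp add: mmh[OF y0] hmh[OF y0] algebra_simps)
    finally show ?thesis by simp
  qed
  have "0 = (\<Sum>j\<in>UNIV. m_up y $ j * (?P * ?u * m j y + ?P * ?v * (a *v p) $ j + ?Q * (?u * mu (sl y) * m j y + ?m * mu (sl y) * (a *v p) $ j)))"
    by (simp only: 2) simp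
  also have "\<dots> = (\<Sum>j\<in>UNIV. (?P * ?u + ?Q * ?u * mu (sl y)) * (m_up y $ j * m j y) + (?P * ?v + ?Q * ?m * mu (sl y)) * (m_up y $ j * (a *v p) $ j))"
    by (intro sum.cong refl) (simp add: algebra_simps)
  also have "\<dots> = ?u * mu (sl y) * E1 (sl y)"
    unfolding sum.distrib sum_distrib_left[symmetric] sum_h amh by (simp add: mmh[OF y0] E1_def algebra_simps)
  finally show ?thesis using mu p(3) rho_nz[OF y] by simp
qed

text \<open>\<open>y\<close> combines \<open>b_up\<close> with a vector \<open>u\<close> that is
  a-orthogonal to \<open>b_up\<close> and to \<open>p\<close>. The coefficient t/B prescribes
  \<beta>(y) = t, and \<open>r\<close> normalises \<alpha>(y) to 1.\<close>

lemma direction_exists: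
  assumes "b \<noteq> 0" "t\<^sup>2 < B" "p \<bullet> b = 0"
  obtains y where "y \<noteq> 0" "sl y = t" "p \<bullet> (a *v y) = 0"
proof -
  have Bp: "B > 0" using B_pos assms by simp
  obtain u where u: "u \<noteq> 0" "u \<bullet> b = 0" "u \<bullet> (a *v p) = 0"
    using orthogonal_to_two_exists[OF card] by metis
  define A where "A = u \<bullet> (a *v u)"
  have A: "A > 0" using a_pos[OF u(1)] by (simp add: A_def)
  define r where "r = sqrt ((1 - t\<^sup>2 / B) / A)"
  define y where "y = (t / B) *\<^sub>R b_up + r *\<^sub>R u"
  have r2: "r\<^sup>2 * A = 1 - t\<^sup>2 / B"
    using A Bp assms(2) by (simp add: r_def)
  have ay: "a *v y = (t / B) *\<^sub>R b + r *\<^sub>R (a *v u)"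
    by (simp add: y_def matrix_vector_right_distrib matrix_vector_mult_scaleR a_b_up)
  have b_up_au: "b_up \<bullet> (a *v u) = 0" unfolding a_adjoint a_b_up using u by (simp add: inner_commute)
  have "y \<bullet> (a *v y) = (t / B)\<^sup>2 * B + r\<^sup>2 * A"
    unfolding ay using B_eq b_up_au u
    by (simp add: y_def inner_add_left inner_add_right power2_eq_square A_def inner_commute[of b_up b])
  also have "\<dots> = 1" unfolding r2 using Bp by (simp add: power2_eq_square)
  finally have 1: "al y = 1" by (simp add: al_eq)
  have "b \<bullet> y = t" using B_eq Bp u by (simp add: y_def inner_add_right inner_commute[of b u])
  then have "sl y = t" by (simp add: ab_s_def 1 \<beta>_eq)
  moreover have "p \<bullet> (a *v u) = 0" unfolding a_adjoint using u by (simp add: inner_commute)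
  then have "p \<bullet> (a *v y) = 0" unfolding ay using assms by (simp add: inner_add_right)
  moreover have "y \<noteq> 0" using 1 by (auto simp: al_eq)
  ultimately show thesis using that by blast
qed

lemma domF_I: "y \<noteq> 0 \<Longrightarrow> sl y \<in> I \<Longrightarrow> y \<in> domF"
  by (simp add: ab_cone_def)

lemma rho_N_nz:
  assumes "b \<noteq> 0" "t \<in> I" "t\<^sup>2 < B"
  shows "rho t \<noteq> 0" "N t \<noteq> 0"
  using direction_exists[OF assms(1,3), of 0] rho_nz N_nz domF_I assms(2) by (metis inner_zero_left)+

lemma E1_zero:
  assumes b: "b \<noteq> 0" and \<sigma>: "\<sigma> \<noteq> 0" and t: "t \<in> I" "t\<^sup>2 < B"
    and z: "\<And>y i j k. y \<in> domF \<Longrightarrow> sT \<sigma> i j k y = 0"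
  shows "E1 t = 0"
proof -
  \<comment> \<open>A vector killed by b on which \<sigma> takes the value |p|^2; it is zero exactly
    when \<sigma> is a multiple of b.\<close>
  define p where "p = \<sigma> - (\<sigma> \<bullet> b / (b \<bullet> b)) *\<^sub>R b"
  have pb: "p \<bullet> b = 0" using b by (simp add: p_def inner_diff_left)
  have sp: "\<sigma> \<bullet> p = p \<bullet> p"
    using pb by (simp add: p_def inner_diff_left inner_diff_right inner_commute)
  obtain y where y: "y \<noteq> 0" "sl y = t" "p \<bullet> (a *v y) = 0"
    using direction_exists[OF b t(2) pb] .
  have yd: "y \<in> domF" using domF_I y t by simp
  have mu: "mu (sl y) \<noteq> 0" using t y by (simp add: mu_def)
  show ?thesis
  proof (cases "p = 0")
    case True
    then have "\<sigma> = (\<sigma> \<bullet> b / (b \<bullet> b)) *\<^sub>R b" by (simp add: p_def)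
    moreover from this have "\<sigma> \<bullet> b / (b \<bullet> b) \<noteq> 0" using \<sigma> by auto
    ultimately show ?thesis using E1_parallel[OF yd _ _ mu] z[OF yd] y by metis
  next
    case False
    then have "\<sigma> \<bullet> p \<noteq> 0" using sp by simp
    from E1_nonparallel[OF yd z[OF yd] mu y(3) pb this] show ?thesis using y by simp
  qed
qed

end

section \<open>The differential equation for $\phi$\<close>

text \<open>
  To be read at $q = Q(t)$, $q_1 = Q'(t)$, $q_2 = Q''(t)$. The zeros of the first expression are
  $1 + tQ = C(b^2 - t^2)$, with a pole of $Q$ at $0$ when $g_{ij}$ is nondegenerate, and those of
  the second are the explicit family; the third one is $\det g_{ij}$ up to a nonzero factor.
\<close>

definition sing_expr :: "real \<Rightarrow> real \<Rightarrow> real \<Rightarrow> real \<Rightarrow> real" where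
  "sing_expr B t q q1 = 2 * t * (1 + t * q) + (B - t\<^sup>2) * (q + t * q1)"
definition lin_expr :: "real \<Rightarrow> real \<Rightarrow> real \<Rightarrow> real \<Rightarrow> real \<Rightarrow> real" where
  "lin_expr B t q q1 q2 = (B - t\<^sup>2) * q2 + q - t * q1"
definition nondeg_expr :: "real \<Rightarrow> real \<Rightarrow> real \<Rightarrow> real \<Rightarrow> real" where
  "nondeg_expr B t q q1 = 1 + t * q + (B - t\<^sup>2) * q1"

lemma has_real_derivative_zero_on:
  fixes g :: "real \<Rightarrow> real"
  assumes "open J" "t \<in> J" "\<And>s. s \<in> J \<Longrightarrow> g s = 0" "(g has_real_derivative g') (at t)"
  shows "g' = 0"
proof -
  have "((\<lambda>_. 0) has_real_derivative g') (at t)"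
    using has_field_derivative_transform_within_open[OF assms(4,1,2), of "\<lambda>_. 0"] assms(3) by simp
  then show ?thesis using DERIV_unique DERIV_const by blast
qed

text \<open>Q is common to all points; \<open>B\<close> and \<open>J\<close> vary with the point, so
  there is one instance per point with b \<noteq> 0.\<close>

locale ode =
  fixes J :: "real set" and Q Q1 Q2 Q3 :: "real \<Rightarrow> real" and B :: real
  assumes open_J: "open J" and connected_J: "connected J"
    and J_lt: "t \<in> J \<Longrightarrow> t\<^sup>2 < B"
    and DERIV_Q: "t \<in> J \<Longrightarrow> (Q has_real_derivative Q1 t) (at t)"
    and DERIV_Q1: "t \<in> J \<Longrightarrow> (Q1 has_real_derivative Q2 t) (at t)"
    and DERIV_Q2: "t \<in> J \<Longrightarrow> (Q2 has_real_derivative Q3 t) (at t)"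
    and nondeg_expr_nz: "t \<in> J \<Longrightarrow> nondeg_expr B t (Q t) (Q1 t) \<noteq> 0"
begin

lemma DERIV_sing_expr:
  assumes "t \<in> J"
  shows "((\<lambda>t. sing_expr B t (Q t) (Q1 t)) has_real_derivative
      2 * (1 + t * Q t) + (B - t\<^sup>2) * (2 * Q1 t + t * Q2 t)) (at t)"
  unfolding sing_expr_def
  by (auto intro!: derivative_eq_intros DERIV_Q DERIV_Q1 assms simp: algebra_simps power2_eq_square)

lemma DERIV_lin_expr:
  assumes "t \<in> J"
  shows "((\<lambda>t. lin_expr B t (Q t) (Q1 t) (Q2 t)) has_real_derivative (B - t\<^sup>2) * Q3 t - 3 * t * Q2 t) (at t)"
  unfolding lin_expr_def
  by (auto intro!: derivative_eq_intros DERIV_Q DERIV_Q1 DERIV_Q2 assms simp: algebra_simps power2_eq_square)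

text \<open>Stated on an open subset because the dichotomy applies it where the other factor is
  nonzero, before anything is known on all of \<open>J\<close>.\<close>

lemma sing_expr_derivs:
  assumes "open U" "U \<subseteq> J" "\<And>s. s \<in> U \<Longrightarrow> sing_expr B s (Q s) (Q1 s) = 0" "t \<in> U"
  shows "2 * (1 + t * Q t) + (B - t\<^sup>2) * (2 * Q1 t + t * Q2 t) = 0"
    and "2 * (Q t + t * Q1 t) - 2 * t * (2 * Q1 t + t * Q2 t) + (B - t\<^sup>2) * (3 * Q2 t + t * Q3 t) = 0"
proof -
  have z: "2 * (1 + t * Q t) + (B - t\<^sup>2) * (2 * Q1 t + t * Q2 t) = 0" if "t \<in> U" for t
    using has_real_derivative_zero_on[OF assms(1) that assms(3) DERIV_sing_expr] that assms(2) by auto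
  show "2 * (1 + t * Q t) + (B - t\<^sup>2) * (2 * Q1 t + t * Q2 t) = 0"
    using z assms(4) .
  have tJ: "t \<in> J" using assms by auto
  have "((\<lambda>t. 2 * (1 + t * Q t) + (B - t\<^sup>2) * (2 * Q1 t + t * Q2 t)) has_real_derivative
     2 * (Q t + t * Q1 t) - 2 * t * (2 * Q1 t + t * Q2 t) + (B - t\<^sup>2) * (3 * Q2 t + t * Q3 t)) (at t)"
    by (auto intro!: derivative_eq_intros DERIV_Q DERIV_Q1 DERIV_Q2 tJ simp: algebra_simps power2_eq_square)
  then show "2 * (Q t + t * Q1 t) - 2 * t * (2 * Q1 t + t * Q2 t) + (B - t\<^sup>2) * (3 * Q2 t + t * Q3 t) = 0"
    using has_real_derivative_zero_on[OF assms(1,4), of "\<lambda>t. 2 * (1 + t * Q t) + (B - t\<^sup>2) * (2 * Q1 t + t * Q2 t)"] z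
    by blast
qed

text \<open>With D the nondegeneracy expression, the hypotheses say t (B - t^2) Q'' = -2D and (B -
  t^2)(Q - t Q') = -2tD. \<open>B'\<close> is free: \<open>B' = B\<close> separates the two factors
  in one tangent space, another value compares two points.\<close>

lemma lin_expr_at_sing_expr_zero:
  assumes "sing_expr B t (Q t) (Q1 t) = 0"
    and "2 * (1 + t * Q t) + (B - t\<^sup>2) * (2 * Q1 t + t * Q2 t) = 0"
  shows "t * (B - t\<^sup>2) * lin_expr B' t (Q t) (Q1 t) (Q2 t) = - 2 * nondeg_expr B t (Q t) (Q1 t) * B'"
  using assms unfolding sing_expr_def nondeg_expr_def lin_expr_def by algebra

lemma dichotomy:
  assumes z: "\<And>t. t \<in> J \<Longrightarrow> sing_expr B t (Q t) (Q1 t) * lin_expr B t (Q t) (Q1 t) (Q2 t) = 0"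
  shows "(\<forall>t\<in>J. lin_expr B t (Q t) (Q1 t) (Q2 t) = 0) \<or> (\<forall>t\<in>J. t \<noteq> 0 \<and> sing_expr B t (Q t) (Q1 t) = 0)"
proof -
  let ?f = "\<lambda>t. lin_expr B t (Q t) (Q1 t) (Q2 t)" and ?d = "\<lambda>t. nondeg_expr B t (Q t) (Q1 t)"
  \<comment> \<open>Equal to 0 where \<open>?f\<close> vanishes and to -2B elsewhere, while
    continuous across the zeros of \<open>?f\<close>.\<close>
  define g where "g t = t * (B - t\<^sup>2) * ?f t / ?d t" for t
  have cf: "continuous_on J ?f"
    using DERIV_lin_expr by (meson DERIV_isCont continuous_at_imp_continuous_on)
  have cQ: "continuous_on J Q" "continuous_on J Q1"
    using DERIV_Q DERIV_Q1 by (meson DERIV_isCont continuous_at_imp_continuous_on)+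
  have cd: "continuous_on J ?d"
    unfolding nondeg_expr_def by (intro continuous_intros cQ)
  have cg: "continuous_on J g"
    unfolding g_def by (intro continuous_intros cf cd) (use nondeg_expr_nz in auto)
  have g: "g t = - 2 * B" if t: "t \<in> J" "?f t \<noteq> 0" for t
  proof -
    have U: "open {s \<in> J. ?f s \<noteq> 0}"
    proof -
      have "open (J \<inter> ?f -` (- {0}))" by (rule continuous_open_preimage[OF cf open_J]) auto
      moreover have "J \<inter> ?f -` (- {0}) = {s \<in> J. ?f s \<noteq> 0}" by auto
      ultimately show ?thesis by simp
    qed
    have zU: "sing_expr B s (Q s) (Q1 s) = 0" if "s \<in> {s \<in> J. ?f s \<noteq> 0}" for s
      using z[of s] that by auto
    have "t \<in> {s \<in> J. ?f s \<noteq> 0}" using t by auto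
    then have "t * (B - t\<^sup>2) * ?f t = - 2 * ?d t * B"
      by (intro lin_expr_at_sing_expr_zero zU sing_expr_derivs(1)[OF U _ zU]) auto
    then show ?thesis using nondeg_expr_nz[OF t(1)] by (simp add: g_def)
  qed
  have "g ` J \<subseteq> {0, - 2 * B}" using g by (force simp: g_def)
  then have "finite (g ` J)" using finite_subset by blast
  then have "g constant_on J"
    using continuous_finite_range_constant[OF connected_J cg] by simp
  then obtain c where c: "\<And>t. t \<in> J \<Longrightarrow> g t = c" unfolding constant_on_def by blast
  show ?thesis
  proof (cases "\<exists>t\<in>J. ?f t \<noteq> 0")
    case True
    then obtain t0 where t0: "t0 \<in> J" "g t0 = - 2 * B" using g by auto
    \<comment> \<open>The nonzero constant value of \<open>g\<close> rules out t = 0 as well, since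
      t is a factor of \<open>g\<close>.\<close>
    have "t \<noteq> 0 \<and> sing_expr B t (Q t) (Q1 t) = 0" if "t \<in> J" for t
    proof -
      have "g t = - 2 * B" using c that t0 by metis
      moreover have "B > 0" using J_lt[OF that] by (smt (verit) zero_le_power2)
      ultimately have "g t \<noteq> 0" by simp
      then have "?f t \<noteq> 0" "t \<noteq> 0" by (auto simp: g_def)
      then show ?thesis using z[OF that] by auto
    qed
    then show ?thesis by blast
  qed blast
qed

text \<open>First integrals: solve Q = c1 sqrt(B - t^2) + c2 t and its derivative for c1 and c2. The
  derivatives of the resulting expressions are multiples of \<open>lin_expr\<close>.\<close>

lemma lin_expr_zero_const:
  assumes f: "\<And>t. t \<in> J \<Longrightarrow> lin_expr B t (Q t) (Q1 t) (Q2 t) = 0" and st: "s \<in> J" "t \<in> J"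
  shows "(Q s - s * Q1 s) * sqrt (B - s\<^sup>2) / B = (Q t - t * Q1 t) * sqrt (B - t\<^sup>2) / B"
    and "(s * Q s + (B - s\<^sup>2) * Q1 s) / B = (t * Q t + (B - t\<^sup>2) * Q1 t) / B"
proof -
  define e where "e t = (Q t - t * Q1 t) * sqrt (B - t\<^sup>2) / B" for t
  define k where "k t = (t * Q t + (B - t\<^sup>2) * Q1 t) / B" for t
  have Bp: "B > 0" using J_lt[OF st(1)] by (smt (verit) zero_le_power2)
  have "convex J" using connected_J by (simp add: is_interval_connected_1[symmetric] is_interval_convex_1)
  have "(k has_real_derivative 0) (at t)" if "t \<in> J" for t
  proof -
    have "(k has_real_derivative lin_expr B t (Q t) (Q1 t) (Q2 t) / B) (at t)"
      unfolding k_def[abs_def] lin_expr_def using Bp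
      by (auto intro!: derivative_eq_intros DERIV_Q DERIV_Q1 that simp: field_simps power2_eq_square)
    then show ?thesis by (simp add: f that)
  qed
  then have k: "k s = k t"
    using has_field_derivative_zero_constant[OF \<open>convex J\<close>, of k] st
    by (metis has_field_derivative_at_within)
  have "(e has_real_derivative 0) (at t)" if "t \<in> J" for t
  proof -
    let ?r = "sqrt (B - t\<^sup>2)"
    have r: "?r > 0" "?r * ?r = B - t\<^sup>2" using J_lt[OF that] by auto
    have dr: "((\<lambda>t. sqrt (B - t\<^sup>2)) has_real_derivative - t / ?r) (at t)"
      using J_lt[OF that] by (auto intro!: derivative_eq_intros simp: field_simps)
    have dR: "((\<lambda>t. Q t - t * Q1 t) has_real_derivative Q1 t - (Q1 t + t * Q2 t)) (at t)"
      by (auto intro!: derivative_eq_intros DERIV_Q DERIV_Q1 that)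
    have "(e has_real_derivative
       ((Q1 t - (Q1 t + t * Q2 t)) * ?r + (Q t - t * Q1 t) * (- t / ?r)) / B) (at t)"
      unfolding e_def[abs_def]
      by (rule DERIV_cong[OF DERIV_cdivide[OF DERIV_mult[OF dR dr]]]) (simp add: mult.commute)
    also have "((Q1 t - (Q1 t + t * Q2 t)) * ?r + (Q t - t * Q1 t) * (- t / ?r)) / B
       = - t * lin_expr B t (Q t) (Q1 t) (Q2 t) / (?r * B)"
    proof -
      have "((q1 - (q1 + t * q2)) * r + (q - t * q1) * (- t / r)) / B = - t * (r * r * q2 + q - t * q1) / (r * B)"
        if "r > 0" for q q1 q2 r :: real
        using that Bp by (simp add: field_simps)
      from this[OF r(1)] show ?thesis unfolding lin_expr_def r(2) .
    qed
    finally show ?thesis by (simp add: f that)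
  qed
  then have e: "e s = e t"
    using has_field_derivative_zero_constant[OF \<open>convex J\<close>, of e] st
    by (metis has_field_derivative_at_within)
  show "(Q s - s * Q1 s) * sqrt (B - s\<^sup>2) / B = (Q t - t * Q1 t) * sqrt (B - t\<^sup>2) / B"
    using e by (simp add: e_def)
  show "(s * Q s + (B - s\<^sup>2) * Q1 s) / B = (t * Q t + (B - t\<^sup>2) * Q1 t) / B"
    using k by (simp add: k_def)
qed

lemma lin_expr_zero_solution:
  assumes f: "\<And>t. t \<in> J \<Longrightarrow> lin_expr B t (Q t) (Q1 t) (Q2 t) = 0" and st: "s \<in> J" "t \<in> J"
  shows "Q t = (Q s - s * Q1 s) * sqrt (B - s\<^sup>2) / B * sqrt (B - t\<^sup>2) + (s * Q s + (B - s\<^sup>2) * Q1 s) / B * t"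
proof -
  have Bp: "B > 0" using J_lt[OF st(1)] by (smt (verit) zero_le_power2)
  have "sqrt (B - t\<^sup>2) * sqrt (B - t\<^sup>2) = B - t\<^sup>2" using J_lt[OF st(2)] by simp
  then have A: "(Q t - t * Q1 t) * sqrt (B - t\<^sup>2) / B * sqrt (B - t\<^sup>2) = (Q t - t * Q1 t) * (B - t\<^sup>2) / B"
    by (simp only: times_divide_eq_left mult.assoc)
  have "(Q t - t * Q1 t) * sqrt (B - t\<^sup>2) / B * sqrt (B - t\<^sup>2) + (t * Q t + (B - t\<^sup>2) * Q1 t) / B * t = Q t"
    unfolding A using Bp by (simp add: field_simps power2_eq_square)
  then show ?thesis
    by (simp only: lin_expr_zero_const(1)[OF f st] lin_expr_zero_const(2)[OF f st])
qed

end

section \<open>The coefficients of the T-tensor as functions of Q\<close>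

context ab_fibre
begin

definition "D0 t = \<phi> t - t * d 1 t"
text \<open>Q is invariant under scaling of \<phi> and lowers the order by one: \<phi>'/\<phi> = Q /
  (1 + t Q). \<open>Q1\<close>, \<open>Q2\<close>, \<open>Q3\<close> are closed forms of its
  derivatives where \<open>D0\<close> is nonzero.\<close>

definition "Q t = d 1 t / D0 t"
definition "Q1 t = \<phi> t * d 2 t / (D0 t)\<^sup>2"
definition "Q2 t = (d 1 t * d 2 t + \<phi> t * d 3 t) / (D0 t)\<^sup>2 + 2 * t * \<phi> t * (d 2 t)\<^sup>2 / (D0 t) ^ 3"
definition "Q3 t = ((d 2 t)\<^sup>2 + 2 * d 1 t * d 3 t + \<phi> t * d 4 t) / (D0 t)\<^sup>2
  + (4 * t * d 1 t * (d 2 t)\<^sup>2 + 2 * \<phi> t * (d 2 t)\<^sup>2 + 6 * t * \<phi> t * d 2 t * d 3 t) / (D0 t) ^ 3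
  + 6 * t\<^sup>2 * \<phi> t * (d 2 t) ^ 3 / (D0 t) ^ 4"

lemma D0_eq: "\<phi> t - t * d 1 t = D0 t" "\<phi> t - t * deriv \<phi> t = D0 t"
  by (simp_all add: D0_def)

lemma DERIV_d': "t \<in> I \<Longrightarrow> (deriv \<phi> has_real_derivative d 2 t) (at t)"
  using DERIV_d(2)[of t] by simp

lemma DERIV_Qs:
  assumes "t \<in> I" "D0 t \<noteq> 0"
  shows "(Q has_real_derivative Q1 t) (at t)" "(Q1 has_real_derivative Q2 t) (at t)"
    "(Q2 has_real_derivative Q3 t) (at t)"
proof -
  have D: "(D0 has_real_derivative - t * d 2 t) (at t)"
    unfolding D0_def[abs_def] by (auto intro!: derivative_eq_intros DERIV_d DERIV_d' assms(1))
  show "(Q has_real_derivative Q1 t) (at t)"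
    unfolding Q_def[abs_def] Q1_def using assms(2)
    by (auto intro!: derivative_eq_intros DERIV_d DERIV_d' D assms(1) simp: field_simps power2_eq_square)
       (simp add: D0_def algebra_simps)
  show "(Q1 has_real_derivative Q2 t) (at t)"
    unfolding Q1_def[abs_def] Q2_def using assms(2)
    by (auto intro!: derivative_eq_intros DERIV_d DERIV_d' D assms(1) simp: field_simps power2_eq_square power3_eq_cube power4_eq_xxxx)
  show "(Q2 has_real_derivative Q3 t) (at t)"
    unfolding Q2_def[abs_def] Q3_def using assms(2)
    by (auto intro!: derivative_eq_intros DERIV_d DERIV_d' D assms(1) simp: field_simps power2_eq_square power3_eq_cube power4_eq_xxxx)
qed

text \<open>w = \<phi> / D0, while R and K are rho1 and kap divided by D0^2.\<close>

lemma coeffs_Q: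
  fixes t
  defines "w \<equiv> 1 + t * Q t" and "R \<equiv> Q t - t * Q1 t"
  defines "K \<equiv> Q2 t + 2 * Q1 t * R / w"
  assumes "t \<in> I" "D0 t \<noteq> 0"
  shows "w \<noteq> 0" "d 1 t = \<phi> t * Q t / w" "rho t = (\<phi> t)\<^sup>2 / w" "rho1 t = (\<phi> t)\<^sup>2 * R / w\<^sup>2"
    "del t = (\<phi> t)\<^sup>2 * Q1 t / w\<^sup>2" "kap t = (\<phi> t)\<^sup>2 * K / w\<^sup>2"
    "N t = (\<phi> t)\<^sup>2 * nondeg_expr B t (Q t) (Q1 t) / w\<^sup>2"
proof -
  have p: "\<phi> t \<noteq> 0" using \<phi>_pos[OF assms(4)] by simp
  have w: "w = \<phi> t / D0 t" using assms(5) by (simp add: w_def Q_def field_simps) (simp add: D0_def)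
  then show wn: "w \<noteq> 0" using p assms(5) by simp
  show "d 1 t = \<phi> t * Q t / w" using p assms(5) by (simp add: w Q_def)
  show rho: "rho t = (\<phi> t)\<^sup>2 / w" using p assms(5) by (simp add: w rho_def D0_eq power2_eq_square)
  have R: "R = rho1 t / (D0 t)\<^sup>2"
    using assms(5) by (simp add: R_def Q_def Q1_def rho1_def D0_eq field_simps power2_eq_square)
  show "rho1 t = (\<phi> t)\<^sup>2 * R / w\<^sup>2" using p assms(5) by (simp add: w R power2_eq_square)
  show del: "del t = (\<phi> t)\<^sup>2 * Q1 t / w\<^sup>2" using p assms(5) by (simp add: w Q1_def del_def power2_eq_square)
  have K: "K = kap t / (D0 t)\<^sup>2"
    using p assms(5) unfolding K_def R w Q2_def Q1_def kap_def rho1_def D0_eq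
    by (simp add: field_simps power2_eq_square power3_eq_cube)
  show "kap t = (\<phi> t)\<^sup>2 * K / w\<^sup>2" using p assms(5) by (simp add: w K power2_eq_square)
  show "N t = (\<phi> t)\<^sup>2 * nondeg_expr B t (Q t) (Q1 t) / w\<^sup>2"
    using wn unfolding N_def rho del nondeg_expr_def w_def[symmetric] mu_def
    by (simp add: field_simps power2_eq_square)
qed

text \<open>Found by differentiating the formula for \<open>kap\<close> in \<open>coeffs_Q\<close>
  on the open set where \<open>D0\<close> is nonzero, which avoids expanding the fourth derivative
  of \<phi>.\<close>

lemma kap1_Q:
  fixes t
  defines "w \<equiv> 1 + t * Q t" and "R \<equiv> Q t - t * Q1 t"
  defines "K \<equiv> Q2 t + 2 * Q1 t * R / w"
  assumes t: "t \<in> I" "D0 t \<noteq> 0"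
  shows "kap1 t = (\<phi> t)\<^sup>2 * (2 * Q t * K / w + (Q3 t + 2 * Q2 t * R / w - 2 * t * Q1 t * Q2 t / w
        - 2 * Q1 t * R * (Q t + t * Q1 t) / w\<^sup>2) - 2 * (Q t + t * Q1 t) * K / w) / w\<^sup>2"
proof -
  have "continuous_on I D0"
    unfolding D0_def[abs_def] using DERIV_d by (intro continuous_intros continuous_at_imp_continuous_on)
      (auto intro: DERIV_isCont)
  then have "open (I \<inter> D0 -` (- {0}))"
    by (intro continuous_open_preimage open_I) auto
  moreover have "I \<inter> D0 -` (- {0}) = {s \<in> I. D0 s \<noteq> 0}" by auto
  ultimately have S: "open {s \<in> I. D0 s \<noteq> 0}" by simp
  have wn: "w \<noteq> 0" unfolding w_def by (rule coeffs_Q(1)[OF t])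
  have d1: "d 1 t = \<phi> t * Q t / w" unfolding w_def by (rule coeffs_Q(2)[OF t])
  have dw: "((\<lambda>s. 1 + s * Q s) has_real_derivative Q t + t * Q1 t) (at t)"
    by (auto intro!: derivative_eq_intros DERIV_Qs t)
  have dR: "((\<lambda>s. Q s - s * Q1 s) has_real_derivative - t * Q2 t) (at t)"
    by (auto intro!: derivative_eq_intros DERIV_Qs t)
  let ?K1 = "Q3 t + 2 * Q2 t * R / w - 2 * t * Q1 t * Q2 t / w - 2 * Q1 t * R * (Q t + t * Q1 t) / w\<^sup>2"
  let ?K = "\<lambda>s. Q2 s + 2 * Q1 s * (Q s - s * Q1 s) / (1 + s * Q s)"
  have dK: "(?K has_real_derivative ?K1) (at t)"
  proof -
    have "(?K has_real_derivative
      Q3 t + ((2 * Q2 t * R + 2 * Q1 t * (- t * Q2 t)) * w - 2 * Q1 t * R * (Q t + t * Q1 t)) / (w * w)) (at t)"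
      unfolding w_def R_def
      by (rule DERIV_cong[OF DERIV_add[OF DERIV_Qs(3)[OF t]
            DERIV_divide[OF DERIV_mult[OF DERIV_cmult[OF DERIV_Qs(2)[OF t]] dR] dw]]])
        (use wn in \<open>auto simp: w_def algebra_simps\<close>)
    moreover have "Q3 t + ((2 * Q2 t * R + 2 * Q1 t * (- t * Q2 t)) * w - 2 * Q1 t * R * (Q t + t * Q1 t)) / (w * w) = ?K1"
      using wn by (simp add: field_simps power2_eq_square)
    ultimately show ?thesis by metis
  qed
  let ?k = "\<lambda>s. (\<phi> s)\<^sup>2 * ?K s / (1 + s * Q s)\<^sup>2"
  let ?k' = "(\<phi> t)\<^sup>2 * (2 * Q t * K / w + ?K1 - 2 * (Q t + t * Q1 t) * K / w) / w\<^sup>2"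
  have "(?k has_real_derivative ?k') (at t)"
  proof -
    have "(?k has_real_derivative ((2 * \<phi> t * d 1 t * K + (\<phi> t)\<^sup>2 * ?K1) * w\<^sup>2
        - (\<phi> t)\<^sup>2 * K * (2 * w * (Q t + t * Q1 t))) / (w\<^sup>2 * w\<^sup>2)) (at t)"
      unfolding w_def K_def R_def
      by (rule DERIV_cong[OF DERIV_divide[OF DERIV_mult[OF DERIV_power[OF DERIV_d(1)[OF t(1)], of 2]
              dK[unfolded w_def R_def]] DERIV_power[OF dw, of 2]]])
        (use wn in \<open>auto simp: w_def mult_ac\<close>)
    moreover have "((2 * p * (p * q / w) * K + p\<^sup>2 * k1) * w\<^sup>2 - p\<^sup>2 * K * (2 * w * w1)) / (w\<^sup>2 * w\<^sup>2)
       = p\<^sup>2 * (2 * q * K / w + k1 - 2 * w1 * K / w) / w\<^sup>2" for p q k1 w1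
      using wn by (simp add: field_simps power2_eq_square)
    ultimately show ?thesis unfolding d1 by simp
  qed
  then have "(kap has_real_derivative ?k') (at t)"
    by (rule has_field_derivative_transform_within_open[OF _ S]) (use t coeffs_Q(6) in auto)
  then show ?thesis using DERIV_unique DERIV_coeffs(4)[OF t(1)] by blast
qed

lemma Phi_Psi_Omega_Q:
  fixes t
  defines "w \<equiv> 1 + t * Q t" and "R \<equiv> Q t - t * Q1 t"
  defines "K \<equiv> Q2 t + 2 * Q1 t * R / w"
  defines "K' \<equiv> Q3 t + 2 * Q2 t * R / w - 2 * t * Q1 t * Q2 t / w - 2 * Q1 t * R * (Q t + t * Q1 t) / w\<^sup>2"
  defines "D \<equiv> nondeg_expr B t (Q t) (Q1 t)"
  assumes t: "t \<in> I" "D0 t \<noteq> 0" and D: "D \<noteq> 0"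
  shows "Phi t = (\<phi> t) ^ 3 / w\<^sup>2 * (- t * R - R\<^sup>2 * mu t / (2 * D))"
    and "Psi t = (\<phi> t) ^ 3 / w\<^sup>2 * (- t * K + 2 * R * Q t / w - R\<^sup>2 / D - R * K * mu t / (2 * D) - R\<^sup>2 / w)"
    and "Omega t = (\<phi> t) ^ 3 / w\<^sup>2 * (K' + 6 * Q t * K / w - 2 * (Q t + t * Q1 t) * K / w
      + 6 * Q1 t * R\<^sup>2 / (w * D) - 6 * R * K / D - 3 / 2 * K\<^sup>2 * mu t / D)"
proof -
  have p: "\<phi> t \<noteq> 0" using \<phi>_pos[OF t(1)] by simp
  note c = coeffs_Q[OF t, folded w_def, folded R_def, folded K_def, folded D_def]
  have k1: "kap1 t = (\<phi> t)\<^sup>2 * (2 * Q t * K / w + K' - 2 * (Q t + t * Q1 t) * K / w) / w\<^sup>2"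
    using kap1_Q[OF t] unfolding w_def R_def K_def K'_def .
  have w: "w \<noteq> 0" by (rule c(1))
  show "Phi t = (\<phi> t) ^ 3 / w\<^sup>2 * (- t * R - R\<^sup>2 * mu t / (2 * D))"
    unfolding Phi_def c using p w D by (simp add: field_simps power2_eq_square power3_eq_cube)
  show "Psi t = (\<phi> t) ^ 3 / w\<^sup>2 * (- t * K + 2 * R * Q t / w - R\<^sup>2 / D - R * K * mu t / (2 * D) - R\<^sup>2 / w)"
    unfolding Psi_def c using p w D by (simp add: field_simps power2_eq_square power3_eq_cube)
  show "Omega t = (\<phi> t) ^ 3 / w\<^sup>2 * (K' + 6 * Q t * K / w - 2 * (Q t + t * Q1 t) * K / w
      + 6 * Q1 t * R\<^sup>2 / (w * D) - 6 * R * K / D - 3 / 2 * K\<^sup>2 * mu t / D)"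
  proof -
    have "p * (p\<^sup>2 * X / w\<^sup>2) + 4 * (p\<^sup>2 * K / w\<^sup>2) * (p * q / w)
       - 3 * p / 2 * (4 * (p\<^sup>2 * R / w\<^sup>2) * (p\<^sup>2 * K / w\<^sup>2) / (p\<^sup>2 * D / w\<^sup>2)
         + (p\<^sup>2 * K / w\<^sup>2)\<^sup>2 * u / (p\<^sup>2 * D / w\<^sup>2)
         - 4 * (p\<^sup>2 * q1 / w\<^sup>2) * (p\<^sup>2 * R / w\<^sup>2)\<^sup>2 / (p\<^sup>2 / w * (p\<^sup>2 * D / w\<^sup>2)))
      = p ^ 3 / w\<^sup>2 * (X + 4 * q * K / w + 6 * q1 * R\<^sup>2 / (w * D) - 6 * R * K / D - 3 / 2 * K\<^sup>2 * u / D)"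
      if "p \<noteq> 0" for p X q q1 u
      using that w D by (simp add: field_simps power2_eq_square power3_eq_cube)
    note ring = this[OF p]
    show ?thesis
      unfolding Omega_def c k1 ring
      by (intro arg_cong[where f = "\<lambda>x. (\<phi> t) ^ 3 / w\<^sup>2 * x"]) (simp add: algebra_simps)
  qed
qed

lemma E1_factor:
  assumes t: "t \<in> I" "D0 t \<noteq> 0" and D: "nondeg_expr B t (Q t) (Q1 t) \<noteq> 0"
  shows "E1 t = - ((\<phi> t) ^ 3 / (2 * (1 + t * Q t)\<^sup>2 * nondeg_expr B t (Q t) (Q1 t)))
    * (sing_expr B t (Q t) (Q1 t) * lin_expr B t (Q t) (Q1 t) (Q2 t))"
proof -
  have "c * (- t * (q - t * q1) - (q - t * q1)\<^sup>2 * u / (2 * D)) + 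
     c * (- t * (q2 + 2 * q1 * (q - t * q1) / w) + 2 * (q - t * q1) * q / w - (q - t * q1)\<^sup>2 / D
        - (q - t * q1) * (q2 + 2 * q1 * (q - t * q1) / w) * u / (2 * D) - (q - t * q1)\<^sup>2 / w) * u
    = - (c / (2 * D)) * ((2 * t * w + u * (q + t * q1)) * (u * q2 + q - t * q1))"
    if w: "w \<noteq> 0" and D: "D = w + u * q1" "D \<noteq> 0" for q q1 q2 u w D c
  proof -
    define R where "R = q - t * q1"
    \<comment> \<open>In terms of R = Q - t Q' and D the two factors are 2tD + uR and u Q'' + R. The
      first is already a factor of Phi, which is proportional to R (2tD + uR) / D.\<close>
    have eq: "2 * t * w + u * (q + t * q1) = 2 * t * D + u * R" "u * q2 + q - t * q1 = u * q2 + R"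
      by (simp_all add: D R_def algebra_simps)
    have q: "q = R + t * q1" and w': "w = D - u * q1" by (simp_all add: R_def D)
    have "2 * D * w * (- t * R - R\<^sup>2 * u / (2 * D) + (- t * (q2 + 2 * q1 * R / w) + 2 * R * q / w - R\<^sup>2 / D
        - R * (q2 + 2 * q1 * R / w) * u / (2 * D) - R\<^sup>2 / w) * u)
       = - 2 * t * R * D * w - 3 * u * R\<^sup>2 * w + u * (- 2 * t * (q2 * w + 2 * q1 * R) * D + 4 * R * q * D
         - R * (q2 * w + 2 * q1 * R) * u - 2 * R\<^sup>2 * D)"
      using w D(2) by (simp add: field_simps power2_eq_square)
    also have "\<dots> = - w * ((2 * t * D + u * R) * (u * q2 + R))"
      unfolding q w' by (simp add: algebra_simps power2_eq_square)
    finally have fin: "2 * D * w * (- t * R - R\<^sup>2 * u / (2 * D) + (- t * (q2 + 2 * q1 * R / w) + 2 * R * q / w - R\<^sup>2 / D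
        - R * (q2 + 2 * q1 * R / w) * u / (2 * D) - R\<^sup>2 / w) * u) = - w * ((2 * t * D + u * R) * (u * q2 + R))" .
    have cancel: "X = - Y / (2 * D)" if "2 * D * w * X = - w * Y" for X Y
    proof -
      have "w * (2 * D * X + Y) = 0" using that by (simp add: algebra_simps)
      then have "2 * D * X + Y = 0" using w by simp
      then show ?thesis using w D(2) by (simp add: field_simps add_eq_0_iff)
    qed
    have "- t * R - R\<^sup>2 * u / (2 * D) + (- t * (q2 + 2 * q1 * R / w) + 2 * R * q / w - R\<^sup>2 / D
        - R * (q2 + 2 * q1 * R / w) * u / (2 * D) - R\<^sup>2 / w) * u = - ((2 * t * D + u * R) * (u * q2 + R)) / (2 * D)"
      by (rule cancel[OF fin])
    then show ?thesis
      unfolding eq R_def[symmetric] by (simp add: mult.assoc distrib_left[symmetric])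
  qed
  from this[OF coeffs_Q(1)[OF t], of "nondeg_expr B t (Q t) (Q1 t)" "mu t" "Q1 t" "(\<phi> t) ^ 3 / (1 + t * Q t)\<^sup>2" "Q t" "Q2 t"] D
  show ?thesis
    unfolding E1_def Phi_Psi_Omega_Q[OF assms] by (simp add: sing_expr_def lin_expr_def nondeg_expr_def mu_def)
qed

text \<open>On solutions R = -u Q'' and Q''' = 3 t Q'' / u with u = B - t^2, so \<open>E2\<close>
  becomes a rational expression in t, w, D, u and Q''.\<close>

lemma E2_zero:
  assumes t: "t \<in> I" "D0 t \<noteq> 0" and D: "nondeg_expr B t (Q t) (Q1 t) \<noteq> 0" and u: "mu t \<noteq> 0"
    and f: "lin_expr B t (Q t) (Q1 t) (Q2 t) = 0" "(B - t\<^sup>2) * Q3 t - 3 * t * Q2 t = 0"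
  shows "E2 t = 0"
proof -
  define w where "w = 1 + t * Q t"
  define D where "D = nondeg_expr B t (Q t) (Q1 t)"
  define u where "u = mu t"
  define q2 where "q2 = Q2 t"
  have nz: "w \<noteq> 0" "D \<noteq> 0" "u \<noteq> 0" using coeffs_Q(1)[OF t] assms by (auto simp: w_def D_def u_def)
  have q1: "Q1 t = (D - w) / u"
    using nz(3) by (simp add: D_def w_def u_def nondeg_expr_def mu_def)
  have R: "Q t - t * Q1 t = - u * q2" using f(1) by (simp add: lin_expr_def u_def mu_def q2_def algebra_simps)
  then have q: "Q t = t * (D - w) / u - u * q2" unfolding q1 by simp
  have q3: "Q3 t = 3 * t * q2 / u" using f(2) nz(3) by (simp add: u_def mu_def q2_def field_simps)
  have K: "q2 + 2 * ((D - w) / u) * (- u * q2) / w = q2 * (3 * w - 2 * D) / w"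
    using nz by (simp add: field_simps)
  have w1: "t * (D - w) / u - u * q2 + t * ((D - w) / u) = 2 * t * (D - w) / u - u * q2"
    using nz by (simp add: field_simps)
  note P = Phi_Psi_Omega_Q[OF assms(1-3), folded D_def, folded w_def u_def]
  show ?thesis
    unfolding E2_def P u_def[symmetric] R q2_def[symmetric] unfolding q1 q3 unfolding q K w1
    using nz by (simp add: field_simps power2_eq_square power3_eq_cube)
qed

text \<open>The expression and its first two derivatives determine Q, Q', Q'' and Q''' from t, w, D
  and u; all three coefficients then cancel identically.\<close>

lemma sing_expr_zero:
  assumes t: "t \<in> I" "D0 t \<noteq> 0" "t \<noteq> 0" and D: "nondeg_expr B t (Q t) (Q1 t) \<noteq> 0" and u: "mu t \<noteq> 0"
    and z: "sing_expr B t (Q t) (Q1 t) = 0" "2 * (1 + t * Q t) + (B - t\<^sup>2) * (2 * Q1 t + t * Q2 t) = 0"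
      "2 * (Q t + t * Q1 t) - 2 * t * (2 * Q1 t + t * Q2 t) + (B - t\<^sup>2) * (3 * Q2 t + t * Q3 t) = 0"
  shows "Phi t = 0" "Psi t = 0" "Omega t = 0"
proof -
  define w where "w = 1 + t * Q t"
  define D where "D = nondeg_expr B t (Q t) (Q1 t)"
  define u where "u = mu t"
  have nz: "w \<noteq> 0" "D \<noteq> 0" "u \<noteq> 0" "t \<noteq> 0" using coeffs_Q(1)[OF t(1,2)] assms by (auto simp: w_def D_def u_def)
  have q1: "Q1 t = (D - w) / u"
    using nz(3) by (simp add: D_def w_def u_def nondeg_expr_def mu_def)
  have w1: "Q t + t * Q1 t = - 2 * t * w / u"
    using z(1) nz by (simp add: sing_expr_def w_def u_def mu_def field_simps)
  then have "Q t = - 2 * t * w / u - t * ((D - w) / u)" unfolding q1 by linarith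
  then have q: "Q t = - (D + w) * t / u" using nz by (simp add: field_simps)
  have R: "Q t - t * Q1 t = - 2 * t * D / u" unfolding q q1 using nz by (simp add: field_simps)
  have "u * t * Q2 t = - 2 * w - 2 * u * Q1 t"
    using z(2) unfolding w_def u_def mu_def by (simp add: algebra_simps)
  then have q2: "Q2 t = - 2 * D / (u * t)" unfolding q1 using nz by (simp add: field_simps)
  have "u * t * Q3 t = - 2 * (Q t + t * Q1 t) + 2 * t * (2 * Q1 t + t * Q2 t) - 3 * u * Q2 t"
    using z(3) unfolding w_def u_def mu_def by (simp add: algebra_simps)
  then have q3: "Q3 t = 6 * D / (u * t\<^sup>2)"
    unfolding w1 unfolding q1 q2 using nz by (simp add: field_simps power2_eq_square)
  have K: "- 2 * D / (u * t) + 2 * ((D - w) / u) * (- 2 * t * D / u) / w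
     = - 2 * D * (u * w + 2 * t\<^sup>2 * (D - w)) / (u\<^sup>2 * t * w)"
    using nz by (simp add: field_simps power2_eq_square)
  note P = Phi_Psi_Omega_Q[OF t(1,2) assms(4), folded D_def, folded w_def u_def]
  show "Phi t = 0"
    unfolding P w1 R using nz by (simp add: field_simps power2_eq_square)
  show "Psi t = 0"
    unfolding P w1 R unfolding q1 q2 q3 unfolding q K using nz by (simp add: field_simps power2_eq_square)
  show "Omega t = 0"
    unfolding P w1 R unfolding q1 q2 q3 unfolding q K using nz by (simp add: field_simps power2_eq_square)
qed

end

section \<open>The integral formula\<close>

lemma interval_integrable_cong:
  assumes "\<And>x. x \<in> einterval (min a b) (max a b) \<Longrightarrow> f x = g x"
    and "interval_lebesgue_integrable lborel a b f"
  shows "interval_lebesgue_integrable lborel a b g"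
  using assms unfolding interval_lebesgue_integrable_def
  by (auto simp: min_def max_def split: if_splits cong: set_integrable_cong)

definition sT_num :: "real \<Rightarrow> real \<Rightarrow> real \<Rightarrow> real \<Rightarrow> real" where
  "sT_num B c1 c2 t = c1 * sqrt (B - t\<^sup>2) + c2 * t"

lemma sT_integrand_eq: "sT_integrand B c1 c2 t = sT_num B c1 c2 t / (1 + t * sT_num B c1 c2 t)"
  by (simp add: sT_integrand_def sT_num_def add.commute)

lemma continuous_sT_num: "continuous_on UNIV (sT_num B c1 c2)"
  unfolding sT_num_def[abs_def] by (intro continuous_intros)

lemma isCont_sT_num: "isCont (sT_num B c1 c2) t"
  using continuous_sT_num by (simp add: continuous_on_eq_continuous_at)

lemma isCont_sT_integrand:
  "1 + t * sT_num B c1 c2 t \<noteq> 0 \<Longrightarrow> isCont (sT_integrand B c1 c2) t"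
  unfolding sT_integrand_eq[abs_def] by (intro continuous_intros isCont_sT_num) auto

text \<open>Isolating the square root and squaring yields an even polynomial of degree at most 4
  whose constant term 1 keeps it nonzero.\<close>

lemma finite_sT_zeros: "finite {t. t\<^sup>2 < B \<and> 1 + t * sT_num B c1 c2 t = 0}"
proof -
  define P where "P = [:1, 0, 2 * c2 - c1\<^sup>2 * B, 0, c2\<^sup>2 + c1\<^sup>2:]"
  have "poly P t = 0" if "t\<^sup>2 < B" "1 + t * sT_num B c1 c2 t = 0" for t
  proof -
    have s: "(sqrt (B - t\<^sup>2))\<^sup>2 = B - t\<^sup>2" using that by simp
    have "1 + c2 * t\<^sup>2 = - t * c1 * sqrt (B - t\<^sup>2)"
      using that(2) by (simp add: sT_num_def algebra_simps power2_eq_square)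
    then have "(1 + c2 * t\<^sup>2)\<^sup>2 = t\<^sup>2 * c1\<^sup>2 * (sqrt (B - t\<^sup>2))\<^sup>2"
      by (simp add: power_mult_distrib)
    then have "(1 + c2 * t\<^sup>2)\<^sup>2 - t\<^sup>2 * c1\<^sup>2 * (B - t\<^sup>2) = 0"
      unfolding s by simp
    moreover have "poly P t = (1 + c2 * t\<^sup>2)\<^sup>2 - t\<^sup>2 * c1\<^sup>2 * (B - t\<^sup>2)"
      by (simp add: P_def algebra_simps power2_eq_square)
    ultimately show ?thesis by simp
  qed
  then have "{t. t\<^sup>2 < B \<and> 1 + t * sT_num B c1 c2 t = 0} \<subseteq> {t. poly P t = 0}" by auto
  moreover have "P \<noteq> 0" by (simp add: P_def)
  ultimately show ?thesis using poly_roots_finite finite_subset by blast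
qed

text \<open>On one side of 0 one of the two intervals contains the other, so integrability over
  their hull is one of the hypotheses.\<close>

lemma interval_integral_split:
  fixes f :: "real \<Rightarrow> real" and s t :: real
  assumes "interval_lebesgue_integrable lborel 0 (ereal s) f" "interval_lebesgue_integrable lborel 0 (ereal t) f"
    and "s * t \<ge> 0"
  shows "(LBINT x=0..ereal t. f x) = (LBINT x=0..ereal s. f x) + (LBINT x=ereal s..ereal t. f x)"
proof -
  have "interval_lebesgue_integrable lborel (min 0 (min (ereal s) (ereal t))) (max 0 (max (ereal s) (ereal t))) f"
  proof (cases "s \<ge> 0 \<and> t \<ge> 0")
    case True
    then show ?thesis using assms(1,2) by (auto simp: min_def max_def)
  next
    case False
    then have "s \<le> 0 \<and> t \<le> 0" using assms(3) by (auto simp: zero_le_mult_iff)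
    then have "min 0 (min (ereal s) (ereal t)) = ereal (min s t)" "max 0 (max (ereal s) (ereal t)) = 0"
      by (auto simp: min_def max_def zero_ereal_def)
    moreover have "interval_lebesgue_integrable lborel (ereal s) 0 f" "interval_lebesgue_integrable lborel (ereal t) 0 f"
      using assms(1,2) interval_integrable_endpoints_reverse by blast+
    ultimately show ?thesis by (simp add: min_def)
  qed
  from interval_integral_sum[OF this] show ?thesis by simp
qed

text \<open>Away from 0 and the finitely many zeros of the denominator, the fundamental theorem
  gives p' (1 + t q) = p q. Both sides are continuous and a nonempty open set is infinite, so this
  holds on all of \<open>J\<close>; then 1 + t q = 0 would force q = 0, which is absurd.\<close>

lemma explicit_imp_ratio:
  fixes p p' :: "real \<Rightarrow> real"
  assumes J: "open J" "\<And>t. t \<in> J \<Longrightarrow> t\<^sup>2 < B"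
    and p: "\<And>t. t \<in> J \<Longrightarrow> p t > 0" "\<And>t. t \<in> J \<Longrightarrow> (p has_real_derivative p' t) (at t)" "continuous_on J p'"
    and int: "\<And>t. t \<in> J \<Longrightarrow> interval_lebesgue_integrable lborel 0 (ereal t) (sT_integrand B c1 c2)"
    and eq: "\<And>t. t \<in> J \<Longrightarrow> p t = c3 * exp (LBINT x=0..ereal t. sT_integrand B c1 c2 x)"
    and t: "t \<in> J"
  shows "p' t / (p t - t * p' t) = sT_num B c1 c2 t"
proof -
  let ?q = "sT_num B c1 c2" and ?f = "sT_integrand B c1 c2"
  define X where "X = {t. t = 0 \<or> t\<^sup>2 < B \<and> 1 + t * ?q t = 0}"
  have finX: "finite X"
    using finite_sT_zeros[of B c1 c2] by (simp add: X_def Collect_disj_eq)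
  define g where "g t = p' t * (1 + t * ?q t) - p t * ?q t" for t
  have g0: "g t = 0" if t: "t \<in> J" "t \<notin> X" for t
  proof -
    have "open (J - X)" using J(1) finX by (intro open_Diff finite_imp_closed)
    then obtain e where e: "e > 0" "cball t e \<subseteq> J - X"
      using t open_contains_cball by blast
    \<comment> \<open>Half of |t| bounds the radius, which keeps [l, u] on one side of 0 as the
      splitting of the integral requires.\<close>
    define l u where "l = t - min e (\<bar>t\<bar> / 2)" and "u = t + min e (\<bar>t\<bar> / 2)"
    have tn: "t \<noteq> 0" using t by (simp add: X_def)
    have lu: "l < t" "t < u" using e tn by (auto simp: l_def u_def)
    have sub: "{l..u} \<subseteq> J - X" using e by (auto simp: l_def u_def dist_real_def subset_iff)
    have sgn: "l * x \<ge> 0" if "x \<in> {l..u}" for x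
      using that tn by (cases "t > 0") (auto simp: l_def u_def zero_le_mult_iff min_def split: if_splits)
    have cf: "continuous_on {l..u} ?f"
    proof (intro continuous_at_imp_continuous_on ballI isCont_sT_integrand)
      fix x assume "x \<in> {l..u}"
      then have "x \<in> J" "x \<notin> X" using sub by auto
      then show "1 + x * ?q x \<noteq> 0" using J(2) by (auto simp: X_def)
    qed
    define G where "G x = (LBINT y=ereal l..ereal x. ?f y)" for x
    have "(G has_vector_derivative ?f t) (at t within {l..u})"
      unfolding G_def using interval_integral_FTC2[of l l u ?f t] lu cf by auto
    moreover have "at t within {l..u} = at t"
      using lu by (intro at_within_interior) (auto simp: interior_atLeastAtMost_real)
    ultimately have G: "(G has_real_derivative ?f t) (at t)"
      by (simp add: has_real_derivative_iff_has_vector_derivative)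
    define c where "c = c3 * exp (LBINT x=0..ereal l. ?f x)"
    have pG: "c * exp (G x) = p x" if "x \<in> {l<..<u}" for x
    proof -
      have x: "x \<in> {l..u}" "l \<in> {l..u}" using that lu by auto
      then have xJ: "x \<in> J" "l \<in> J" using sub by blast+
      show ?thesis
        unfolding eq[OF xJ(1)] interval_integral_split[OF int[OF xJ(2)] int[OF xJ(1)] sgn[OF x(1)]]
        by (simp add: c_def G_def exp_add)
    qed
    have "((\<lambda>x. c * exp (G x)) has_real_derivative c * (exp (G t) * ?f t)) (at t)"
      by (intro DERIV_cmult DERIV_fun_exp G)
    then have "(p has_real_derivative c * (exp (G t) * ?f t)) (at t)"
      by (rule has_field_derivative_transform_within_open[where S = "{l<..<u}"]) (use lu pG in auto)
    then have "p' t = p t * ?f t"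
      using DERIV_unique[OF p(2)[OF t(1)]] pG[of t] lu by (simp add: mult.assoc)
    moreover have "1 + t * ?q t \<noteq> 0" using t J(2) by (auto simp: X_def)
    ultimately show ?thesis by (simp add: g_def sT_integrand_eq)
  qed
  have "continuous_on J g"
    unfolding g_def[abs_def]
    by (intro continuous_intros p(3) continuous_on_subset[OF continuous_sT_num]
        continuous_at_imp_continuous_on ballI DERIV_isCont[OF p(2)]) auto
  then have "open (J \<inter> g -` (- {0}))"
    by (intro continuous_open_preimage J(1)) auto
  moreover have "J \<inter> g -` (- {0}) \<subseteq> X" using g0 by auto
  ultimately have "J \<inter> g -` (- {0}) = {}"
    using finX finite_subset finite_imp_not_open by blast
  then have "g t = 0" using t by auto
  then have 1: "p' t * (1 + t * ?q t) = p t * ?q t" by (simp add: g_def)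
  have e: "1 + t * ?q t \<noteq> 0"
  proof
    assume z: "1 + t * ?q t = 0"
    then have "?q t = 0" using 1 p(1)[OF t] by simp
    then show False using z by simp
  qed
  have "p' t = p t * ?q t / (1 + t * ?q t)" using 1 e by (simp add: field_simps)
  moreover have "p t - t * (p t * ?q t / (1 + t * ?q t)) = p t / (1 + t * ?q t)"
    using e by (simp add: field_simps)
  ultimately show ?thesis using e p(1)[OF t] by simp
qed

text \<open>Both ends of the segment are delicate: 0 may lie outside \<open>I\<close>, and s^2 = B
  is allowed although the ratio is known only for t^2 < B. The second claim therefore compares two
  points of \<open>I\<close> instead of evaluating at 0.\<close>

lemma ratio_imp_explicit:
  fixes p p' :: "real \<Rightarrow> real"
  assumes I: "convex I" "B > 0"
    and p: "\<And>t. t \<in> I \<Longrightarrow> p t > 0" "\<And>t. t \<in> I \<Longrightarrow> (p has_real_derivative p' t) (at t)" "continuous_on I p'"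
    and pole: "\<And>t. t \<in> I \<Longrightarrow> t\<^sup>2 < B \<Longrightarrow> p t - t * p' t \<noteq> 0"
    and ratio: "\<And>t. t \<in> I \<Longrightarrow> t\<^sup>2 < B \<Longrightarrow> p' t / (p t - t * p' t) = sT_num B c1 c2 t"
    and s: "s \<in> I" "s\<^sup>2 \<le> B" "closed_segment 0 s \<subseteq> insert 0 I"
    and t: "t \<in> I" "t \<in> closed_segment 0 s"
  shows "interval_lebesgue_integrable lborel 0 (ereal t) (sT_integrand B c1 c2)"
    and "ln (p t) - (LBINT x=0..ereal t. sT_integrand B c1 c2 x)
      = ln (p s) - (LBINT x=0..ereal s. sT_integrand B c1 c2 x)"
proof -
  let ?q = "sT_num B c1 c2" and ?f = "sT_integrand B c1 c2"
  define S where "S = {min 0 s..max 0 s}"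
  have S: "S = closed_segment 0 s" by (auto simp: S_def closed_segment_eq_real_ivl)
  have lt: "x\<^sup>2 < B" if "x \<in> S" "x \<noteq> s" for x
  proof -
    have "\<bar>x\<bar> < \<bar>s\<bar>" using that by (auto simp: S_def min_def max_def split: if_splits)
    then have "x\<^sup>2 < s\<^sup>2" using abs_le_square_iff[of s x] by linarith
    then show ?thesis using s by simp
  qed
  have e: "1 + x * ?q x \<noteq> 0 \<and> ?f x = p' x / p x" if "x \<in> I" "x\<^sup>2 < B" for x
  proof -
    have d: "p x - x * p' x \<noteq> 0" "p x > 0" using pole p that by auto
    have "1 + x * ?q x = p x / (p x - x * p' x)" unfolding ratio[OF that, symmetric] using d by (simp add: field_simps)
    then show ?thesis using d by (simp add: sT_integrand_eq ratio[OF that, symmetric])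
  qed
  \<comment> \<open>At \<open>s\<close> the integrand may fail to be continuous when s^2 = B, so its
    value there is replaced by the limit p'/p. A single endpoint does not change the integral. At 0
    the denominator is 1.\<close>
  define F where "F x = (if x = s then p' s / p s else ?f x)" for x
  have FI: "F x = p' x / p x" if "x \<in> S" "x \<in> I" for x
    using e[OF that(2) lt[OF that(1)]] by (auto simp: F_def)
  have cF: "continuous_on S F"
  proof (unfold continuous_on_eq_continuous_within, intro ballI)
    fix x assume x: "x \<in> S"
    show "continuous (at x within S) F"
    proof (cases "x = s")
      case False
      have "1 + x * ?q x \<noteq> 0"
        using e[OF _ lt[OF x False]] x s(3) by (cases "x = 0") (auto simp: S)
      then have "isCont ?f x" by (rule isCont_sT_integrand)
      then have "continuous (at x within S) ?f" by (rule continuous_at_imp_continuous_at_within)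
      moreover have "\<forall>\<^sub>F y in at x within S. ?f y = F y"
        using False unfolding eventually_at by (intro exI[of _ "dist x s"]) (auto simp: F_def dist_commute)
      moreover have "F x = ?f x" using False by (simp add: F_def)
      ultimately show ?thesis
        unfolding continuous_within by (metis tendsto_cong)
    next
      case True
      show ?thesis
      proof (cases "s = 0")
        case True
        then have "S = {0}" by (simp add: S_def)
        then show ?thesis
          using \<open>x \<in> S\<close> continuous_on_sing[of 0 F] by (simp add: continuous_on_eq_continuous_within)
      next
        case s0: False
        have "continuous (at s within I) (\<lambda>x. p' x / p x)"
          using p s(1) DERIV_isCont[OF p(2)[OF s(1)]] continuous_at_imp_continuous_at_within
          by (intro continuous_intros) (auto simp: continuous_on_eq_continuous_within less_imp_neq[THEN not_sym])
        then have "((\<lambda>x. p' x / p x) \<longlongrightarrow> p' s / p s) (at s within (S \<inter> I))"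
          unfolding continuous_within using tendsto_within_subset by blast
        moreover have "\<forall>\<^sub>F y in at s within (S \<inter> I). p' y / p y = F y"
          unfolding eventually_at_filter by (rule always_eventually) (auto simp: FI)
        ultimately have "(F \<longlongrightarrow> p' s / p s) (at s within (S \<inter> I))"
          by (rule Lim_transform_eventually)
        \<comment> \<open>The segment without 0 lies in \<open>I\<close>, and s is not 0.\<close>
        moreover have "at s within S = at s within (S \<inter> I)"
          by (rule at_within_nhd[where S = "- {0}"]) (use s0 s(3) in \<open>auto simp: S\<close>)
        ultimately show ?thesis
          unfolding continuous_within \<open>x = s\<close> by (simp add: F_def[of s])
      qed
    qed
  qed
  then obtain g where g: "\<And>x. x \<in> S \<Longrightarrow> (g has_vector_derivative F x) (at x within S)"
    using antiderivative_continuous[of "min 0 s" "max 0 s" F] by (auto simp: S_def)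
  have *: "interval_lebesgue_integrable lborel 0 (ereal t) ?f \<and> (LBINT x=0..ereal t. ?f x) = g t - g 0" if "t \<in> S" for t
  proof -
    have sub: "{min 0 t..max 0 t} \<subseteq> S" using that by (auto simp: S_def)
    have 1: "(LBINT x=ereal 0..ereal t. F x) = g t - g 0"
      by (rule interval_integral_FTC_finite)
        (use sub in \<open>auto intro!: continuous_on_subset[OF cF] has_vector_derivative_within_subset[OF g]\<close>)
    have "continuous_on {min 0 t..max 0 t} F" using continuous_on_subset[OF cF sub] .
    then have "interval_lebesgue_integrable lborel (ereal (min 0 t)) (ereal (max 0 t)) F"
      by (intro interval_integrable_continuous_on) auto
    then have 2: "interval_lebesgue_integrable lborel 0 (ereal t) F"
      using interval_integrable_endpoints_reverse[of 0 "ereal t" F]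
      by (cases "t \<ge> 0") (auto simp: min_def max_def zero_ereal_def)
    have 3: "F x = ?f x" if "x \<in> einterval (min 0 (ereal t)) (max 0 (ereal t))" for x
      using that \<open>t \<in> S\<close> by (auto simp: F_def einterval_def S_def min_def max_def zero_ereal_def split: if_splits)
    show ?thesis
      using 1 interval_integrable_cong[OF 3 2] interval_integral_cong[OF 3] by (simp add: zero_ereal_def)
  qed
  show "interval_lebesgue_integrable lborel 0 (ereal t) ?f" using * t by (simp add: S)
  have "convex (S \<inter> I)" unfolding S by (intro convex_Int convex_closed_segment I)
  moreover have "((\<lambda>x. ln (p x) - g x) has_real_derivative 0) (at x within (S \<inter> I))" if "x \<in> S \<inter> I" for x
  proof -
    have "((\<lambda>x. ln (p x)) has_real_derivative p' x / p x) (at x within (S \<inter> I))"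
      using that p by (auto intro!: derivative_eq_intros has_field_derivative_at_within[OF p(2)] simp: divide_inverse mult.commute)
    moreover have "(g has_real_derivative p' x / p x) (at x within (S \<inter> I))"
      using has_vector_derivative_within_subset[OF g, of x "S \<inter> I"] FI[of x] that
      by (simp add: has_real_derivative_iff_has_vector_derivative)
    ultimately show ?thesis using DERIV_diff by fastforce
  qed
  ultimately have "ln (p t) - g t = ln (p s) - g s"
    using has_field_derivative_zero_constant[of "S \<inter> I" "\<lambda>x. ln (p x) - g x"] s t by (auto simp: S)
  then show "ln (p t) - (LBINT x=0..ereal t. ?f x) = ln (p s) - (LBINT x=0..ereal s. ?f x)"
    using *[of t] *[of s] t by (simp add: S)
qed

lemma square_less_iff: "(x::real)\<^sup>2 < B \<longleftrightarrow> \<bar>x\<bar> < sqrt B"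
  by (metis real_sqrt_abs real_sqrt_less_iff)

lemma sT_num_lin_expr_zero:
  assumes J: "open J" "\<And>t. t \<in> J \<Longrightarrow> t\<^sup>2 < B"
    and Q: "\<And>t. t \<in> J \<Longrightarrow> Q t = sT_num B c1 c2 t"
    and D: "\<And>t. t \<in> J \<Longrightarrow> (Q has_real_derivative Q1 t) (at t)"
      "\<And>t. t \<in> J \<Longrightarrow> (Q1 has_real_derivative Q2 t) (at t)"
    and t: "t \<in> J"
  shows "lin_expr B t (Q t) (Q1 t) (Q2 t) = 0"
proof -
  have r: "sqrt (B - t\<^sup>2) > 0" "sqrt (B - t\<^sup>2) * sqrt (B - t\<^sup>2) = B - t\<^sup>2" if "t \<in> J" for t
    using J(2)[OF that] by auto
  have dr: "((\<lambda>t. sqrt (B - t\<^sup>2)) has_real_derivative - t / sqrt (B - t\<^sup>2)) (at t)" if "t \<in> J" for t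
    using J(2)[OF that] by (auto intro!: derivative_eq_intros simp: field_simps)
  have Q1: "Q1 t = c1 * (- t / sqrt (B - t\<^sup>2)) + c2" if "t \<in> J" for t
  proof -
    have "(sT_num B c1 c2 has_real_derivative c1 * (- t / sqrt (B - t\<^sup>2)) + c2) (at t)"
      unfolding sT_num_def[abs_def]
      by (rule DERIV_cong[OF DERIV_add[OF DERIV_cmult[OF dr[OF that]] DERIV_cmult[OF DERIV_ident]]]) simp
    then have "(Q has_real_derivative c1 * (- t / sqrt (B - t\<^sup>2)) + c2) (at t)"
      by (rule has_field_derivative_transform_within_open[OF _ J(1) that]) (simp add: Q)
    then show ?thesis using DERIV_unique D(1)[OF that] by blast
  qed
  have "((\<lambda>t. c1 * (- t / sqrt (B - t\<^sup>2)) + c2) has_real_derivative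
     c1 * ((- 1 * sqrt (B - t\<^sup>2) - (- t) * (- t / sqrt (B - t\<^sup>2))) / (sqrt (B - t\<^sup>2) * sqrt (B - t\<^sup>2)))) (at t)"
    by (rule DERIV_cong[OF DERIV_add[OF DERIV_cmult[OF DERIV_divide[OF DERIV_minus[OF DERIV_ident] dr[OF t]]] DERIV_const]])
       (use r[OF t] in auto)
  then have "(Q1 has_real_derivative
     c1 * ((- 1 * sqrt (B - t\<^sup>2) - (- t) * (- t / sqrt (B - t\<^sup>2))) / (sqrt (B - t\<^sup>2) * sqrt (B - t\<^sup>2)))) (at t)"
    by (rule has_field_derivative_transform_within_open[OF _ J(1) t]) (simp add: Q1)
  then have Q2: "Q2 t = c1 * ((- 1 * sqrt (B - t\<^sup>2) - (- t) * (- t / sqrt (B - t\<^sup>2))) / (sqrt (B - t\<^sup>2) * sqrt (B - t\<^sup>2)))"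
    using DERIV_unique D(2)[OF t] by blast
  have ring: "r * r * (c1 * ((- 1 * r - (- t) * (- t / r)) / (r * r))) + (c1 * r + c2 * t) - t * (c1 * (- t / r) + c2) = 0"
    if "r > 0" for r
    using that by (simp add: field_simps)
  show ?thesis
    using ring[OF r(1)[OF t]] unfolding r(2)[OF t] lin_expr_def Q[OF t] Q1[OF t] Q2 sT_num_def by simp
qed

section \<open>The two alternatives in one tangent space\<close>

context ab_fibre
begin

text \<open>The values of s off the boundary directions; there m is nonzero and \<open>E1\<close>
  can be isolated.\<close>

definition "J = {t \<in> I. t\<^sup>2 < B}"

context
  assumes b: "b \<noteq> 0" and convex_I: "convex I"
begin

lemma J_props: "open J" "convex J" "t \<in> J \<Longrightarrow> t\<^sup>2 < B" "t \<in> J \<Longrightarrow> t \<in> I"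
proof -
  have J: "J = I \<inter> {- sqrt B<..<sqrt B}"
    by (auto simp: J_def square_less_iff)
  show "open J" unfolding J by (intro open_Int open_I) auto
  show "convex J" unfolding J by (intro convex_Int convex_I) auto
qed (auto simp: J_def)

lemma J_nz: 
  assumes "t \<in> J"
  shows "D0 t \<noteq> 0" "nondeg_expr B t (Q t) (Q1 t) \<noteq> 0" "mu t \<noteq> 0"
proof -
  have t: "t \<in> I" "t\<^sup>2 < B" using assms by (auto simp: J_def)
  note nz = rho_N_nz[OF b t]
  show "D0 t \<noteq> 0" using nz(1) by (auto simp: rho_def D0_def)
  then show "nondeg_expr B t (Q t) (Q1 t) \<noteq> 0" using nz(2) coeffs_Q(7)[OF t(1)] by auto
  show "mu t \<noteq> 0" using t by (simp add: mu_def)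
qed

lemma ode_J: "ode J Q Q1 Q2 Q3 B"
  by unfold_locales
    (use J_props J_nz DERIV_Qs in \<open>auto intro: convex_connected\<close>)

lemma ode_product_zero:
  assumes "\<sigma> \<noteq> 0" "\<And>y i j k. y \<in> domF \<Longrightarrow> sT \<sigma> i j k y = 0" "t \<in> J"
  shows "sing_expr B t (Q t) (Q1 t) * lin_expr B t (Q t) (Q1 t) (Q2 t) = 0"
proof -
  have t: "t \<in> I" "t\<^sup>2 < B" using assms(3) by (auto simp: J_def)
  have "E1 t = 0" by (rule E1_zero[OF b assms(1) t assms(2)])
  then show ?thesis
    using E1_factor[OF t(1) J_nz(1,2)] assms(3) coeffs_Q(1)[OF t(1) J_nz(1)] J_nz(2) \<phi>_pos[OF t(1)] by auto
qed

lemma T_zero_if_sing_expr: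
  assumes z: "\<And>t. t \<in> J \<Longrightarrow> t \<noteq> 0 \<and> sing_expr B t (Q t) (Q1 t) = 0" and y: "y \<in> domF"
  shows "T_tensor F r i j k y = 0"
proof -
  interpret ode J Q Q1 Q2 Q3 B by (rule ode_J)
  define t where "t = sl y"
  have t: "t \<in> I" using domFD(2)[OF y] by (simp add: t_def)
  have "D0 t \<noteq> 0" using rho_nz[OF y] by (auto simp: t_def rho_def D0_def)
  show ?thesis
  proof (cases "mu t = 0")
    case False
    then have tJ: "t \<in> J" using mu_nonneg[OF domFD(1)[OF y]] t by (simp add: J_def mu_def t_def)
    show ?thesis
      using sing_expr_zero[OF t J_nz(1) _ J_nz(2,3), OF tJ _ tJ tJ] z tJ
        sing_expr_derivs[OF J_props(1) subset_refl _ tJ] T_zero[OF y] unfolding t_def by blast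
  next
    \<comment> \<open>Such a direction cannot occur: at t^2 = B the singular expression equals 2t (1
      + tQ), which is nonzero, while by continuity it is a limit of its zeros in
      \<open>J\<close>.\<close>
    case True
    then have B: "B = t\<^sup>2" by (simp add: mu_def)
    have t0: "t \<noteq> 0" using B_pos[OF b] B by auto
    have w: "1 + t * Q t \<noteq> 0" by (rule coeffs_Q(1)) fact+
    define g where "g s = sing_expr B s (Q s) (Q1 s)" for s
    have "isCont g t"
      unfolding g_def[abs_def] sing_expr_def
      by (intro continuous_intros DERIV_isCont[OF DERIV_Qs(1)] DERIV_isCont[OF DERIV_Qs(2)]) fact+
    moreover have "g t \<noteq> 0" using w t0 B by (simp add: g_def sing_expr_def)
    ultimately have "\<forall>\<^sub>F s in at t. g s \<noteq> 0" unfolding isCont_def by (rule tendsto_imp_eventually_ne)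
    moreover have "\<forall>\<^sub>F s in at t. s \<in> I" using open_I t by (rule eventually_at_in_open')
    ultimately have "\<forall>\<^sub>F s in at t. g s \<noteq> 0 \<and> s \<in> I" by (rule eventually_conj)
    then obtain e where e: "e > 0" "\<And>s. s \<noteq> t \<Longrightarrow> dist s t < e \<Longrightarrow> g s \<noteq> 0 \<and> s \<in> I"
      unfolding eventually_at by auto
    \<comment> \<open>Shrinking t by the factor 1 - k gives s^2 < t^2 = B, hence a point of
      \<open>J\<close>, and k |t| < e keeps it where \<open>g\<close> is nonzero.\<close>
    define k where "k = min (1/2) (e / (2 * \<bar>t\<bar>))"
    have k: "0 < k" "k \<le> 1 / 2" "k * \<bar>t\<bar> < e"
    proof -
      have "k * \<bar>t\<bar> \<le> e / (2 * \<bar>t\<bar>) * \<bar>t\<bar>" by (intro mult_right_mono) (auto simp: k_def)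
      also have "\<dots> < e" using e(1) t0 by simp
      finally show "k * \<bar>t\<bar> < e" .
    qed (use e(1) t0 in \<open>auto simp: k_def\<close>)
    define s where "s = t - k * t"
    have s: "s \<noteq> t" "dist s t < e" using k t0 by (auto simp: s_def dist_real_def abs_mult)
    have "s\<^sup>2 = (1 - k)\<^sup>2 * t\<^sup>2" by (simp add: s_def algebra_simps power2_eq_square)
    also have "\<dots> < 1 * t\<^sup>2"
      using k t0 by (intro mult_strict_right_mono) (auto simp: abs_square_less_1)
    finally have "s \<in> J" using e(2)[OF s] B by (simp add: J_def)
    then have "g s = 0" using z by (simp add: g_def)
    then show ?thesis using e(2)[OF s] by simp
  qed
qed

lemma sT_zero_if_lin_expr:
  assumes f: "\<And>t. t \<in> J \<Longrightarrow> lin_expr B t (Q t) (Q1 t) (Q2 t) = 0" and y: "y \<in> domF"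
  shows "sT (w *\<^sub>R b) i j k y = 0"
proof (rule sT_parallel_zero[OF y])
  interpret ode J Q Q1 Q2 Q3 B by (rule ode_J)
  define t where "t = sl y"
  assume "mu (sl y) \<noteq> 0"
  then have tJ: "t \<in> J"
    using mu_nonneg[OF domFD(1)[OF y]] domFD(2)[OF y] by (simp add: J_def mu_def t_def)
  note tI = J_props(4)[OF tJ]
  \<comment> \<open>\<open>E2\<close> needs a third-order relation, which is the derivative of the
    linear equation.\<close>
  have "(B - t\<^sup>2) * Q3 t - 3 * t * Q2 t = 0"
    using has_real_derivative_zero_on[OF J_props(1) tJ f DERIV_lin_expr[OF tJ]] by blast
  then show "E1 (sl y) = 0 \<and> E2 (sl y) = 0"
    using E1_factor[OF tI J_nz(1,2)[OF tJ]] E2_zero[OF tI J_nz[OF tJ] f[OF tJ]] f[OF tJ] by (simp add: t_def)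
qed

lemma Q_ratio: "Q t = deriv \<phi> t / (\<phi> t - t * deriv \<phi> t)"
  by (simp add: Q_def D0_def)

lemma continuous_deriv: "continuous_on I (deriv \<phi>)"
  using DERIV_d' by (meson DERIV_isCont continuous_at_imp_continuous_on)

lemma lin_expr_zero_if_explicit:
  assumes "\<And>s. s \<in> I \<Longrightarrow> \<bar>s\<bar> \<le> sqrt B \<Longrightarrow>
      interval_lebesgue_integrable lborel 0 (ereal s) (sT_integrand B c1 c2) \<and>
      \<phi> s = k3 * exp (LBINT t=0..ereal s. sT_integrand B c1 c2 t)"
    and t: "t \<in> J"
  shows "lin_expr B t (Q t) (Q1 t) (Q2 t) = 0"
proof (rule sT_num_lin_expr_zero[OF J_props(1,3) _ _ _ t])
  have J: "s \<in> I" "\<bar>s\<bar> \<le> sqrt B" if "s \<in> J" for s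
    using that by (auto simp: J_def real_le_rsqrt)
  show "Q s = sT_num B c1 c2 s" if "s \<in> J" for s
    unfolding Q_ratio
  proof (rule explicit_imp_ratio[where J = J and B = B and ?c3.0 = k3])
    show "continuous_on J (deriv \<phi>)"
      using continuous_on_subset[OF continuous_deriv] J_props(4) by blast
    show "\<phi> t > 0" "(\<phi> has_real_derivative deriv \<phi> t) (at t)" if "t \<in> J" for t
      using \<phi>_pos DERIV_d(1)[of t] J_props(4)[OF that] by auto
    show "interval_lebesgue_integrable lborel 0 (ereal t) (sT_integrand B c1 c2)"
      "\<phi> t = k3 * exp (LBINT x=0..ereal t. sT_integrand B c1 c2 x)" if "t \<in> J" for t
      using assms(1)[OF J[OF that]] by auto
  qed (use J_props that in auto)
qed (use DERIV_Qs J_nz J_props in auto)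

end

text \<open>F is a constant multiple of \<alpha>. In the formulas s = 0 and mu = 0, and each term of
  Phi has t or mu as a factor.\<close>

lemma T_zero_if_b_zero:
  assumes "b = 0" "y \<in> domF"
  shows "T_tensor F r i j k y = 0"
proof -
  have "sl y = 0" using assms by (simp add: ab_s_def \<beta>_form_def)
  moreover have "mu 0 = 0" unfolding mu_def b_sq_def using assms(1) by simp
  ultimately show ?thesis by (intro T_zero[OF assms(2)]) (auto simp: Phi_def)
qed

lemma sT_zero_if_T_zero:
  assumes "\<And>r i j k. T_tensor F r i j k y = 0"
  shows "sT \<sigma> i j k y = 0"
  using assms by (simp add: sT_def T_tensor_up_def)

end

section \<open>From one tangent space to the manifold\<close>

lemma continuous_on_det:
  fixes M :: "'a::topological_space \<Rightarrow> real^'n::finite^'n"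
  assumes "\<And>i j. continuous_on S (\<lambda>x. M x $ i $ j)"
  shows "continuous_on S (\<lambda>x. det (M x))"
  unfolding det_def by (intro continuous_intros assms)

text \<open>Cramer's rule replaces the chosen inverse by quotients of determinants, which are
  visibly continuous.\<close>

lemma continuous_on_b_sq:
  fixes a :: "'a::topological_space \<Rightarrow> real^'n::finite^'n" and b :: "'a \<Rightarrow> real^'n"
  assumes a: "continuous_on S a" and b: "continuous_on S b" and inv: "\<And>x. x \<in> S \<Longrightarrow> invertible (a x)"
  shows "continuous_on S (\<lambda>x. b_sq (a x) (b x))"
proof -
  have eq: "b_sq (a x) (b x) = (\<Sum>k\<in>UNIV. b x $ k *
      (det (\<chi> i j. if j = k then b x $ i else a x $ i $ j) / det (a x)))" if "x \<in> S" for x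
  proof -
    have d: "det (a x) \<noteq> 0" using inv[OF that] by (simp add: invertible_det_nz)
    have "matrix_inv (a x) *v b x = (\<chi> k. det (\<chi> i j. if j = k then b x $ i else a x $ i $ j) / det (a x))"
      using matrix_inv_solves[OF inv[OF that], of "b x"] by (simp add: cramer[OF d])
    moreover have "b_sq (a x) (b x) = (\<Sum>k\<in>UNIV. b x $ k * (matrix_inv (a x) *v b x) $ k)"
      by (simp add: b_sq_def matrix_vector_mult_def sum_distrib_left mult_ac)
    ultimately show ?thesis by simp
  qed
  have ca: "continuous_on S (\<lambda>x. a x $ i $ j)" for i j
    using a by (intro continuous_intros)
  have cb: "continuous_on S (\<lambda>x. b x $ i)" for i
    using b by (intro continuous_intros)
  have "continuous_on S (\<lambda>x. \<Sum>k\<in>UNIV. b x $ k *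
      (det (\<chi> i j. if j = k then b x $ i else a x $ i $ j) / det (a x)))"
  proof (intro continuous_on_sum continuous_on_mult continuous_on_divide cb continuous_on_det ca ballI)
    fix k i j :: 'n
    show "continuous_on S (\<lambda>x. (\<chi> i j. if j = k then b x $ i else a x $ i $ j) $ i $ j)"
      using ca cb by (cases "j = k") auto
  qed (use inv in \<open>auto simp: invertible_det_nz\<close>)
  then show ?thesis by (simp add: eq cong: continuous_on_cong)
qed

text \<open>A ball is convex, so a differential vanishing on it would make \<sigma> constant on the
  corresponding open subset of the manifold.\<close>

lemma admissible_differential_nonzero:
  fixes A :: "('m::topological_space, 'n::finite) chart set"
  assumes A: "smooth_atlas A" and \<sigma>: "admissible_function A \<sigma>" and c: "c \<in> A"
    and e: "e > 0" "ball x e \<subseteq> chart_image c"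
  shows "\<exists>x'\<in>ball x e. \<exists>h. dcomp c \<sigma> h x' \<noteq> 0"
proof (rule ccontr)
  assume no: "\<not> ?thesis"
  let ?f = "\<sigma> \<circ> chart_inv c"
  have z: "dcomp c \<sigma> h x' = 0" if "x' \<in> ball x e" for x' h
    using no that by blast
  have hom: "homeomorphism (fst c) (chart_image c) (snd c) (chart_inv c)" "open (fst c)" "open (chart_image c)"
    using A c by (auto simp: smooth_atlas_def)
  have "smooth_on (chart_image c) ?f"
    using \<sigma> c unfolding admissible_function_def smooth_function_def by blast
  then have "Ck_on (Suc 0) (chart_image c) ?f"
    unfolding smooth_on_def by blast
  then have diff: "?f differentiable_on chart_image c" by simp
  have d0: "(?f has_derivative (\<lambda>h. 0)) (at x' within ball x e)" if x': "x' \<in> ball x e" for x'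
  proof -
    have "?f differentiable (at x')"
      using diff hom(3) x' e by (auto simp: differentiable_on_eq_differentiable_at)
    then have d: "(?f has_derivative frechet_derivative ?f (at x')) (at x')"
      by (simp add: frechet_derivative_works)
    then have lin: "linear (frechet_derivative ?f (at x'))"
      by (rule has_derivative_linear)
    have "frechet_derivative ?f (at x') v = 0" for v
    proof -
      have "v = (\<Sum>i\<in>UNIV. v $ i *\<^sub>R axis i 1)"
        using basis_expansion[of v] by (simp add: scalar_mult_eq_scaleR)
      then have "frechet_derivative ?f (at x') v = frechet_derivative ?f (at x') (\<Sum>i\<in>UNIV. v $ i *\<^sub>R axis i 1)"
        by (rule arg_cong)
      also have "\<dots> = (\<Sum>i\<in>UNIV. v $ i *\<^sub>R frechet_derivative ?f (at x') (axis i 1))"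
        by (simp only: linear_sum[OF lin] linear_scale[OF lin])
      also have "\<dots> = 0"
        using z[OF x'] by (simp add: dcomp_def pd_def)
      finally show ?thesis .
    qed
    then have "frechet_derivative ?f (at x') = (\<lambda>h. 0)" by auto
    then show ?thesis using d by (metis has_derivative_at_withinI)
  qed
  then obtain k where k: "\<And>x'. x' \<in> ball x e \<Longrightarrow> ?f x' = k"
    using has_derivative_zero_constant[OF convex_ball, of x e ?f] by blast
  define U where "U = fst c \<inter> snd c -` ball x e"
  have "open U"
    unfolding U_def using hom by (intro continuous_open_preimage) (auto simp: homeomorphism_def)
  moreover have "U \<noteq> {}"
  proof -
    have x: "x \<in> ball x e" using e by simp
    then have "x \<in> snd c ` fst c" using e unfolding chart_image_def by blast
    then show ?thesis using x unfolding U_def by blast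
  qed
  moreover have "\<sigma> u = k" if "u \<in> U" for u
    using k[of "snd c u"] that hom(1) by (simp add: U_def homeomorphism_def)
  then have "\<sigma> constant_on U" by (auto simp: constant_on_def)
  ultimately show False using \<sigma> by (auto simp: admissible_function_def)
qed

section \<open>Comparison of the points of the manifold\<close>

locale ab_space =
  fixes A :: "('m::{t2_space, second_countable_topology}, 'n::finite) chart set"
    and a :: "('m, 'n) chart \<Rightarrow> real^'n \<Rightarrow> real^'n^'n"
    and b :: "('m, 'n) chart \<Rightarrow> real^'n \<Rightarrow> real^'n"
    and \<phi> :: "real \<Rightarrow> real" and I :: "real set" and b0 :: real
  assumes card: "CARD('n) \<ge> 3"
    and atlas: "smooth_atlas A"
    and metric: "ab_metric A a b \<phi> I b0"
begin

lemma I_cases: "b0 > 0" "I = {-b0<..<b0} \<or> I = {0<..<b0}"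
  using metric by (auto simp: ab_metric_def)

lemma convex_I: "convex I" and open_I: "open I"
  using I_cases(2) by auto

lemma small_in_I: "0 < t \<Longrightarrow> t < b0 \<Longrightarrow> t \<in> I"
  using I_cases by auto

definition "pts = {(c, x). c \<in> A \<and> x \<in> chart_image c}"

lemma ball_pts: "(\<forall>p\<in>pts. P p) \<longleftrightarrow> (\<forall>c\<in>A. \<forall>x\<in>chart_image c. P (c, x))"
  by (auto simp: pts_def)

abbreviation "BB p \<equiv> b_sq (a (fst p) (snd p)) (b (fst p) (snd p))"
abbreviation "bb p \<equiv> b (fst p) (snd p)"
abbreviation "FF p \<equiv> ab_F \<phi> (a (fst p) (snd p)) (b (fst p) (snd p))"
abbreviation "cone_at p \<equiv> ab_cone I (a (fst p) (snd p)) (b (fst p) (snd p))"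

lemma fibre:
  assumes "p \<in> pts"
  shows "ab_fibre (a (fst p) (snd p)) (bb p) \<phi> I"
proof
  have p: "fst p \<in> A" "snd p \<in> chart_image (fst p)" using assms by (auto simp: pts_def)
  have r: "riemannian_metric A a" using metric by (simp add: ab_metric_def)
  then have tr: "transpose (a (fst p) (snd p)) = a (fst p) (snd p)" using p by (simp add: riemannian_metric_def)
  show "a (fst p) (snd p) $ i $ j = a (fst p) (snd p) $ j $ i" for i j
    using arg_cong[OF tr, of "\<lambda>M. M $ j $ i"] by (simp add: transpose_def)
  show "v \<bullet> (a (fst p) (snd p) *v v) > 0" if "v \<noteq> 0" for v
    using r p that by (simp add: riemannian_metric_def)
qed (use metric card open_I assms in \<open>auto simp: ab_metric_def pts_def\<close>)

abbreviation "Q \<equiv> ab_fibre.Q \<phi>"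
abbreviation "Q1 \<equiv> ab_fibre.Q1 \<phi>"
abbreviation "Q2 \<equiv> ab_fibre.Q2 \<phi>"
abbreviation "Q3 \<equiv> ab_fibre.Q3 \<phi>"

definition "JJ p = {t \<in> I. t\<^sup>2 < BB p}"

lemma JJ_eq: "p \<in> pts \<Longrightarrow> ab_fibre.J (a (fst p) (snd p)) (bb p) I = JJ p"
  using ab_fibre.J_def[OF fibre] by (simp add: JJ_def)

lemma ode_JJ: "p \<in> pts \<Longrightarrow> bb p \<noteq> 0 \<Longrightarrow> ode (JJ p) Q Q1 Q2 Q3 (BB p)"
  using ab_fibre.ode_J[OF fibre _ convex_I] by (simp add: JJ_eq)

lemma BB_pos: "p \<in> pts \<Longrightarrow> bb p \<noteq> 0 \<Longrightarrow> BB p > 0"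
  using ab_fibre.B_pos[OF fibre] .

text \<open>Either form of \<open>I\<close> contains (0, b0), so small positive values of s are
  available wherever b is nonzero. There the equations of two points apply to the same Q.\<close>

lemma common_point:
  assumes "p \<in> pts" "bb p \<noteq> 0" "p' \<in> pts" "bb p' \<noteq> 0" "u > 0"
  obtains t where "0 < t" "t < u" "t \<in> JJ p" "t \<in> JJ p'"
proof -
  define u' where "u' = min (min u b0) (min (sqrt (BB p)) (sqrt (BB p')))"
  have "u' > 0"
    using assms I_cases BB_pos by (simp add: u'_def)
  then obtain t where t: "0 < t" "t < u'" using dense by blast
  then have "t < u" "t < b0" "t < sqrt (BB p)" "t < sqrt (BB p')" by (auto simp: u'_def)
  then show thesis using that t small_in_I by (auto simp: JJ_def square_less_iff)
qed

definition "sig \<sigma> p = (\<chi> h. dcomp (fst p) \<sigma> h (snd p))"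

lemma sT_sig:
  assumes "p \<in> pts"
  shows "ab_fibre.sT (a (fst p) (snd p)) (bb p) \<phi> (sig \<sigma> p) i j k y
    = (\<Sum>h\<in>UNIV. dcomp (fst p) \<sigma> h (snd p) * T_tensor_up (FF p) h i j k y)"
  by (simp add: ab_fibre.sT_def[OF fibre[OF assms]] sig_def)

lemma sigma_T_iff: "sigma_T_condition A a b \<phi> I \<longleftrightarrow> (\<exists>\<sigma>. admissible_function A \<sigma> \<and>
    (\<forall>p\<in>pts. \<forall>y\<in>cone_at p. \<forall>i j k. ab_fibre.sT (a (fst p) (snd p)) (bb p) \<phi> (sig \<sigma> p) i j k y = 0))"
  proof -
  have "(\<forall>p\<in>pts. \<forall>y\<in>cone_at p. \<forall>i j k. ab_fibre.sT (a (fst p) (snd p)) (bb p) \<phi> (sig \<sigma> p) i j k y = 0)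
    \<longleftrightarrow> (\<forall>p\<in>pts. \<forall>y\<in>cone_at p. \<forall>i j k.
      (\<Sum>h\<in>UNIV. dcomp (fst p) \<sigma> h (snd p) * T_tensor_up (FF p) h i j k y) = 0)" for \<sigma>
    by (intro ball_cong refl) (simp add: sT_sig)
  then show ?thesis
    unfolding sigma_T_condition_def ball_pts by simp
qed

lemma T_iff: "T_condition A a b \<phi> I \<longleftrightarrow>
    (\<forall>p\<in>pts. \<forall>y\<in>cone_at p. \<forall>r i j k. T_tensor (FF p) r i j k y = 0)"
  unfolding T_condition_def ball_pts by simp

lemma explicit_iff: "phi_explicit A a b \<phi> I \<longleftrightarrow> (\<exists>c1 c2 c3. \<forall>p\<in>pts. \<forall>s\<in>I. \<bar>s\<bar> \<le> sqrt (BB p) \<longrightarrow>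
        interval_lebesgue_integrable lborel 0 (ereal s) (sT_integrand (BB p) c1 c2) \<and>
        \<phi> s = c3 * exp (LBINT t=0..ereal s. sT_integrand (BB p) c1 c2 t))"
  unfolding phi_explicit_def ball_pts by simp

text \<open>Where \<open>d\<sigma> = 0\<close> the condition is void; there the equation is the limit of its instances at
  nearby points, since only the parameter \<open>b\<^sup>2\<close> varies.\<close>

lemma ode_product_zero:
  assumes \<sigma>: "admissible_function A \<sigma>"
    and z: "\<And>p y i j k. p \<in> pts \<Longrightarrow> y \<in> cone_at p \<Longrightarrow> ab_fibre.sT (a (fst p) (snd p)) (bb p) \<phi> (sig \<sigma> p) i j k y = 0"
    and p: "p \<in> pts" and t: "t \<in> JJ p"
  shows "sing_expr (BB p) t (Q t) (Q1 t) * lin_expr (BB p) t (Q t) (Q1 t) (Q2 t) = 0"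
proof (rule ccontr)
  assume nz: "sing_expr (BB p) t (Q t) (Q1 t) * lin_expr (BB p) t (Q t) (Q1 t) (Q2 t) \<noteq> 0"
  obtain c x where cx: "p = (c, x)" "c \<in> A" "x \<in> chart_image c" using p by (auto simp: pts_def)
  define BC where "BC x = b_sq (a c x) (b c x)" for x
  define g where "g B = (if t\<^sup>2 < B then sing_expr B t (Q t) (Q1 t) * lin_expr B t (Q t) (Q1 t) (Q2 t) else 0)" for B
  have open_c: "open (chart_image c)" using atlas cx by (auto simp: smooth_atlas_def)
  have "continuous_on (chart_image c) BC"
    unfolding BC_def
  proof (rule continuous_on_b_sq)
    have "Ck_on 0 (chart_image c) (a c)" "Ck_on 0 (chart_image c) (b c)"
      using metric cx(2) by (auto simp: ab_metric_def riemannian_metric_def one_form_def smooth_on_def simp del: Ck_on.simps)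
    then show "continuous_on (chart_image c) (a c)" "continuous_on (chart_image c) (b c)" by auto
    show "invertible (a c x)" if "x \<in> chart_image c" for x
      using ab_fibre.invertible_a[OF fibre[of "(c, x)"]] that cx by (simp add: pts_def)
  qed
  then have "isCont BC x" using open_c cx by (simp add: continuous_on_eq_continuous_at)
  moreover have "isCont (\<lambda>B. sing_expr B t (Q t) (Q1 t) * lin_expr B t (Q t) (Q1 t) (Q2 t)) (BC x)"
    unfolding sing_expr_def lin_expr_def by (intro continuous_intros)
  ultimately have "isCont (\<lambda>x. sing_expr (BC x) t (Q t) (Q1 t) * lin_expr (BC x) t (Q t) (Q1 t) (Q2 t)) x"
    by (rule isCont_o2)
  then have "\<forall>\<^sub>F x' in nhds x. sing_expr (BC x') t (Q t) (Q1 t) * lin_expr (BC x') t (Q t) (Q1 t) (Q2 t) \<noteq> 0"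
    using nz cx by (intro tendsto_imp_eventually_ne[where c = "sing_expr (BC x) t (Q t) (Q1 t) * lin_expr (BC x) t (Q t) (Q1 t) (Q2 t)"])
      (simp_all add: isCont_def tendsto_nhds_iff, simp_all add: BC_def)
  moreover have "(BC \<longlongrightarrow> BC x) (nhds x)" "t\<^sup>2 < BC x"
    using \<open>isCont BC x\<close> t cx by (simp_all add: isCont_def tendsto_nhds_iff JJ_def BC_def[of x])
  then have "\<forall>\<^sub>F x' in nhds x. t\<^sup>2 < BC x'"
    by (rule order_tendstoD(1))
  moreover have "\<forall>\<^sub>F x' in nhds x. x' \<in> chart_image c"
    using open_c cx by (intro eventually_nhds_in_open)
  ultimately have "\<forall>\<^sub>F x' in nhds x. sing_expr (BC x') t (Q t) (Q1 t) * lin_expr (BC x') t (Q t) (Q1 t) (Q2 t) \<noteq> 0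
      \<and> t\<^sup>2 < BC x' \<and> x' \<in> chart_image c"
    by eventually_elim auto
  then obtain e where e: "e > 0" "\<And>x'. dist x' x < e \<Longrightarrow>
      sing_expr (BC x') t (Q t) (Q1 t) * lin_expr (BC x') t (Q t) (Q1 t) (Q2 t) \<noteq> 0 \<and> t\<^sup>2 < BC x' \<and> x' \<in> chart_image c"
    unfolding eventually_nhds_metric by blast
  then have "ball x e \<subseteq> chart_image c" by (auto simp: dist_commute)
  then obtain x' h where x': "x' \<in> ball x e" "dcomp c \<sigma> h x' \<noteq> 0"
    using admissible_differential_nonzero[OF atlas \<sigma> cx(2) e(1)] by blast
  have p': "(c, x') \<in> pts" "t \<in> JJ (c, x')" "t\<^sup>2 < BC x'"
    using e(2)[of x'] x'(1) cx t by (auto simp: pts_def JJ_def BC_def dist_commute)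
  have "sig \<sigma> (c, x') \<noteq> 0" using x'(2) by (auto simp: sig_def vec_eq_iff)
  moreover have "bb (c, x') \<noteq> 0"
  proof
    assume "bb (c, x') = 0"
    then have "BC x' = 0" by (simp add: BC_def b_sq_def)
    then show False using p'(3) by (simp add: not_less)
  qed
  ultimately have "sing_expr (BC x') t (Q t) (Q1 t) * lin_expr (BC x') t (Q t) (Q1 t) (Q2 t) = 0"
    using ab_fibre.ode_product_zero[OF fibre[OF p'(1)] _ convex_I _ z[OF p'(1)]] p' JJ_eq[OF p'(1)]
    by (simp add: BC_def)
  then show False using e(2)[of x'] x'(1) by (simp add: dist_commute)
qed

text \<open>The ratio fixes \<phi> at each point up to a factor; the issue is one \<open>c3\<close>
  for all of them. \<open>K p s\<close> is the logarithm of the factor read off at \<open>p\<close>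
  and \<open>s\<close>, and must depend on neither.\<close>

lemma ratio_imp_phi_explicit:
  assumes Q: "\<And>p t. p \<in> pts \<Longrightarrow> bb p \<noteq> 0 \<Longrightarrow> t \<in> JJ p \<Longrightarrow> Q t = sT_num (BB p) c1 c2 t"
    and p0: "p0 \<in> pts" "bb p0 \<noteq> 0" 
  shows "phi_explicit A a b \<phi> I"
proof -
  let ?f = "\<lambda>p. sT_integrand (BB p) c1 c2"
  interpret f0: ab_fibre "a (fst p0) (snd p0)" "bb p0" \<phi> I by (rule fibre[OF p0(1)])
  define K where "K p s = ln (\<phi> s) - (LBINT x=0..ereal s. ?f p x)" for p s
  obtain s0 where s0: "0 < s0" "s0 \<in> JJ p0" using common_point[OF p0 p0, of 1] by auto
  have seg: "closed_segment 0 s \<subseteq> insert 0 I" if "s \<in> I" for s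
    using that I_cases by (auto simp: closed_segment_eq_real_ivl split: if_splits)
  have K: "interval_lebesgue_integrable lborel 0 (ereal t) (?f p) \<and> K p t = K p s"
    if p: "p \<in> pts" "bb p \<noteq> 0" and s: "s \<in> I" "s\<^sup>2 \<le> BB p" and t: "t \<in> I" "t \<in> closed_segment 0 s" for p s t
  proof -
    have J: "u \<in> JJ p" if "u \<in> I" "u\<^sup>2 < BB p" for u using that by (simp add: JJ_def)
    have nz: "\<phi> u - u * deriv \<phi> u \<noteq> 0" if "u \<in> I" "u\<^sup>2 < BB p" for u
      using ab_fibre.J_nz(1)[OF fibre[OF p(1)] p(2) convex_I] J[OF that] JJ_eq[OF p(1)] ab_fibre.D0_eq(2)[OF fibre[OF p(1)]]
      by simp
    have r: "deriv \<phi> u / (\<phi> u - u * deriv \<phi> u) = sT_num (BB p) c1 c2 u" if "u \<in> I" "u\<^sup>2 < BB p" for u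
      using Q[OF p J[OF that]] by (simp add: f0.Q_ratio[OF p0(2) convex_I])
    have d: "(\<phi> has_real_derivative deriv \<phi> u) (at u)" if "u \<in> I" for u
      using f0.DERIV_d(1)[OF that] by simp
    show ?thesis
      unfolding K_def
      using ratio_imp_explicit[OF convex_I BB_pos[OF p] f0.\<phi>_pos d f0.continuous_deriv[OF p0(2) convex_I] nz r s seg[OF s(1)] t]
      by blast
  qed
  have const: "K p s = K p0 s0" if p: "p \<in> pts" "bb p \<noteq> 0" and s: "s \<in> I" "s\<^sup>2 \<le> BB p" for p s
  proof (cases "0 \<in> I")
    case True
    have "K p 0 = K p0 0" by (simp add: K_def zero_ereal_def[symmetric])
    moreover have "K p 0 = K p s" using K[OF p s True] by simp
    moreover have "K p0 0 = K p0 s0" using K[OF p0 _ _ True, of s0] s0 by (simp add: JJ_def)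
    ultimately show ?thesis by simp
  next
    \<comment> \<open>With 0 outside the domain of \<phi>, the constants are compared at a small t
      common to both points: on (0, t) both integrands are the same function of Q.\<close>
    case False
    then have I: "I = {0<..<b0}" using I_cases by auto
    then have "s > 0" using s by simp
    then obtain t where t: "0 < t" "t < min s s0" "t \<in> JJ p" "t \<in> JJ p0"
      using common_point[OF p p0, of "min s s0"] s0 by auto
    have tI: "t \<in> I" using t by (simp add: JJ_def)
    have "K p t = K p0 t"
    proof -
      have "?f p x = ?f p0 x" if "x \<in> einterval (min 0 (ereal t)) (max 0 (ereal t))" for x
      proof -
        have x: "0 < x" "x < t" using that t by (auto simp: einterval_def min_def max_def zero_ereal_def split: if_splits)
        then have "x\<^sup>2 < t\<^sup>2" by (simp add: power_strict_mono)
        moreover have "x \<in> I" using x t(3) unfolding JJ_def by (simp add: I)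
        ultimately have "x \<in> JJ p" "x \<in> JJ p0" using t(3,4) by (auto simp: JJ_def)
        then have "sT_num (BB p) c1 c2 x = sT_num (BB p0) c1 c2 x" using Q p p0 by metis
        then show ?thesis by (simp add: sT_integrand_eq)
      qed
      then have "(LBINT x=0..ereal t. ?f p x) = (LBINT x=0..ereal t. ?f p0 x)"
        by (rule interval_integral_cong)
      then show ?thesis by (simp add: K_def)
    qed
    moreover have "K p t = K p s" using K[OF p s tI] t by (simp add: closed_segment_eq_real_ivl)
    moreover have "K p0 t = K p0 s0"
      using K[OF p0 _ _ tI, of s0] s0 t by (simp add: closed_segment_eq_real_ivl JJ_def)
    ultimately show ?thesis by simp
  qed
  show ?thesis
    unfolding explicit_iff
  proof (intro exI ballI impI)
    fix p s assume p: "p \<in> pts" and s: "s \<in> I" "\<bar>s\<bar> \<le> sqrt (BB p)"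
    have pos: "\<phi> s > 0" using f0.\<phi>_pos s by simp
    show "interval_lebesgue_integrable lborel 0 (ereal s) (?f p) \<and>
        \<phi> s = exp (K p0 s0) * exp (LBINT t=0..ereal s. ?f p t)"
    proof (cases "bb p = 0")
      \<comment> \<open>Only s = 0 is in range, and the formula reduces to \<phi>(0) = c3.\<close>
      case True
      then have "s = 0" using s by (simp add: b_sq_def)
      moreover have "K p0 0 = K p0 s0"
        using K[OF p0 _ _ s(1)[unfolded \<open>s = 0\<close>], of s0] s0 by (simp add: JJ_def)
      then have "exp (K p0 s0) = \<phi> 0"
        unfolding \<open>K p0 0 = K p0 s0\<close>[symmetric] using pos \<open>s = 0\<close>
        by (simp add: K_def zero_ereal_def[symmetric])
      ultimately show ?thesis
        by (simp add: zero_ereal_def[symmetric] interval_lebesgue_integrable_def einterval_same set_integrable_def)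
    next
      case False
      have s2: "s\<^sup>2 \<le> BB p" using s(2) BB_pos[OF p False]
        by (metis abs_le_square_iff abs_of_nonneg less_imp_le real_sqrt_ge_0_iff real_sqrt_pow2)
      have "ln (\<phi> s) = K p0 s0 + (LBINT t=0..ereal s. ?f p t)"
        using const[OF p False s(1) s2] by (simp add: K_def)
      then have "\<phi> s = exp (K p0 s0 + (LBINT t=0..ereal s. ?f p t))"
        using pos by (metis exp_ln)
      then show ?thesis using K[OF p False s(1) s2 s(1)] by (simp add: exp_add)
    qed
  qed
qed

lemma sigma_T_imp:
  assumes "sigma_T_condition A a b \<phi> I"
  shows "T_condition A a b \<phi> I \<or> phi_explicit A a b \<phi> I"
proof -
  obtain \<sigma> where \<sigma>: "admissible_function A \<sigma>"
    "\<And>p y i j k. p \<in> pts \<Longrightarrow> y \<in> cone_at p \<Longrightarrow> ab_fibre.sT (a (fst p) (snd p)) (bb p) \<phi> (sig \<sigma> p) i j k y = 0"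
    using assms unfolding sigma_T_iff by blast
  have prod: "sing_expr (BB p) t (Q t) (Q1 t) * lin_expr (BB p) t (Q t) (Q1 t) (Q2 t) = 0" if "p \<in> pts" "t \<in> JJ p" for p t
    by (rule ode_product_zero[OF \<sigma>(1) _ that]) (rule \<sigma>(2))
  let ?f = "\<lambda>p. \<forall>t\<in>JJ p. lin_expr (BB p) t (Q t) (Q1 t) (Q2 t) = 0"
  let ?z = "\<lambda>p. \<forall>t\<in>JJ p. t \<noteq> 0 \<and> sing_expr (BB p) t (Q t) (Q1 t) = 0"
  have dich: "?f p \<or> ?z p" if "p \<in> pts" "bb p \<noteq> 0" for p
    using ode.dichotomy[OF ode_JJ[OF that] prod[OF that(1)]] by blast
  show ?thesis
  proof (cases "\<exists>p0\<in>pts. bb p0 \<noteq> 0 \<and> ?f p0")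
    case False
    then have z: "?z p" if "p \<in> pts" "bb p \<noteq> 0" for p using dich that by blast
    have "T_tensor (FF p) r i j k y = 0" if p: "p \<in> pts" and y: "y \<in> cone_at p" for p y r i j k
    proof (cases "bb p = 0")
      case True
      then show ?thesis using ab_fibre.T_zero_if_b_zero[OF fibre[OF p] True y] by simp
    next
      case False
      show ?thesis
        using ab_fibre.T_zero_if_sing_expr[OF fibre[OF p] False convex_I _ y] z[OF p False] JJ_eq[OF p] by auto
    qed
    then show ?thesis unfolding T_iff by blast
  next
    case True
    then obtain p0 where p0: "p0 \<in> pts" "bb p0 \<noteq> 0" "?f p0" by blast
    \<comment> \<open>At a common small t the singular alternative at \<open>p\<close> would make
      the linear expression of \<open>p0\<close> nonzero, by the identity with two different values
      of b^2.\<close>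
    have f: "?f p" if p: "p \<in> pts" "bb p \<noteq> 0" for p
    proof (rule ccontr)
      assume "\<not> ?f p"
      then have z: "?z p" using dich p by blast
      obtain t where t: "0 < t" "t \<in> JJ p" "t \<in> JJ p0" using common_point[OF p p0(1,2), of 1] by auto
      interpret ode "JJ p" Q Q1 Q2 Q3 "BB p" by (rule ode_JJ[OF p])
      have "t * (BB p - t\<^sup>2) * lin_expr (BB p0) t (Q t) (Q1 t) (Q2 t) = - 2 * nondeg_expr (BB p) t (Q t) (Q1 t) * BB p0"
        using z t sing_expr_derivs(1)[OF open_J subset_refl _ t(2)] by (intro lin_expr_at_sing_expr_zero) auto
      then show False using p0(3) t nondeg_expr_nz[OF t(2)] BB_pos[OF p0(1,2)] by auto
    qed
    obtain s0 where s0: "s0 \<in> JJ p0" using common_point[OF p0(1,2) p0(1,2), of 1] by auto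
    \<comment> \<open>The first integrals at the reference point; the same constants have to serve
      every other point.\<close>
    define c1 where "c1 = (Q s0 - s0 * Q1 s0) * sqrt (BB p0 - s0\<^sup>2) / BB p0"
    define c2 where "c2 = (s0 * Q s0 + (BB p0 - s0\<^sup>2) * Q1 s0) / BB p0"
    have "Q t = sT_num (BB p) c1 c2 t" if p: "p \<in> pts" "bb p \<noteq> 0" and t: "t \<in> JJ p" for p t
    proof -
      interpret o0: ode "JJ p0" Q Q1 Q2 Q3 "BB p0" by (rule ode_JJ[OF p0(1,2)])
      interpret op: ode "JJ p" Q Q1 Q2 Q3 "BB p" by (rule ode_JJ[OF p])
      obtain s where s: "s \<in> JJ p" "s \<in> JJ p0" using common_point[OF p p0(1,2), of 1] by auto
      have f0s: "lin_expr (BB p0) s (Q s) (Q1 s) (Q2 s) = 0" and fps: "lin_expr (BB p) s (Q s) (Q1 s) (Q2 s) = 0"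
        using p0(3) f[OF p] s by auto
      have c1: "c1 = (Q s - s * Q1 s) * sqrt (BB p0 - s\<^sup>2) / BB p0"
        unfolding c1_def by (rule o0.lin_expr_zero_const(1)[OF _ s0 s(2)]) (use p0(3) in auto)
      have c2: "c2 = (s * Q s + (BB p0 - s\<^sup>2) * Q1 s) / BB p0"
        unfolding c2_def by (rule o0.lin_expr_zero_const(2)[OF _ s0 s(2)]) (use p0(3) in auto)
      have sol: "Q t = (Q s - s * Q1 s) * sqrt (BB p - s\<^sup>2) / BB p * sqrt (BB p - t\<^sup>2)
          + (s * Q s + (BB p - s\<^sup>2) * Q1 s) / BB p * t"
        by (rule op.lin_expr_zero_solution[OF _ s(1) t]) (use f[OF p] in auto)
      show ?thesis
      proof (cases "BB p = BB p0")
        case True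
        then show ?thesis using sol unfolding sT_num_def c1 c2 by simp
      next
        case False
        \<comment> \<open>Two values of b^2 in the linear equation force Q'' = 0 at s, hence Q = s
          Q'. The first integral c1 is then 0 and c2 is Q' for either value, so the constants agree
          after all.\<close>
        have "(BB p - BB p0) * Q2 s = 0" using f0s fps unfolding lin_expr_def left_diff_distrib by linarith
        then have "Q2 s = 0" using False by simp
        then have q: "Q s = s * Q1 s" using fps by (simp add: lin_expr_def)
        have k: "(s * Q s + (B - s\<^sup>2) * Q1 s) / B = Q1 s" if "B > 0" for B
          using that unfolding q by (simp add: field_simps power2_eq_square)
        show ?thesis
          using sol unfolding sT_num_def c1 c2 k[OF BB_pos[OF p]] k[OF BB_pos[OF p0(1,2)]] by (simp add: q)
      qed
    qed
    then show ?thesis using ratio_imp_phi_explicit p0 by blast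
  qed
qed

lemma T_imp_sigma_T:
  assumes "T_condition A a b \<phi> I" "admissible_function A \<sigma>"
  shows "sigma_T_condition A a b \<phi> I"
  using assms ab_fibre.sT_zero_if_T_zero[OF fibre] unfolding sigma_T_iff T_iff by blast

lemma explicit_imp_sigma_T:
  assumes "phi_explicit A a b \<phi> I" and \<sigma>: "admissible_function A \<sigma>" "parallel_differential A b \<sigma>"
  shows "sigma_T_condition A a b \<phi> I"
proof -
  obtain c1 c2 c3 where e: "\<And>p s. p \<in> pts \<Longrightarrow> s \<in> I \<Longrightarrow> \<bar>s\<bar> \<le> sqrt (BB p) \<Longrightarrow>
        interval_lebesgue_integrable lborel 0 (ereal s) (sT_integrand (BB p) c1 c2) \<and>
        \<phi> s = c3 * exp (LBINT t=0..ereal s. sT_integrand (BB p) c1 c2 t)"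
    using assms(1) unfolding explicit_iff by blast
  have "ab_fibre.sT (a (fst p) (snd p)) (bb p) \<phi> (sig \<sigma> p) i j k y = 0"
    if p: "p \<in> pts" and y: "y \<in> cone_at p" for p y i j k
  proof -
    interpret f: ab_fibre "a (fst p) (snd p)" "bb p" \<phi> I by (rule fibre[OF p])
    show ?thesis
    proof (cases "bb p = 0")
      case True
      show ?thesis by (rule f.sT_zero_if_T_zero) (rule f.T_zero_if_b_zero[OF True y])
    next
      case False
      then obtain i0 where i0: "bb p $ i0 \<noteq> 0" by (auto simp: vec_eq_iff)
      have "bb p $ i0 * sig \<sigma> p $ j = bb p $ j * sig \<sigma> p $ i0" for j
        using \<sigma>(2) p by (auto simp: parallel_differential_def pts_def sig_def)
      then have "sig \<sigma> p = (sig \<sigma> p $ i0 / bb p $ i0) *\<^sub>R bb p"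
        using i0 by (simp add: vec_eq_iff field_simps)
      moreover have "f.sT (w *\<^sub>R bb p) i j k y = 0" for w
        by (rule f.sT_zero_if_lin_expr[OF False convex_I _ y], rule f.lin_expr_zero_if_explicit[OF False convex_I])
          (use e[OF p] in auto)
      ultimately show ?thesis by metis
    qed
  qed
  then show ?thesis unfolding sigma_T_iff using \<sigma>(1) by blast
qed

end

text \<open>The T-condition makes the contraction vanish for every \<sigma>, so its implication asks
  only for some admissible function. For the explicit family the contraction is shown to vanish when
  d\<sigma> is parallel to \<beta>; whether such a \<sigma> exists depends on the manifold and
  \<beta>, not on \<phi>, and therefore appears as a hypothesis of the equivalence.\<close>

theorem theorem4p2:
  fixes A :: "('m::{t2_space, second_countable_topology}, 'n::finite) chart set"
    and a :: "('m, 'n) chart \<Rightarrow> real^'n \<Rightarrow> real^'n^'n"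
    and b :: "('m, 'n) chart \<Rightarrow> real^'n \<Rightarrow> real^'n"
    and \<phi> :: "real \<Rightarrow> real" and I :: "real set" and b0 :: real
  assumes "CARD('n) \<ge> 3"
    and "smooth_atlas A"
    and "ab_metric A a b \<phi> I b0"
  shows "(sigma_T_condition A a b \<phi> I \<longrightarrow> T_condition A a b \<phi> I \<or> phi_explicit A a b \<phi> I) \<and>
         ((\<exists>\<sigma>. admissible_function A \<sigma>) \<longrightarrow>
            T_condition A a b \<phi> I \<longrightarrow> sigma_T_condition A a b \<phi> I) \<and>
         ((\<exists>\<sigma>. admissible_function A \<sigma> \<and> parallel_differential A b \<sigma>) \<longrightarrow>
            (sigma_T_condition A a b \<phi> I \<longleftrightarrow> T_condition A a b \<phi> I \<or> phi_explicit A a b \<phi> I))"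
proof -
  interpret ab_space A a b \<phi> I b0
    using assms by unfold_locales
  show ?thesis
    using sigma_T_imp T_imp_sigma_T explicit_imp_sigma_T by blast
qed

end
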